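(* Let $d\ge2$, let $\Omega\subset\mathbb{R}^d$ be a bounded smooth domain and let $\gamma\in L^\infty(\Omega)$ be a conductivity. For $\xi\in\mathbb{R}^d$, let $\eta_1,\eta_2\in\mathbb{C}^d$ be such that $\eta_1\cdot\eta_1=\eta_2\cdot\eta_2=0$ and $\eta_1+\eta_2=-i\xi$. If $\gamma^{\mathrm{B}}_1\in L^\infty(\Omega)+\mathcal{E}'(\Omega)$ exists, that is, $\mathrm{d}\Phi_1(\gamma^{\mathrm{B}}_1)=\Lambda_\gamma$, then $$\mathcal{F}\gamma^{\mathrm{B}}_1(\xi)=-\frac{2}{|\xi|^2}\langle e_{\eta_1},\Lambda_\gamma e_{\eta_2}\rangle_{H^{1/2}\times H^{-1/2}},\qquad\forall\xi\in\mathbb{R}^d\setminus\{0\}.$$ As a consequence, $\gamma^{\mathrm{B}}_1$ is uniquely determined by $\Lambda_\gamma$ in $L^\infty(\Omega)+\mathcal{E}'(\Omega)$.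
   Context: A conductivity is a real-valued $\gamma\in L^\infty(\Omega)$ with $\gamma\ge c$ a.e. for some $c>0$. For $f\in H^{1/2}(\partial\Omega)$, $u_f^\gamma\in H^1(\Omega)$ is the unique solution of $-\nabla\cdot(\gamma\nabla u_f^\gamma)=0$ in $\Omega$, $u_f^\gamma=f$ on $\partial\Omega$. The Dirichlet-to-Neumann map $\Lambda_\gamma:H^{1/2}(\partial\Omega)\to H^{-1/2}(\partial\Omega)$ is given by $\langle f,\Lambda_\gamma g\rangle_{H^{1/2}\times H^{-1/2}}=\int_\Omega\gamma\,\nabla u_f\cdot\nabla u_g^\gamma\,\mathrm{d}x$ for any $u_f\in H^1(\Omega)$ with $u_f|_{\partial\Omega}=f$; the pairing is bilinear (no complex conjugation). $\Phi(\gamma):=\Lambda_\gamma$, and $\mathrm{d}\Phi_1$ is its Fréchet differential at the constant conductivity $1$: for $F\in L^\infty(\Omega)$ (complex valued), $\langle f,\mathrm{d}\Phi_1(F)g\rangle_{H^{1/2}\times H^{-1/2}}=\int_\Omega F\,\nabla u_f^1\cdot\nabla u_g^1\,\mathrm{d}x$. With $\mathcal{E}'(\Omega)$ the space of distributions with compact support contained in $\Omega$, it is extended linearly to $L^\infty(\Omega)+\mathcal{E}'(\Omega)$ by $\langle f,\mathrm{d}\Phi_1(F)g\rangle:=\langle F,\chi\nabla u_f^1\cdot\nabla u_g^1\rangle_{\mathcal{E}'\times\mathcal{C}^\infty}$ for $F\in\mathcal{E}'(\Omega)$, where $\chi\in\mathcal{C}_c^\infty(\Omega)$, $\chi F=F$.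 For $\eta\in\mathbb{C}^d$, $e_\eta(x):=e^{\eta\cdot x}$, where $\eta\cdot x$ and $\eta\cdot\eta$ are bilinear (no conjugation); in the boundary pairing $e_\eta$ is restricted to $\partial\Omega$. The Fourier transform of $f\in L^1(\Omega)$ is $\mathcal{F}f(\xi):=\int_\Omega e^{-ix\cdot\xi}f(x)\,\mathrm{d}x$; it is extended to $L^1(\Omega)+\mathcal{E}'(\Omega)$ by replacing the integral with the distributional duality pairing on $\mathbb{R}^d$ (functions on $\Omega$ being extended by zero). *)

theory Defs
  imports "HOL-Analysis.Analysis"
begin

section \<open>Smooth functions and bounded smooth domains\<close>

definition partial :: "'n::finite \<Rightarrow> (real^'n \<Rightarrow> 'a::real_normed_vector) \<Rightarrow> real^'n \<Rightarrow> 'a" where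
  "partial i f = (\<lambda>x. frechet_derivative f (at x) (axis i 1))"

text \<open>Multi-indices are lists of coordinates.\<close>

fun partials :: "'n::finite list \<Rightarrow> (real^'n \<Rightarrow> 'a::real_normed_vector) \<Rightarrow> real^'n \<Rightarrow> 'a" where
  "partials [] f = f"
| "partials (i # is) f = partial i (partials is f)"

text \<open>Intended for open \<open>S\<close>. Differentiability of the iterated partial derivatives of every order makes
  all of them continuous, so this is \<open>C\<^sup>\<infinity>(S)\<close>.\<close>

definition smooth_on :: "(real^'n::finite) set \<Rightarrow> (real^'n \<Rightarrow> 'a::real_normed_vector) \<Rightarrow> bool" where
  "smooth_on S f \<longleftrightarrow> (\<forall>is. \<forall>x\<in>S. partials is f differentiable (at x))"

definition cgrad :: "(real^'n::finite \<Rightarrow> complex) \<Rightarrow> real^'n \<Rightarrow> complex^'n" where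
  "cgrad f x = (\<chi> i. partial i f x)"

text \<open>After relabelling and reorienting the axes (the choice of the coordinate \<open>k\<close> and the sign \<open>s\<close>),
  \<open>\<Omega>\<close> lies locally on one side of the graph of a smooth function \<open>h\<close> of the remaining \<open>d - 1\<close> variables.\<close>

definition smooth_boundary :: "(real^'n::finite) set \<Rightarrow> bool" where
  "smooth_boundary \<Omega> \<longleftrightarrow>
    (\<forall>p\<in>frontier \<Omega>. \<exists>r>0. \<exists>k. \<exists>s\<in>{-1, 1}. \<exists>h :: real^'n \<Rightarrow> real.
       smooth_on UNIV h \<and>
       (\<forall>x y. (\<forall>j. j \<noteq> k \<longrightarrow> x $ j = y $ j) \<longrightarrow> h x = h y) \<and>
       \<Omega> \<inter> ball p r = {x \<in> ball p r. s * x $ k > h x})"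

definition bounded_smooth_domain :: "(real^'n::finite) set \<Rightarrow> bool" where
  "bounded_smooth_domain \<Omega> \<longleftrightarrow>
     open \<Omega> \<and> connected \<Omega> \<and> \<Omega> \<noteq> {} \<and> bounded \<Omega> \<and> smooth_boundary \<Omega>"


section \<open>Bilinear products and exponentials\<close>

definition bdot :: "complex^'n::finite \<Rightarrow> complex^'n \<Rightarrow> complex" where
  "bdot a b = (\<Sum>i\<in>UNIV. a $ i * b $ i)"

definition cvec :: "real^'n::finite \<Rightarrow> complex^'n" where
  "cvec x = (\<chi> i. complex_of_real (x $ i))"

definition e_exp :: "complex^'n::finite \<Rightarrow> real^'n \<Rightarrow> complex" where
  "e_exp \<eta> x = exp (bdot \<eta> (cvec x))"


section \<open>Lebesgue spaces, weak gradients and \<open>H\<^sup>1\<close>\<close>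

text \<open>Elements of function spaces are represented by functions on all of \<open>\<real>\<^sup>d\<close>; only their values
  almost everywhere on \<open>\<Omega>\<close> (or on \<open>\<partial>\<Omega>\<close>) matter.\<close>

definition L1 :: "(real^'n::finite) set \<Rightarrow> (real^'n \<Rightarrow> complex) set" where
  "L1 \<Omega> = {f. integrable (lebesgue_on \<Omega>) f}"

definition L2 :: "(real^'n::finite) set \<Rightarrow> (real^'n \<Rightarrow> 'a::euclidean_space) set" where
  "L2 \<Omega> = {f. f \<in> borel_measurable (lebesgue_on \<Omega>) \<and>
              integrable (lebesgue_on \<Omega>) (\<lambda>x. (norm (f x))\<^sup>2)}"

definition Linf :: "(real^'n::finite) set \<Rightarrow> (real^'n \<Rightarrow> 'a::euclidean_space) set" where
  "Linf \<Omega> = {f. f \<in> borel_measurable (lebesgue_on \<Omega>) \<and>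
                (\<exists>C. AE x in lebesgue_on \<Omega>. norm (f x) \<le> C)}"

definition conductivity :: "(real^'n::finite) set \<Rightarrow> (real^'n \<Rightarrow> real) \<Rightarrow> bool" where
  "conductivity \<Omega> \<gamma> \<longleftrightarrow> \<gamma> \<in> Linf \<Omega> \<and> (\<exists>c>0. AE x in lebesgue_on \<Omega>. c \<le> \<gamma> x)"

definition supp :: "(real^'n::finite \<Rightarrow> complex) \<Rightarrow> (real^'n) set" where
  "supp \<phi> = closure {x. \<phi> x \<noteq> 0}"

text \<open>\<open>C\<^sub>c\<^sup>\<infinity>(\<Omega>)\<close>, its members being extended by zero to \<open>\<real>\<^sup>d\<close>.\<close>

definition test_fun :: "(real^'n::finite) set \<Rightarrow> (real^'n \<Rightarrow> complex) set" where
  "test_fun \<Omega> = {\<phi>. smooth_on UNIV \<phi> \<and> compact (supp \<phi>) \<and> supp \<phi> \<subseteq> \<Omega>}"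

definition weak_gradient ::
    "(real^'n::finite) set \<Rightarrow> (real^'n \<Rightarrow> complex) \<Rightarrow> (real^'n \<Rightarrow> complex^'n) \<Rightarrow> bool" where
  "weak_gradient \<Omega> u G \<longleftrightarrow>
     (\<forall>\<phi>\<in>test_fun \<Omega>. \<forall>i. (LINT x|lebesgue_on \<Omega>. u x * partial i \<phi> x)
                         = - (LINT x|lebesgue_on \<Omega>. G x $ i * \<phi> x))"

definition H1 :: "(real^'n::finite) set \<Rightarrow> (real^'n \<Rightarrow> complex) set" where
  "H1 \<Omega> = {u \<in> L2 \<Omega>. \<exists>G\<in>L2 \<Omega>. weak_gradient \<Omega> u G}"

definition wgrad :: "(real^'n::finite) set \<Rightarrow> (real^'n \<Rightarrow> complex) \<Rightarrow> real^'n \<Rightarrow> complex^'n" where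
  "wgrad \<Omega> u = (SOME G. G \<in> L2 \<Omega> \<and> weak_gradient \<Omega> u G)"

definition H1_norm :: "(real^'n::finite) set \<Rightarrow> (real^'n \<Rightarrow> complex) \<Rightarrow> real" where
  "H1_norm \<Omega> u = sqrt ((LINT x|lebesgue_on \<Omega>. (norm (u x))\<^sup>2)
                     + (LINT x|lebesgue_on \<Omega>. (norm (wgrad \<Omega> u x))\<^sup>2))"


section \<open>Surface measure, traces and \<open>H\<^bsup>1/2\<^esup>\<close>\<close>

text \<open>Normalised so that \<open>s\<close>-dimensional Hausdorff measure is the \<open>s\<close>-dimensional area; used with
  \<open>s = d - 1 \<ge> 1\<close>.\<close>

definition hausdorff_outer :: "nat \<Rightarrow> 'a::metric_space set \<Rightarrow> ennreal" where
  "hausdorff_outer s A =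
     ennreal (unit_ball_vol (real s) / 2 ^ s) *
     (SUP \<delta>\<in>{0::real<..}.
        INF C\<in>{C :: nat \<Rightarrow> 'a set. A \<subseteq> (\<Union>n. C n) \<and> (\<forall>n. bounded (C n) \<and> diameter (C n) \<le> \<delta>)}.
          (\<Sum>n. ennreal (diameter (C n) ^ s)))"

definition surface_measure :: "(real^'n::finite) set \<Rightarrow> (real^'n) measure" where
  "surface_measure \<Omega> =
     restrict_space (measure_of UNIV (sets borel) (hausdorff_outer (CARD('n) - 1))) (frontier \<Omega>)"

text \<open>The trace operator is the closure in \<open>H\<^sup>1(\<Omega>) \<times> L\<^sup>2(\<partial>\<Omega>)\<close> of the restriction map on functions
  smooth up to the boundary; \<open>has_trace \<Omega> u f\<close> means \<open>u = f\<close> on \<open>\<partial>\<Omega>\<close>.\<close>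

definition has_trace ::
    "(real^'n::finite) set \<Rightarrow> (real^'n \<Rightarrow> complex) \<Rightarrow> (real^'n \<Rightarrow> complex) \<Rightarrow> bool" where
  "has_trace \<Omega> u f \<longleftrightarrow>
     u \<in> H1 \<Omega> \<and> f \<in> borel_measurable (surface_measure \<Omega>) \<and>
     (\<exists>\<phi> :: nat \<Rightarrow> real^'n \<Rightarrow> complex.
        (\<forall>n. smooth_on UNIV (\<phi> n)) \<and>
        (\<lambda>n. H1_norm \<Omega> (\<lambda>x. \<phi> n x - u x)) \<longlonglongrightarrow> 0 \<and>
        (\<lambda>n. \<integral>\<^sup>+ x. ennreal ((norm (\<phi> n x - f x))\<^sup>2) \<partial>surface_measure \<Omega>) \<longlonglongrightarrow> 0)"

definition H_half :: "(real^'n::finite) set \<Rightarrow> (real^'n \<Rightarrow> complex) set" where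
  "H_half \<Omega> = {f. \<exists>u. has_trace \<Omega> u f}"

text \<open>An element of \<open>H\<^bsup>-1/2\<^esup>(\<partial>\<Omega>)\<close>, the dual of \<open>H\<^bsup>1/2\<^esup>(\<partial>\<Omega>)\<close>, is represented by its action on
  \<open>H_half \<Omega>\<close>. The pairing is bilinear.\<close>

type_synonym 'n boundary_functional = "(real^'n \<Rightarrow> complex) \<Rightarrow> complex"

definition bpair :: "(real^'n::finite \<Rightarrow> complex) \<Rightarrow> 'n boundary_functional \<Rightarrow> complex" where
  "bpair f \<psi> = \<psi> f"

text \<open>Equality of two maps from \<open>H\<^bsup>1/2\<^esup>(\<partial>\<Omega>)\<close> to \<open>H\<^bsup>-1/2\<^esup>(\<partial>\<Omega>)\<close>.\<close>

definition same_operator ::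
    "(real^'n::finite) set \<Rightarrow> ((real^'n \<Rightarrow> complex) \<Rightarrow> 'n boundary_functional)
       \<Rightarrow> ((real^'n \<Rightarrow> complex) \<Rightarrow> 'n boundary_functional) \<Rightarrow> bool" where
  "same_operator \<Omega> A B \<longleftrightarrow> (\<forall>g\<in>H_half \<Omega>. \<forall>f\<in>H_half \<Omega>. bpair f (A g) = bpair f (B g))"


section \<open>The conductivity equation and the Dirichlet-to-Neumann map\<close>

text \<open>The weak form of \<open>-\<nabla>\<cdot>(\<gamma>\<nabla>u) = 0\<close> in \<open>\<Omega>\<close>, \<open>u = f\<close> on \<open>\<partial>\<Omega>\<close>; the test functions are those of
  \<open>H\<^sup>1\<^sub>0(\<Omega>)\<close>, the elements of \<open>H\<^sup>1(\<Omega>)\<close> with zero trace.\<close>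

definition weak_solution ::
    "(real^'n::finite) set \<Rightarrow> (real^'n \<Rightarrow> real) \<Rightarrow> (real^'n \<Rightarrow> complex) \<Rightarrow> (real^'n \<Rightarrow> complex) \<Rightarrow> bool" where
  "weak_solution \<Omega> \<gamma> f u \<longleftrightarrow>
     u \<in> H1 \<Omega> \<and> has_trace \<Omega> u f \<and>
     (\<forall>v. has_trace \<Omega> v (\<lambda>_. 0) \<longrightarrow>
        (LINT x|lebesgue_on \<Omega>. complex_of_real (\<gamma> x) * bdot (wgrad \<Omega> u x) (wgrad \<Omega> v x)) = 0)"

text \<open>The solution is unique up to null sets, so \<open>SOME\<close> picks a representative. In the
  Dirichlet-to-Neumann map the value does not depend on the chosen extension of \<open>f\<close> either.\<close>

definition sol :: "(real^'n::finite) set \<Rightarrow> (real^'n \<Rightarrow> real) \<Rightarrow> (real^'n \<Rightarrow> complex) \<Rightarrow> real^'n \<Rightarrow> complex" where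
  "sol \<Omega> \<gamma> f = (SOME u. weak_solution \<Omega> \<gamma> f u)"

definition extension :: "(real^'n::finite) set \<Rightarrow> (real^'n \<Rightarrow> complex) \<Rightarrow> real^'n \<Rightarrow> complex" where
  "extension \<Omega> f = (SOME u. has_trace \<Omega> u f)"

definition DN_map ::
    "(real^'n::finite) set \<Rightarrow> (real^'n \<Rightarrow> real) \<Rightarrow> (real^'n \<Rightarrow> complex) \<Rightarrow> 'n boundary_functional" where
  "DN_map \<Omega> \<gamma> g = (\<lambda>f. LINT x|lebesgue_on \<Omega>.
     complex_of_real (\<gamma> x) * bdot (wgrad \<Omega> (extension \<Omega> f) x) (wgrad \<Omega> (sol \<Omega> \<gamma> g) x))"


section \<open>Distributions with compact support\<close>

text \<open>Functionals are only relevant on \<open>test_fun \<Omega>\<close>. The last clause bounds \<open>T \<phi>\<close> by a constant times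
  the \<open>C\<^sup>N\<close> norm of \<open>\<phi>\<close>, uniformly over \<open>\<phi>\<close> supported in \<open>K\<close>.\<close>

definition distribution_on :: "(real^'n::finite) set \<Rightarrow> ((real^'n \<Rightarrow> complex) \<Rightarrow> complex) \<Rightarrow> bool" where
  "distribution_on \<Omega> T \<longleftrightarrow>
     (\<forall>a b. \<forall>\<phi>\<in>test_fun \<Omega>. \<forall>\<psi>\<in>test_fun \<Omega>. T (\<lambda>x. a * \<phi> x + b * \<psi> x) = a * T \<phi> + b * T \<psi>) \<and>
     (\<forall>K. compact K \<and> K \<subseteq> \<Omega> \<longrightarrow>
        (\<exists>C N. \<forall>\<phi>\<in>test_fun \<Omega>. supp \<phi> \<subseteq> K \<longrightarrow>
           (\<forall>M. (\<forall>is x. length is \<le> N \<longrightarrow> norm (partials is \<phi> x) \<le> M) \<longrightarrow> norm (T \<phi>) \<le> C * M)))"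

definition E_prime :: "(real^'n::finite) set \<Rightarrow> ((real^'n \<Rightarrow> complex) \<Rightarrow> complex) set" where
  "E_prime \<Omega> = {T. distribution_on \<Omega> T \<and>
     (\<exists>K. compact K \<and> K \<subseteq> \<Omega> \<and> (\<forall>\<phi>\<in>test_fun \<Omega>. supp \<phi> \<inter> K = {} \<longrightarrow> T \<phi> = 0))}"

text \<open>The cutoff \<open>\<kappa> \<in> C\<^sub>c\<^sup>\<infinity>(\<Omega>)\<close> with \<open>\<kappa>T = T\<close>, and the pairing of \<open>T \<in> E'(\<Omega>)\<close> with \<open>\<phi> \<in> C\<^sup>\<infinity>(\<Omega>)\<close>,
  which does not depend on the choice of \<open>\<kappa>\<close>.\<close>

definition cutoff :: "(real^'n::finite) set \<Rightarrow> ((real^'n \<Rightarrow> complex) \<Rightarrow> complex) \<Rightarrow> real^'n \<Rightarrow> complex" where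
  "cutoff \<Omega> T = (SOME \<kappa>. \<kappa> \<in> test_fun \<Omega> \<and> (\<forall>\<phi>\<in>test_fun \<Omega>. T (\<lambda>x. \<kappa> x * \<phi> x) = T \<phi>))"

definition E_pair ::
    "(real^'n::finite) set \<Rightarrow> ((real^'n \<Rightarrow> complex) \<Rightarrow> complex) \<Rightarrow> (real^'n \<Rightarrow> complex) \<Rightarrow> complex" where
  "E_pair \<Omega> T \<phi> = T (\<lambda>x. cutoff \<Omega> T x * \<phi> x)"

text \<open>\<open>T = F + S\<close> as distributions on \<open>\<Omega>\<close>, with \<open>F\<close> in the function space \<open>V\<close> and \<open>S\<close> in \<open>E'(\<Omega>)\<close>.\<close>

definition decomposition ::
    "(real^'n \<Rightarrow> complex) set \<Rightarrow> (real^'n::finite) set \<Rightarrow> ((real^'n \<Rightarrow> complex) \<Rightarrow> complex)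
       \<Rightarrow> (real^'n \<Rightarrow> complex) \<times> ((real^'n \<Rightarrow> complex) \<Rightarrow> complex) \<Rightarrow> bool" where
  "decomposition V \<Omega> T = (\<lambda>(F, S). F \<in> V \<and> S \<in> E_prime \<Omega> \<and>
     (\<forall>\<phi>\<in>test_fun \<Omega>. T \<phi> = (LINT x|lebesgue_on \<Omega>. F x * \<phi> x) + S \<phi>))"

definition plus_E_prime ::
    "(real^'n \<Rightarrow> complex) set \<Rightarrow> (real^'n::finite) set \<Rightarrow> ((real^'n \<Rightarrow> complex) \<Rightarrow> complex) set" where
  "plus_E_prime V \<Omega> = {T. \<exists>D. decomposition V \<Omega> T D}"

definition distribution_eq ::
    "(real^'n::finite) set \<Rightarrow> ((real^'n \<Rightarrow> complex) \<Rightarrow> complex) \<Rightarrow> ((real^'n \<Rightarrow> complex) \<Rightarrow> complex) \<Rightarrow> bool" where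
  "distribution_eq \<Omega> T T' \<longleftrightarrow> (\<forall>\<phi>\<in>test_fun \<Omega>. T \<phi> = T' \<phi>)"


section \<open>The differential at the conductivity 1 and the Fourier transform\<close>

definition dPhi1_Linf ::
    "(real^'n::finite) set \<Rightarrow> (real^'n \<Rightarrow> complex) \<Rightarrow> (real^'n \<Rightarrow> complex) \<Rightarrow> 'n boundary_functional" where
  "dPhi1_Linf \<Omega> F g = (\<lambda>f. LINT x|lebesgue_on \<Omega>.
     F x * bdot (wgrad \<Omega> (sol \<Omega> (\<lambda>_. 1) f) x) (wgrad \<Omega> (sol \<Omega> (\<lambda>_. 1) g) x))"

text \<open>The representative of \<open>u\<^sub>f\<^sup>1\<close> that is smooth in \<open>\<Omega>\<close> (Weyl's lemma): a distribution needs a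
  pointwise smooth argument.\<close>

definition harmonic_sol :: "(real^'n::finite) set \<Rightarrow> (real^'n \<Rightarrow> complex) \<Rightarrow> real^'n \<Rightarrow> complex" where
  "harmonic_sol \<Omega> f = (SOME u. weak_solution \<Omega> (\<lambda>_. 1) f u \<and> smooth_on \<Omega> u)"

definition dPhi1_E ::
    "(real^'n::finite) set \<Rightarrow> ((real^'n \<Rightarrow> complex) \<Rightarrow> complex) \<Rightarrow> (real^'n \<Rightarrow> complex) \<Rightarrow> 'n boundary_functional" where
  "dPhi1_E \<Omega> S g =
     (\<lambda>f. E_pair \<Omega> S (\<lambda>x. bdot (cgrad (harmonic_sol \<Omega> f) x) (cgrad (harmonic_sol \<Omega> g) x)))"

text \<open>The linear extensions to \<open>L\<^sup>\<infinity>(\<Omega>) + E'(\<Omega>)\<close> and to \<open>L\<^sup>1(\<Omega>) + E'(\<Omega>)\<close>; neither depends on the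
  decomposition chosen, because the two prescriptions agree on functions with compact support in \<open>\<Omega>\<close>.\<close>

definition dPhi1 ::
    "(real^'n::finite) set \<Rightarrow> ((real^'n \<Rightarrow> complex) \<Rightarrow> complex) \<Rightarrow> (real^'n \<Rightarrow> complex) \<Rightarrow> 'n boundary_functional" where
  "dPhi1 \<Omega> T g =
     (let (F, S) = (SOME D. decomposition (Linf \<Omega>) \<Omega> T D)
      in (\<lambda>f. dPhi1_Linf \<Omega> F g f + dPhi1_E \<Omega> S g f))"

definition fourier_L1 :: "(real^'n::finite) set \<Rightarrow> (real^'n \<Rightarrow> complex) \<Rightarrow> real^'n \<Rightarrow> complex" where
  "fourier_L1 \<Omega> F \<xi> = (LINT x|lebesgue_on \<Omega>. exp (- \<i> * complex_of_real (x \<bullet> \<xi>)) * F x)"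

definition fourier_E :: "(real^'n::finite) set \<Rightarrow> ((real^'n \<Rightarrow> complex) \<Rightarrow> complex) \<Rightarrow> real^'n \<Rightarrow> complex" where
  "fourier_E \<Omega> S \<xi> = E_pair \<Omega> S (\<lambda>x. exp (- \<i> * complex_of_real (x \<bullet> \<xi>)))"

definition fourier :: "(real^'n::finite) set \<Rightarrow> ((real^'n \<Rightarrow> complex) \<Rightarrow> complex) \<Rightarrow> real^'n \<Rightarrow> complex" where
  "fourier \<Omega> T \<xi> =
     (let (F, S) = (SOME D. decomposition (L1 \<Omega>) \<Omega> T D)
      in fourier_L1 \<Omega> F \<xi> + fourier_E \<Omega> S \<xi>)"

end

theory Submission
  imports Defs
begin

text \<open>The product of two isotropic exponentials has gradient product
  \<open>\<nabla>e\<^bsub>\<eta>1\<^esub> \<cdot> \<nabla>e\<^bsub>\<eta>2\<^esub> = (\<eta>1 \<cdot> \<eta>2) e\<^bsub>\<eta>1+\<eta>2\<^esub>\<close>, and \<open>2 \<eta>1 \<cdot> \<eta>2 = (-i\<xi>) \<cdot> (-i\<xi>) = -|\<xi>|\<^sup>2\<close>. Since both exponentials are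
  harmonic, testing \<open>d\<Phi>\<^sub>1(F) = \<Lambda>\<close> against them reads off \<open>F\<close> at the frequency \<open>\<xi>\<close>.

  That an exponential is its own harmonic extension needs Green's formula, but only as a bound of
  \<open>\<integral>\<^sub>\<Omega> \<partial>\<^sub>i\<psi>\<close> by the \<open>L\<^sup>2\<close> norm of \<open>\<psi>\<close> on the boundary. The integral is the limit of
  \<open>(1/t) (\<integral>\<^sub>\<Omega>\<^sub>+\<^sub>t\<^sub>e \<psi> - \<integral>\<^sub>\<Omega> \<psi>)\<close>, and the symmetric difference of \<open>\<Omega> + te\<close> and \<open>\<Omega>\<close> lies in finitely many
  strips of width \<open>O(t)\<close> around graphs; projecting a strip to its graph costs a factor \<open>O(t)\<close> against
  Hausdorff measure. This uses neither a partition of unity nor Fubini.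

  For uniqueness, every test function is the limit, with all derivatives, of trigonometric polynomials
  without constant term: convolve with a concentrating trigonometric kernel whose frequencies lie in a
  shifted lattice that misses \<open>0\<close>, where the formula says nothing.\<close>

section \<open>Smooth functions\<close>

text \<open>Gradients, solutions, cutoffs and decompositions are all chosen by \<open>SOME\<close>,
  so each carries two obligations: something must satisfy the choice predicate, and the value
  computed from it must not depend on the choice. For isotropic exponentials the exponential itself
  is the witness; testing with the conjugate of a difference shows that solutions with the same
  boundary values share their gradient; and two decompositions of one distribution have function
  parts that agree almost everywhere outside a compact set. The boundary estimate owes its form to
  the definition of the trace as a limit. Zero trace only supplies smooth functions whose boundary
  values tend to 0 in \<open>L2\<close>, while their Lipschitz constants may blow up. The constant
  must therefore be uniform in \<psi>. On a strip of width \<open>O(t)\<close> every error that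
  depends on \<psi> is of order \<open>t ^ 3\<close>, and it disappears from the final bound as
  \<open>t\<close> tends to 0. A kernel that concentrates at 0 with frequencies in a shifted lattice
  cannot be positive. It is a positive kernel times a wave of modulus 1, and only the value 1 of
  that wave at the origin matters in the limit.\<close>

text \<open>\<open>diff_upto n\<close> asks for derivatives up to order \<open>n + 1\<close>.\<close>

fun diff_upto :: "nat \<Rightarrow> (real^'n::finite) set \<Rightarrow> (real^'n \<Rightarrow> 'a::real_normed_vector) \<Rightarrow> bool" where
  "diff_upto 0 S f \<longleftrightarrow> (\<forall>x\<in>S. f differentiable (at x))"
| "diff_upto (Suc n) S f \<longleftrightarrow> (\<forall>x\<in>S. f differentiable (at x)) \<and> (\<forall>i. diff_upto n S (partial i f))"

lemma partials_snoc: "partials (is @ [i]) f = partials is (partial i f)"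
  by (induction "is") auto

lemma diff_upto_iff:
  "diff_upto n S f \<longleftrightarrow> (\<forall>is. length is \<le> n \<longrightarrow> (\<forall>x\<in>S. partials is f differentiable (at x)))"
proof (induction n arbitrary: f)
  case (Suc n)
  have "(\<forall>is. length is \<le> Suc n \<longrightarrow> (\<forall>x\<in>S. partials is f differentiable (at x))) \<longleftrightarrow>
        (\<forall>x\<in>S. f differentiable (at x)) \<and>
        (\<forall>i js. length js \<le> n \<longrightarrow> (\<forall>x\<in>S. partials (js @ [i]) f differentiable (at x)))"
    (is "?L \<longleftrightarrow> ?R")
  proof
    assume L: ?L
    have "partials (js @ [i]) f differentiable (at x)" if "length js \<le> n" "x \<in> S" for i js x
      using L that by auto
    moreover have "f differentiable (at x)" if "x \<in> S" for x
      using L[rule_format, of "[]" x] that by simp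
    ultimately show ?R by blast
  next
    assume R: ?R
    show ?L
    proof (intro allI impI ballI)
      fix "is" :: "'a list" and x assume "length is \<le> Suc n" "x \<in> S"
      then show "partials is f differentiable (at x)"
        using R by (cases "is" rule: rev_cases) auto
    qed
  qed
  then show ?case by (simp add: Suc.IH partials_snoc)
qed auto

lemma smooth_on_iff_diff_upto: "smooth_on S f \<longleftrightarrow> (\<forall>n. diff_upto n S f)"
  unfolding smooth_on_def diff_upto_iff by blast

lemma diff_upto_differentiable: "diff_upto n S f \<Longrightarrow> x \<in> S \<Longrightarrow> f differentiable (at x)"
  by (cases n) auto

lemma diff_upto_antimono: "diff_upto m S f \<Longrightarrow> n \<le> m \<Longrightarrow> diff_upto n S f"
  unfolding diff_upto_iff by auto

lemma diff_upto_SucD: "diff_upto (Suc n) S f \<Longrightarrow> diff_upto n S f"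
  by (rule diff_upto_antimono[where m="Suc n"]) auto

section \<open>Locality and calculus of finite differentiability\<close>

lemma partial_eq:
  assumes "(f has_derivative f') (at x)"
  shows "partial i f x = f' (axis i 1)"
  using frechet_derivative_at[OF assms] by (simp add: partial_def)

lemma partial_cong_open:
  assumes "open S" "x \<in> S" "\<And>y. y \<in> S \<Longrightarrow> f y = g y" "f differentiable (at x)"
  shows "partial i f x = partial i g x"
  using frechet_derivative_transform_within_open[OF assms(4,1,2), of g] assms(3) by (simp add: partial_def)

lemma differentiable_cong_open:
  assumes "open S" "x \<in> S" "\<And>y. y \<in> S \<Longrightarrow> f y = g y" "f differentiable (at x)"
  shows "g differentiable (at x)"
proof -
  have "(f has_derivative frechet_derivative f (at x)) (at x)"
    using assms(4) frechet_derivative_works by blast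
  from has_derivative_transform_within_open[OF this assms(1-3)] show ?thesis
    by (auto simp: differentiable_def)
qed

text \<open>On an open set the derivative at a point depends only on nearby values, so equality on
  \<open>S\<close> passes to the partial derivatives and, by induction, to all orders.\<close>

lemma diff_upto_cong:
  assumes "open S" "\<And>x. x \<in> S \<Longrightarrow> f x = g x" "diff_upto n S f"
  shows "diff_upto n S g"
  using assms(2,3)
proof (induction n arbitrary: f g)
  case 0
  then show ?case using differentiable_cong_open[OF assms(1), of _ f g] by auto
next
  case (Suc n)
  have d: "f differentiable (at x)" if "x \<in> S" for x
    using Suc.prems that by auto
  have "g differentiable (at x)" if x: "x \<in> S" for x
    by (rule differentiable_cong_open[OF assms(1) x Suc.prems(1) d[OF x]])
  moreover have "diff_upto n S (partial i g)" for i
  proof (rule Suc.IH)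
    show "partial i f x = partial i g x" if x: "x \<in> S" for x
      by (rule partial_cong_open[OF assms(1) x Suc.prems(1) d[OF x]])
    show "diff_upto n S (partial i f)" using Suc.prems(2) by auto
  qed
  ultimately show ?case by auto
qed

text \<open>Reduces closure under an operation to its derivative formula: if the coefficients of the
  formula have order \<open>n\<close>, the function has order \<open>n + 1\<close>. The inductions
  below for sums, products and compositions all run through this step.\<close>

lemma diff_upto_SucI:
  assumes "open S" "\<And>x. x \<in> S \<Longrightarrow> (f has_derivative f' x) (at x)"
    "\<And>i. diff_upto n S (\<lambda>x. f' x (axis i 1))"
  shows "diff_upto (Suc n) S f"
proof -
  have "diff_upto n S (partial i f)" for i
    by (rule diff_upto_cong[OF assms(1) _ assms(3)[of i]]) (simp add: partial_eq[OF assms(2)])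
  then show ?thesis using assms(2) by (auto simp: differentiable_def)
qed

lemma diff_upto_has_derivative:
  "diff_upto n S f \<Longrightarrow> x \<in> S \<Longrightarrow> (f has_derivative frechet_derivative f (at x)) (at x)"
  by (simp add: diff_upto_differentiable flip: frechet_derivative_works)

lemma diff_upto_partial: "diff_upto (Suc n) S f \<Longrightarrow> diff_upto n S (\<lambda>x. frechet_derivative f (at x) (axis i 1))"
  by (auto simp: partial_def)

lemma diff_upto_add:
  assumes S: "open S"
  shows "diff_upto n S f \<Longrightarrow> diff_upto n S g \<Longrightarrow> diff_upto n S (\<lambda>x. f x + g x)"
proof (induction n arbitrary: f g)
  case (Suc n)
  show ?case
    by (rule diff_upto_SucI[OF S has_derivative_add[OF diff_upto_has_derivative[OF Suc.prems(1)] diff_upto_has_derivative[OF Suc.prems(2)]]])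
      (auto intro!: Suc.IH diff_upto_partial Suc.prems)
qed auto

lemma diff_upto_bilinear:
  assumes B: "bounded_bilinear B" and S: "open S"
  shows "diff_upto n S f \<Longrightarrow> diff_upto n S g \<Longrightarrow> diff_upto n S (\<lambda>x. B (f x) (g x))"
proof (induction n arbitrary: f g)
  case 0
  then show ?case
    using bounded_bilinear.FDERIV[OF B] unfolding diff_upto.simps differentiable_def by blast
next
  case (Suc n)
  show ?case
    by (rule diff_upto_SucI[OF S bounded_bilinear.FDERIV[OF B diff_upto_has_derivative[OF Suc.prems(1)] diff_upto_has_derivative[OF Suc.prems(2)]]])
      (assumption | intro diff_upto_add[OF S] Suc.IH diff_upto_partial Suc.prems diff_upto_SucD[OF Suc.prems(1)] diff_upto_SucD[OF Suc.prems(2)])+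
qed

lemma diff_upto_const: "open S \<Longrightarrow> diff_upto n S (\<lambda>_. c)"
proof (induction n arbitrary: c)
  case (Suc n)
  show ?case by (rule diff_upto_SucI[OF \<open>open S\<close> has_derivative_const]) (use Suc in auto)
qed auto

lemma diff_upto_linear:
  assumes B: "bounded_linear B" and S: "open S"
  shows "diff_upto n S f \<Longrightarrow> diff_upto n S (\<lambda>x. B (f x))"
proof (induction n arbitrary: f)
  case 0
  then show ?case
    using bounded_linear.has_derivative[OF B] unfolding diff_upto.simps differentiable_def by blast
next
  case (Suc n)
  show ?case
    by (rule diff_upto_SucI[OF S bounded_linear.has_derivative[OF B diff_upto_has_derivative[OF Suc.prems(1)]]])
      (auto intro!: Suc.IH diff_upto_partial Suc.prems)
qed

section \<open>Closure properties of smooth functions\<close>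

lemma smooth_on_bilinear:
  assumes "bounded_bilinear B" "open S" "smooth_on S f" "smooth_on S g"
  shows "smooth_on S (\<lambda>x. B (f x) (g x))"
  using assms(3,4) unfolding smooth_on_iff_diff_upto
  by (simp add: diff_upto_bilinear[OF assms(1,2)])

lemma smooth_on_mult:
  fixes f g :: "_ \<Rightarrow> 'a::real_normed_algebra"
  shows "open S \<Longrightarrow> smooth_on S f \<Longrightarrow> smooth_on S g \<Longrightarrow> smooth_on S (\<lambda>x. f x * g x)"
  by (rule smooth_on_bilinear[OF bounded_bilinear_mult])

lemma smooth_on_add:
  "open S \<Longrightarrow> smooth_on S f \<Longrightarrow> smooth_on S g \<Longrightarrow> smooth_on S (\<lambda>x. f x + g x)"
  by (simp add: smooth_on_iff_diff_upto diff_upto_add)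

lemma smooth_on_const: "open S \<Longrightarrow> smooth_on S (\<lambda>_. c)"
  by (simp add: smooth_on_iff_diff_upto diff_upto_const)

lemma smooth_on_linear:
  "bounded_linear B \<Longrightarrow> open S \<Longrightarrow> smooth_on S f \<Longrightarrow> smooth_on S (\<lambda>x. B (f x))"
  by (simp add: smooth_on_iff_diff_upto diff_upto_linear)

lemma smooth_on_bounded_linear:
  assumes "bounded_linear B" "open S" shows "smooth_on S B"
  unfolding smooth_on_iff_diff_upto
proof
  fix n show "diff_upto n S B"
  proof (cases n)
    case 0
    then show ?thesis using bounded_linear_imp_differentiable[OF assms(1)] by auto
  next
    case (Suc k)
    show ?thesis unfolding Suc
      by (rule diff_upto_SucI[OF assms(2) bounded_linear_imp_has_derivative[OF assms(1)]])
        (rule diff_upto_const[OF assms(2)])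
  qed
qed

lemma smooth_on_minus: "open S \<Longrightarrow> smooth_on S f \<Longrightarrow> smooth_on S (\<lambda>x. - f x)"
  by (rule smooth_on_linear[OF bounded_linear_minus[OF bounded_linear_ident]])

lemma smooth_on_diff:
  "open S \<Longrightarrow> smooth_on S f \<Longrightarrow> smooth_on S g \<Longrightarrow> smooth_on S (\<lambda>x. f x - g x)"
  using smooth_on_add[OF _ _ smooth_on_minus, of S f g] by simp

lemma smooth_on_sum:
  "open S \<Longrightarrow> (\<And>a. a \<in> A \<Longrightarrow> smooth_on S (f a)) \<Longrightarrow> smooth_on S (\<lambda>x. \<Sum>a\<in>A. f a x)"
  by (induction A rule: infinite_finite_induct) (auto intro: smooth_on_const smooth_on_add)

lemma smooth_on_partial: "smooth_on S f \<Longrightarrow> smooth_on S (partial i f)"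
  unfolding smooth_on_iff_diff_upto using diff_upto.simps(2) by blast

lemma smooth_on_partials: "smooth_on S f \<Longrightarrow> smooth_on S (partials is f)"
  by (induction "is") (auto intro: smooth_on_partial)

lemma smooth_on_cong:
  "open S \<Longrightarrow> (\<And>x. x \<in> S \<Longrightarrow> f x = g x) \<Longrightarrow> smooth_on S f \<Longrightarrow> smooth_on S g"
  unfolding smooth_on_iff_diff_upto by (simp add: diff_upto_cong[of S f g])

lemma smooth_on_subset: "smooth_on S f \<Longrightarrow> T \<subseteq> S \<Longrightarrow> smooth_on T f"
  unfolding smooth_on_def by blast

lemma smooth_on_Un: "smooth_on S f \<Longrightarrow> smooth_on T f \<Longrightarrow> smooth_on (S \<union> T) f"
  unfolding smooth_on_def by blast

lemma smooth_on_differentiable: "smooth_on S f \<Longrightarrow> x \<in> S \<Longrightarrow> f differentiable (at x)"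
  unfolding smooth_on_def by (drule spec[of _ "[]"]) simp

lemma smooth_on_has_derivative:
  "smooth_on S f \<Longrightarrow> x \<in> S \<Longrightarrow> (f has_derivative frechet_derivative f (at x)) (at x)"
  by (simp add: smooth_on_differentiable flip: frechet_derivative_works)

lemma smooth_on_continuous: "smooth_on S f \<Longrightarrow> continuous_on S f"
  by (simp add: smooth_on_differentiable differentiable_imp_continuous_within continuous_at_imp_continuous_on)

text \<open>The derivative of \<open>1 / f\<close> is a product of \<open>1 / f\<close> with itself
  and a derivative of \<open>f\<close>, so order \<open>n\<close> of \<open>1 / f\<close> yields
  order \<open>n + 1\<close>. The exponential and \<open>flat\<close> below follow the same
  pattern.\<close>

lemma smooth_on_inverse:
  fixes f :: "_ \<Rightarrow> real"
  assumes S: "open S" and f: "smooth_on S f" and nz: "\<And>x. x \<in> S \<Longrightarrow> f x \<noteq> 0"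
  shows "smooth_on S (\<lambda>x. inverse (f x))"
  unfolding smooth_on_iff_diff_upto
proof
  note D = Deriv.has_derivative_inverse[OF nz smooth_on_has_derivative[OF f]]
  note M = diff_upto_bilinear[OF bounded_bilinear_mult S]
  fix n show "diff_upto n S (\<lambda>x. inverse (f x))"
  proof (induction n)
    case 0
    then show ?case using D by (auto simp: differentiable_def)
  next
    case (Suc n)
    have "diff_upto n S (\<lambda>x. frechet_derivative f (at x) (axis i 1))" for i
      by (rule diff_upto_partial) (use f in \<open>simp only: smooth_on_iff_diff_upto\<close>)
    then show ?case
      by (intro diff_upto_SucI[OF S D] diff_upto_linear[OF bounded_linear_minus[OF bounded_linear_ident] S] M Suc.IH)
  qed
qed

lemma has_derivative_cexp:
  fixes f :: "'a::real_normed_vector \<Rightarrow> complex"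
  assumes "(f has_derivative f') (at x)"
  shows "((\<lambda>x. exp (f x)) has_derivative (\<lambda>y. exp (f x) * f' y)) (at x)"
  using has_derivative_compose[OF assms DERIV_exp[unfolded has_field_derivative_def]] .

lemma smooth_on_exp:
  fixes f :: "_ \<Rightarrow> complex"
  assumes S: "open S" and f: "smooth_on S f"
  shows "smooth_on S (\<lambda>x. exp (f x))"
  unfolding smooth_on_iff_diff_upto
proof
  have D: "((\<lambda>x. exp (f x)) has_derivative (\<lambda>y. exp (f x) * frechet_derivative f (at x) y)) (at x)" if "x \<in> S" for x
    using has_derivative_cexp[OF smooth_on_has_derivative[OF f that]] .
  fix n show "diff_upto n S (\<lambda>x. exp (f x))"
  proof (induction n)
    case 0
    then show ?case using D by (auto simp: differentiable_def)
  next
    case (Suc n)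
    have "diff_upto n S (\<lambda>x. frechet_derivative f (at x) (axis i 1))" for i
      by (rule diff_upto_partial) (use f in \<open>simp only: smooth_on_iff_diff_upto\<close>)
    then show ?case
      by (intro diff_upto_SucI[OF S D] diff_upto_bilinear[OF bounded_bilinear_mult S] Suc.IH)
  qed
qed

section \<open>Rules for partial derivatives\<close>

lemma partial_mult:
  fixes f g :: "_ \<Rightarrow> 'a::real_normed_algebra"
  assumes "f differentiable (at x)" "g differentiable (at x)"
  shows "partial i (\<lambda>x. f x * g x) x = f x * partial i g x + partial i f x * g x"
proof -
  have "((\<lambda>x. f x * g x) has_derivative (\<lambda>h. f x * frechet_derivative g (at x) h + frechet_derivative f (at x) h * g x)) (at x)"
    by (rule has_derivative_mult[OF assms[unfolded frechet_derivative_works]])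
  from partial_eq[OF this] show ?thesis by (simp add: partial_def)
qed

lemma partial_linear:
  assumes "bounded_linear B" "f differentiable (at x)"
  shows "partial i (\<lambda>x. B (f x)) x = B (partial i f x)"
  using partial_eq[OF bounded_linear.has_derivative[OF assms(1) assms(2)[unfolded frechet_derivative_works]]]
  by (simp add: partial_def)

lemma partial_add:
  assumes "f differentiable (at x)" "g differentiable (at x)"
  shows "partial i (\<lambda>x. f x + g x) x = partial i f x + partial i g x"
  using partial_eq[OF has_derivative_add[OF assms[unfolded frechet_derivative_works]]]
  by (simp add: partial_def)

lemma partial_const [simp]: "partial i (\<lambda>_. c) = (\<lambda>_. 0)"
  by (rule ext) (simp add: partial_eq[OF has_derivative_const])

lemma frechet_derivative_eq_partials:
  assumes "f differentiable (at x)"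
  shows "frechet_derivative f (at x) v = (\<Sum>i\<in>UNIV. v $ i *\<^sub>R partial i f x)"
proof -
  have l: "linear (frechet_derivative f (at x))"
    by (rule linear_frechet_derivative[OF assms])
  have "v = (\<Sum>i\<in>UNIV. v $ i *\<^sub>R axis i 1)"
    using basis_expansion[of v] by (simp add: scalar_mult_eq_scaleR)
  then have "frechet_derivative f (at x) v = frechet_derivative f (at x) (\<Sum>i\<in>UNIV. v $ i *\<^sub>R axis i 1)" by simp
  also have "\<dots> = (\<Sum>i\<in>UNIV. v $ i *\<^sub>R partial i f x)"
    using l by (simp add: linear_sum linear_cmul partial_def)
  finally show ?thesis .
qed

text \<open>Mean value inequality on a convex set. Since each coordinate of \<open>v\<close> is at
  most \<open>norm v\<close>, the operator norm of the derivative is bounded by the sum of the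
  bounds for the partial derivatives on \<open>K\<close>.\<close>

lemma smooth_on_lipschitz:
  assumes f: "smooth_on UNIV f" and K: "compact K" "convex K"
  shows "\<exists>L\<ge>0. \<forall>x\<in>K. \<forall>y\<in>K. norm (f x - f y) \<le> L * norm (x - y)"
proof -
  have "\<exists>B. \<forall>x\<in>K. norm (partial i f x) \<le> B" for i
  proof -
    have "compact (partial i f ` K)"
      using smooth_on_continuous[OF smooth_on_partial[OF f]] K(1) 
      by (meson compact_continuous_image continuous_on_subset subset_UNIV)
    then show ?thesis using compact_imp_bounded bounded_iff by (metis imageI)
  qed
  then obtain B where B: "\<And>i x. x \<in> K \<Longrightarrow> norm (partial i f x) \<le> B i" by metis
  define L where "L = (\<Sum>i\<in>UNIV. \<bar>B i\<bar>)"
  have L0: "L \<ge> 0" by (simp add: L_def sum_nonneg)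
  have on: "onorm (frechet_derivative f (at x)) \<le> L" if x: "x \<in> K" for x
  proof (rule onorm_bound[OF L0])
    fix v
    have "norm (frechet_derivative f (at x) v) \<le> (\<Sum>i\<in>UNIV. norm (v $ i *\<^sub>R partial i f x))"
      unfolding frechet_derivative_eq_partials[OF smooth_on_differentiable[OF f UNIV_I]] by (rule norm_sum)
    also have "\<dots> \<le> (\<Sum>i\<in>UNIV. norm v * \<bar>B i\<bar>)"
      by (intro sum_mono) (use B[OF x] in \<open>auto intro!: mult_mono simp: component_le_norm_cart intro: order.trans[OF _ abs_ge_self]\<close>)
    also have "\<dots> = L * norm v" by (simp add: L_def sum_distrib_left mult.commute)
    finally show "norm (frechet_derivative f (at x) v) \<le> L * norm v" .
  qed
  have "norm (f x - f y) \<le> L * norm (x - y)" if "x \<in> K" "y \<in> K" for x y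
    using differentiable_bound[OF K(2) has_derivative_at_withinI[OF smooth_on_has_derivative[OF f UNIV_I]] on that] .
  then show ?thesis using L0 by blast
qed

section \<open>Derivatives of complex exponentials\<close>

lemma has_derivative_bdot_cvec:
  "((\<lambda>x. bdot \<eta> (cvec x)) has_derivative (\<lambda>x. bdot \<eta> (cvec x))) (at x)"
  and bounded_linear_bdot_cvec: "bounded_linear (\<lambda>x. bdot \<eta> (cvec x))"
proof -
  show "bounded_linear (\<lambda>x. bdot \<eta> (cvec x))"
    unfolding bdot_def cvec_def
    by (auto intro!: bounded_linear_sum bounded_linear_const_mult bounded_linear_compose[OF bounded_linear_of_real] bounded_linear_vec_nth)
  then show "((\<lambda>x. bdot \<eta> (cvec x)) has_derivative (\<lambda>x. bdot \<eta> (cvec x))) (at x)"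
    by (rule bounded_linear_imp_has_derivative)
qed

lemma smooth_on_e_exp: "open S \<Longrightarrow> smooth_on S (e_exp \<eta>)"
  unfolding e_exp_def[abs_def] by (intro smooth_on_exp smooth_on_bounded_linear bounded_linear_bdot_cvec)

lemma bdot_axis: "bdot \<eta> (cvec (axis i 1)) = \<eta> $ i"
  by (simp add: bdot_def cvec_def axis_def if_distrib cong: if_cong)

lemma partial_e_exp: "partial i (e_exp \<eta>) = (\<lambda>x. \<eta> $ i * e_exp \<eta> x)"
proof
  fix x
  have "(e_exp \<eta> has_derivative (\<lambda>y. exp (bdot \<eta> (cvec x)) * bdot \<eta> (cvec y))) (at x)"
    unfolding e_exp_def[abs_def] by (rule has_derivative_cexp[OF has_derivative_bdot_cvec])
  from partial_eq[OF this] show "partial i (e_exp \<eta>) x = \<eta> $ i * e_exp \<eta> x"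
    by (simp add: bdot_axis e_exp_def)
qed

section \<open>Cutoff functions\<close>

text \<open>The powers of \<open>t\<close> in the denominator make the family closed under
  differentiation. Smoothness at 0 to every order then rests on the single limit
  \<open>flat_tendsto_0\<close>.\<close>

definition flat :: "nat \<Rightarrow> real \<Rightarrow> real" where
  "flat k t = (if t \<le> 0 then 0 else exp (- 1 / t) / t ^ k)"

lemma flat_nonneg: "0 \<le> flat k t"
  by (simp add: flat_def)

lemma flat_pos: "0 < t \<Longrightarrow> 0 < flat k t"
  by (simp add: flat_def)

lemma flat_tendsto_0: "(flat k \<longlongrightarrow> 0) (at 0)"
proof -
  have "((\<lambda>t. (inverse t) ^ k / exp (inverse t)) \<longlongrightarrow> (0::real)) (at_right 0)"
    by (rule filterlim_compose[OF tendsto_power_div_exp_0 filterlim_inverse_at_top_right])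
  moreover have "\<forall>\<^sub>F t in at_right 0. flat k t = (inverse t) ^ k / exp (inverse t)"
    unfolding eventually_at_right_field
    by (intro exI[of _ 1]) (auto simp: flat_def exp_minus field_simps)
  ultimately have r: "(flat k \<longlongrightarrow> 0) (at_right 0)"
    by (simp cong: tendsto_cong)
  have l: "(flat k \<longlongrightarrow> 0) (at_left 0)"
  proof (rule tendsto_eventually)
    show "\<forall>\<^sub>F t in at_left 0. flat k t = 0"
      unfolding eventually_at_left_field by (intro exI[of _ "-1"]) (auto simp: flat_def)
  qed
  show ?thesis by (rule filterlim_split_at[OF l r])
qed

lemma DERIV_flat: "DERIV (flat k) t :> flat (k + 2) t - real k * flat (k + 1) t"
proof -
  consider "t > 0" | "t < 0" | "t = 0" by linarith
  then show ?thesis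
  proof cases
    case 1
    have "DERIV (\<lambda>t. exp (- 1 / t)) t :> exp (- 1 / t) / t\<^sup>2"
      using 1 by (auto intro!: derivative_eq_intros simp: power2_eq_square)
    from DERIV_divide[OF this DERIV_pow[of k]]
    have "DERIV (\<lambda>t. exp (- 1 / t) / t ^ k) t :> flat (k + 2) t - real k * flat (k + 1) t"
      using 1 by (cases k) (auto simp: flat_def field_simps power2_eq_square elim!: DERIV_cong)
    then show ?thesis
      by (rule DERIV_cong_ev[OF refl _ refl, THEN iffD1, rotated])
        (use 1 in \<open>auto simp: flat_def eventually_nhds intro!: exI[of _ "{0<..}"]\<close>)
  next
    case 2
    have "DERIV (\<lambda>t. 0) t :> flat (k + 2) t - real k * flat (k + 1) t"
      using 2 by (auto simp: flat_def)
    then show ?thesis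
      by (rule DERIV_cong_ev[OF refl _ refl, THEN iffD1, rotated])
        (use 2 in \<open>auto simp: flat_def eventually_nhds intro!: exI[of _ "{..<0}"]\<close>)
  next
    case 3
    \<comment> \<open>At 0 the difference quotient of \<open>flat k\<close> is the next member of
      the family, so the derivative there is the limit of \<open>flat (k + 1)\<close>.\<close>
    have "(\<lambda>h. (flat k (0 + h) - flat k 0) / h) = flat (k + 1)"
      by (auto simp: flat_def fun_eq_iff)
    then show ?thesis unfolding 3 DERIV_def
      using flat_tendsto_0[of "k + 1"] by (simp add: flat_def)
  qed
qed

lemma smooth_on_flat:
  assumes S: "open S" and f: "smooth_on S f"
  shows "smooth_on S (\<lambda>x. flat k (f x))"
  unfolding smooth_on_iff_diff_upto
proof
  have D: "((\<lambda>x. flat k (f x)) has_derivative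
      (\<lambda>y. (flat (k + 2) (f x) + (- real k) * flat (k + 1) (f x)) * frechet_derivative f (at x) y)) (at x)" if "x \<in> S" for x k
    using has_derivative_compose[OF smooth_on_has_derivative[OF f that] DERIV_flat[of k "f x", unfolded has_field_derivative_def]]
    by simp
  fix n show "diff_upto n S (\<lambda>x. flat k (f x))"
  proof (induction n arbitrary: k)
    case 0
    then show ?case using D by (auto simp: differentiable_def)
  next
    case (Suc n)
    have "diff_upto n S (\<lambda>x. frechet_derivative f (at x) (axis i 1))" for i
      by (rule diff_upto_partial) (use f in \<open>simp only: smooth_on_iff_diff_upto\<close>)
    then show ?case
      by (intro diff_upto_SucI[OF S D] diff_upto_bilinear[OF bounded_bilinear_mult S] diff_upto_add
        diff_upto_const S Suc.IH)
  qed
qed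

text \<open>The quotient \<open>a t / (a t + a (1 - t))\<close> with \<open>a = flat 0\<close>. One
  of \<open>t\<close> and \<open>1 - t\<close> is always positive, so the denominator never
  vanishes.\<close>

definition smoothstep :: "real \<Rightarrow> real" where
  "smoothstep t = flat 0 t * inverse (flat 0 t + flat 0 (1 - t))"

lemma smoothstep_denominator: "0 < flat 0 t + flat 0 (1 - t)"
  using flat_pos[of t 0] flat_pos[of "1 - t" 0] flat_nonneg[of 0 t] flat_nonneg[of 0 "1 - t"]
  by (cases "t > 0") (auto intro: add_pos_nonneg add_nonneg_pos)

lemma smoothstep_bounds: "0 \<le> smoothstep t" "smoothstep t \<le> 1"
  using smoothstep_denominator[of t] flat_nonneg[of 0 t] flat_nonneg[of 0 "1 - t"]
  unfolding smoothstep_def by (simp_all add: field_simps)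

lemma smoothstep_eq_0: "t \<le> 0 \<Longrightarrow> smoothstep t = 0"
  by (simp add: smoothstep_def flat_def)

lemma smoothstep_eq_1: "t \<ge> 1 \<Longrightarrow> smoothstep t = 1"
  using smoothstep_denominator[of t] by (simp add: smoothstep_def flat_def)

lemma smooth_on_smoothstep: "open S \<Longrightarrow> smooth_on S f \<Longrightarrow> smooth_on S (\<lambda>x. smoothstep (f x))"
  unfolding smoothstep_def
  by (intro smooth_on_mult smooth_on_flat smooth_on_inverse smooth_on_add smooth_on_diff smooth_on_const)
    (auto simp: less_imp_neq[OF smoothstep_denominator, symmetric])

text \<open>A finite sum of bumps, one for each ball of a subcover, is positive on \<open>K\<close>
  and hence bounded below there. A smooth step function flattens it to the constant 1, and this on
  an open neighbourhood of \<open>K\<close>, which is what distributions carried by \<open>K\<close>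
  require.\<close>

lemma smooth_cutoff_exists:
  fixes K U :: "(real^'n::finite) set"
  assumes K: "compact K" and U: "open U" and KU: "K \<subseteq> U"
  obtains \<kappa> :: "real^'n \<Rightarrow> real" and V where "smooth_on UNIV \<kappa>" "\<And>x. 0 \<le> \<kappa> x" "\<And>x. \<kappa> x \<le> 1"
    "open V" "K \<subseteq> V" "\<And>x. x \<in> V \<Longrightarrow> \<kappa> x = 1"
    "compact (closure {x. \<kappa> x \<noteq> 0})" "closure {x. \<kappa> x \<noteq> 0} \<subseteq> U"
proof -
  have "\<exists>r>0. cball p r \<subseteq> U" if "p \<in> K" for p
    using U KU that open_contains_cball by blast
  then obtain r where r: "\<And>p. p \<in> K \<Longrightarrow> r p > 0" "\<And>p. p \<in> K \<Longrightarrow> cball p (r p) \<subseteq> U" by metis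
  obtain D where D: "D \<subseteq> K" "finite D" "K \<subseteq> (\<Union>p\<in>D. ball p (r p))"
    by (rule compactE_image[OF K, of K "\<lambda>p. ball p (r p)"]) (use r(1) in auto)
  define \<sigma> where "\<sigma> = (\<lambda>x. \<Sum>p\<in>D. flat 0 ((r p)\<^sup>2 - (x - p) \<bullet> (x - p)))"
  have s\<sigma>: "smooth_on UNIV \<sigma>"
    unfolding \<sigma>_def
    by (intro smooth_on_sum smooth_on_flat smooth_on_diff smooth_on_const smooth_on_bilinear[OF bounded_bilinear_inner]
        smooth_on_bounded_linear[OF bounded_linear_ident] open_UNIV)
  have pos: "0 < \<sigma> x" if "x \<in> K" for x
  proof -
    obtain p where p: "p \<in> D" "dist p x < r p" using D(3) \<open>x \<in> K\<close> by auto
    then have "(dist x p)\<^sup>2 < (r p)\<^sup>2" by (simp add: dist_commute power_strict_mono)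
    then have "0 < flat 0 ((r p)\<^sup>2 - (x - p) \<bullet> (x - p))"
      by (intro flat_pos) (simp add: dist_norm power2_norm_eq_inner)
    then show ?thesis unfolding \<sigma>_def
      using D(2) p(1) by (intro sum_pos2[of D p]) (auto simp: flat_nonneg)
  qed
  obtain \<epsilon> where \<epsilon>: "0 < \<epsilon>" "\<And>x. x \<in> K \<Longrightarrow> \<epsilon> \<le> \<sigma> x"
  proof (cases "K = {}")
    case False
    have "continuous_on K \<sigma>" using smooth_on_continuous[OF s\<sigma>] continuous_on_subset by blast
    from continuous_attains_inf[OF K False this] pos that show ?thesis by blast
  qed (use that[of 1] in auto)
  \<comment> \<open>The factor \<open>2 / \<epsilon>\<close> in \<kappa> sends values of \<sigma>
    above \<open>\<epsilon> / 2\<close> past 1, where the step function is constant; this leaves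
    room around \<open>K\<close>, where \<sigma> is at least \<epsilon>.\<close>
  define V where "V = {x. \<epsilon> / 2 < \<sigma> x}"
  define \<kappa> where "\<kappa> = (\<lambda>x. smoothstep (2 / \<epsilon> * \<sigma> x))"
  have oV: "open V" unfolding V_def
    by (intro open_Collect_less continuous_on_const smooth_on_continuous[OF s\<sigma>])
  have KV: "K \<subseteq> V" using \<epsilon> by (force simp: V_def)
  have s\<kappa>: "smooth_on UNIV \<kappa>" unfolding \<kappa>_def
    by (intro smooth_on_smoothstep smooth_on_mult smooth_on_const s\<sigma> open_UNIV)
  have one: "\<kappa> x = 1" if "x \<in> V" for x
    using that \<epsilon>(1) by (auto simp: \<kappa>_def V_def field_simps intro!: smoothstep_eq_1)
  define Z where "Z = (\<Union>p\<in>D. cball p (r p))"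
  have Z: "compact Z" "Z \<subseteq> U" using D(1,2) r(2) by (auto simp: Z_def intro!: compact_UN)
  have "x \<in> Z" if "\<kappa> x \<noteq> 0" for x
  proof -
    have "0 < \<sigma> x"
    proof (rule ccontr)
      assume "\<not> 0 < \<sigma> x"
      then have "2 / \<epsilon> * \<sigma> x \<le> 0" using \<epsilon>(1) by (intro mult_nonneg_nonpos) auto
      then show False using that smoothstep_eq_0 by (simp add: \<kappa>_def)
    qed
    have "\<exists>p\<in>D. flat 0 ((r p)\<^sup>2 - (x - p) \<bullet> (x - p)) \<noteq> 0"
    proof (rule ccontr)
      assume "\<not> ?thesis"
      then have "\<sigma> x = 0" unfolding \<sigma>_def by (intro sum.neutral) blast
      then show False using \<open>0 < \<sigma> x\<close> by simp
    qed
    then obtain p where p: "p \<in> D" "flat 0 ((r p)\<^sup>2 - (x - p) \<bullet> (x - p)) \<noteq> 0" by blast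
    then have "(dist x p)\<^sup>2 < (r p)\<^sup>2" by (auto simp: flat_def dist_norm power2_norm_eq_inner split: if_splits)
    then have "dist x p < r p"
      by (rule power2_less_imp_less) (use r(1)[of p] p(1) D(1) in auto)
    then show ?thesis using p(1) by (force simp: Z_def dist_commute)
  qed
  then have cl: "closure {x. \<kappa> x \<noteq> 0} \<subseteq> Z"
    using Z(1) by (intro closure_minimal) (auto simp: compact_imp_closed)
  have "compact (closure {x. \<kappa> x \<noteq> 0})"
    using compact_Int_closed[OF Z(1) closed_closure[of "{x. \<kappa> x \<noteq> 0}"]] cl
    by (simp only: inf.absorb2)
  then show ?thesis
    using that[OF s\<kappa> _ _ oV KV one] smoothstep_bounds cl Z(2) by (auto simp: \<kappa>_def)
qed

lemma test_fun_cutoff_exists: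
  fixes K U :: "(real^'n::finite) set"
  assumes K: "compact K" and U: "open U" and KU: "K \<subseteq> U"
  obtains \<kappa> V where "\<kappa> \<in> test_fun U" "\<And>x. norm (\<kappa> x) \<le> 1" "open V" "K \<subseteq> V" "\<And>x. x \<in> V \<Longrightarrow> \<kappa> x = 1"
proof -
  obtain \<kappa> :: "real^'n \<Rightarrow> real" and V where k: "smooth_on UNIV \<kappa>" "\<And>x. 0 \<le> \<kappa> x" "\<And>x. \<kappa> x \<le> 1"
    "open V" "K \<subseteq> V" "\<And>x. x \<in> V \<Longrightarrow> \<kappa> x = 1"
    "compact (closure {x. \<kappa> x \<noteq> 0})" "closure {x. \<kappa> x \<noteq> 0} \<subseteq> U"
    using smooth_cutoff_exists[OF K U KU] by blast
  show ?thesis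
    by (rule that[of "\<lambda>x. complex_of_real (\<kappa> x)" V])
      (use k in \<open>auto simp: test_fun_def supp_def intro!: smooth_on_linear[OF bounded_linear_of_real]\<close>)
qed

section \<open>Hausdorff measure\<close>

text \<open>Caratheodory's criterion. For closed \<open>F\<close>, the part of \<open>A\<close> at
  distance at least \<open>1 / (n + 1)\<close> from \<open>F\<close> is separated from
  \<open>F\<close>, so only what lies closer has to be controlled. That remainder is a union of
  distance shells; shells of equal parity are separated, which bounds the sum of all their measures
  by twice that of \<open>A\<close> and makes the tail small.\<close>

lemma metric_outer_measure_borel:
  fixes \<mu> :: "'a::metric_space set \<Rightarrow> ennreal"
  assumes empty: "\<mu> {} = 0"
    and mono: "\<And>A B. A \<subseteq> B \<Longrightarrow> \<mu> A \<le> \<mu> B"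
    and sub: "\<And>A :: nat \<Rightarrow> 'a set. \<mu> (\<Union>i. A i) \<le> (\<Sum>i. \<mu> (A i))"
    and sep: "\<And>A B \<epsilon>. \<epsilon> > 0 \<Longrightarrow> (\<And>x y. x \<in> A \<Longrightarrow> y \<in> B \<Longrightarrow> \<epsilon> \<le> dist x y) \<Longrightarrow> \<mu> A + \<mu> B \<le> \<mu> (A \<union> B)"
  shows "measure_space UNIV (sets borel) \<mu>"
proof -
  interpret sigma_algebra UNIV "UNIV :: 'a set set"
    using sigma_algebra_Pow[of "UNIV :: 'a set"] by simp
  have oms: "outer_measure_space (UNIV :: 'a set set) \<mu>"
    using empty mono sub
    by (auto simp: outer_measure_space_def positive_def increasing_def countably_subadditive_def)
  have sub2: "\<mu> (A \<union> B) \<le> \<mu> A + \<mu> B" for A B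
  proof -
    have "\<mu> (\<Union>i. binaryset A B i) \<le> (\<Sum>i. \<mu> (binaryset A B i))" by (rule sub)
    then show ?thesis
      using suminf_binaryset_eq[of \<mu> A B] empty by (simp add: UN_binaryset_eq)
  qed
  have main: "\<mu> (F \<inter> A) + \<mu> (A - F) \<le> \<mu> A" if F: "closed F" "F \<noteq> {}" for F A
  proof (cases "\<mu> A = \<infinity>")
    case False
    define d where "d = (\<lambda>x. infdist x F)"
    have lip: "\<bar>d x - d y\<bar> \<le> dist x y" for x y
      unfolding d_def using infdist_triangle_abs by blast
    define P where "P = (\<lambda>n::nat. {x \<in> A. 1 / real (n + 1) \<le> d x})"
    define R where "R = (\<lambda>n. {x \<in> A. 1 / real (n + 2) \<le> d x \<and> d x < 1 / real (n + 1)})"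
    \<comment> \<open>The disjunction amounts to \<open>d x \<le> a\<close>. Since \<open>d\<close>
      is 1-Lipschitz, sets on which it is at most \<open>a\<close> and at least \<open>b\<close> lie
      \<open>b - a\<close> apart.\<close>
    have sepd: "\<mu> X + \<mu> Y \<le> \<mu> (X \<union> Y)"
      if "a < b" "\<And>x. x \<in> X \<Longrightarrow> d x < a \<or> d x = 0 \<and> a \<ge> 0 \<or> d x \<le> a" "\<And>x. x \<in> Y \<Longrightarrow> b \<le> d x" for X Y a b
    proof (rule sep[of "b - a"])
      fix x y assume "x \<in> X" "y \<in> Y"
      then have "d x \<le> a" "b \<le> d y" using that by force+
      then show "b - a \<le> dist x y" using lip[of x y] by linarith
    qed (use that in auto)
    have even: "(\<Sum>k<N. \<mu> (R (2 * k + j))) \<le> \<mu> (\<Union>k<N. R (2 * k + j))" for N j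
    proof (induction N)
      case (Suc N)
      have "(\<Sum>k<Suc N. \<mu> (R (2 * k + j))) \<le> \<mu> (R (2 * N + j)) + \<mu> (\<Union>k<N. R (2 * k + j))"
        using Suc.IH by (simp add: add.commute add_mono)
      also have "\<dots> \<le> \<mu> (R (2 * N + j) \<union> (\<Union>k<N. R (2 * k + j)))"
      \<comment> \<open>With \<open>N = 0\<close> there are no earlier shells, and the threshold
        \<open>1 / real (2 * N + j)\<close> would be \<open>1 / 0\<close> for
        \<open>j = 0\<close>.\<close>
      proof (cases "N = 0")
        case False
        show ?thesis
        proof (rule sepd[of "1 / real (2 * N + j + 1)" "1 / real (2 * N + j)"])
          show "1 / real (2 * N + j + 1) < 1 / real (2 * N + j)" using False by (simp add: field_simps)
          show "1 / real (2 * N + j) \<le> d x" if "x \<in> (\<Union>k<N. R (2 * k + j))" for x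
          proof -
            from that obtain k where "k < N" "x \<in> R (2 * k + j)" by blast
            then have k: "k < N" "1 / real (2 * k + j + 2) \<le> d x" by (simp_all add: R_def)
            have "1 / real (2 * N + j) \<le> 1 / real (2 * k + j + 2)"
              using k(1) by (intro divide_left_mono) auto
            then show ?thesis using k by linarith
          qed
        qed (auto simp: R_def)
      qed (simp add: empty)
      also have "R (2 * N + j) \<union> (\<Union>k<N. R (2 * k + j)) = (\<Union>k<Suc N. R (2 * k + j))"
        by (auto simp: lessThan_Suc)
      finally show ?case .
    qed (simp add: empty)
    have RA: "(\<Sum>k<N. \<mu> (R (2 * k + j))) \<le> \<mu> A" for N j
      by (rule order.trans[OF even mono]) (auto simp: R_def)
    have "(\<Sum>k<2 * N. \<mu> (R k)) = (\<Sum>k<N. \<mu> (R (2 * k + 0))) + (\<Sum>k<N. \<mu> (R (2 * k + 1)))" for N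
      by (induction N) (simp_all add: algebra_simps)
    then have "(\<Sum>k<2 * N. \<mu> (R k)) \<le> \<mu> A + \<mu> A" for N
      using add_mono[OF RA[of 0 N] RA[of 1 N]] by simp
    then have part: "(\<Sum>k<N. \<mu> (R k)) \<le> \<mu> A + \<mu> A" for N
    proof -
      have "(\<Sum>k<N. \<mu> (R k)) \<le> (\<Sum>k<2 * N. \<mu> (R k))" by (rule sum_mono2) auto
      with \<open>(\<Sum>k<2 * N. \<mu> (R k)) \<le> \<mu> A + \<mu> A\<close> show ?thesis by (rule order.trans[rotated])
    qed
    have fin: "\<mu> A < \<infinity>" using False by (simp add: less_top)
    have finR: "\<mu> (R k) < \<infinity>" for k
      by (rule le_less_trans[OF mono fin]) (auto simp: R_def)
    define g where "g = (\<lambda>k. enn2real (\<mu> (R k)))"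
    have g: "\<mu> (R k) = ennreal (g k)" "0 \<le> g k" for k
      using finR[of k] by (simp_all add: g_def)
    have "summable g"
    proof (rule bounded_imp_summable)
      show "0 \<le> g n" for n by (rule g)
      fix n
      have "ennreal (\<Sum>k\<le>n. g k) = (\<Sum>k<Suc n. \<mu> (R k))"
        using g by (simp add: sum_ennreal lessThan_Suc_atMost)
      also have "\<dots> \<le> \<mu> A + \<mu> A" by (rule part)
      also have "\<dots> = ennreal (2 * enn2real (\<mu> A))"
        using fin by (cases "\<mu> A") (auto simp: ennreal_plus[symmetric] simp del: ennreal_plus)
      finally show "(\<Sum>k\<le>n. g k) \<le> 2 * enn2real (\<mu> A)"
        by (subst (asm) ennreal_le_iff) auto
    qed
    show ?thesis
    proof (rule ennreal_le_epsilon)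
      fix e :: real assume e: "0 < e"
      from suminf_exist_split[OF e \<open>summable g\<close>] obtain n where n: "norm (\<Sum>i. g (i + n)) < e" by auto
      have sg: "summable (\<lambda>i. g (i + n))" using \<open>summable g\<close> by (simp add: summable_iff_shift)
      have "(\<Sum>i. \<mu> (R (i + n))) = ennreal (\<Sum>i. g (i + n))"
        using g sg by (simp add: suminf_ennreal2)
      also have "\<dots> \<le> ennreal e" using n by (intro ennreal_leI) auto
      finally have tail: "(\<Sum>i. \<mu> (R (i + n))) \<le> ennreal e" .
      have cover: "A - F \<subseteq> P n \<union> (\<Union>i. R (i + n))"
      proof
        fix x assume x: "x \<in> A - F"
        then have dx: "0 < d x" unfolding d_def using F infdist_pos_not_in_closed by blast
        show "x \<in> P n \<union> (\<Union>i. R (i + n))"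
        proof (cases "1 / real (n + 1) \<le> d x")
          case False
          \<comment> \<open>The first index whose threshold is reached by \<open>d x\<close>. The
            point lies in the shell just before it, whose index is at least \<open>n\<close> because
            \<open>d x\<close> is below the threshold of \<open>P n\<close>.\<close>
          define m where "m = (LEAST m. 1 / real (m + 1) \<le> d x)"
          obtain m0 where "inverse (real (Suc m0)) < d x" using reals_Archimedean dx by blast
          then have "1 / real (m0 + 1) \<le> d x" by (simp add: inverse_eq_divide)
          then have m: "1 / real (m + 1) \<le> d x" unfolding m_def by (rule LeastI)
          have "n < m"
          proof (rule ccontr)
            assume "\<not> n < m"
            then have "1 / real (n + 1) \<le> 1 / real (m + 1)" by (intro divide_left_mono) auto
            then show False using m False by linarith
          qed
          then obtain i where i: "m = i + n + 1" by (metis Suc_eq_plus1 add.commute add_Suc_right less_imp_Suc_add)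
          have "\<not> 1 / real (i + n + 1) \<le> d x"
            using not_less_Least[of "i + n" "\<lambda>m. 1 / real (m + 1) \<le> d x"] i unfolding m_def by simp
          then have "x \<in> R (i + n)" using m x i by (simp add: R_def)
          then show ?thesis by blast
        qed (use x in \<open>auto simp: P_def\<close>)
      qed
      have "\<mu> (A - F) \<le> \<mu> (P n) + \<mu> (\<Union>i. R (i + n))"
        using order.trans[OF mono[OF cover] sub2] .
      also have "\<dots> \<le> \<mu> (P n) + ennreal e"
        using order.trans[OF sub tail] by (rule add_left_mono)
      finally have "\<mu> (F \<inter> A) + \<mu> (A - F) \<le> (\<mu> (F \<inter> A) + \<mu> (P n)) + ennreal e"
        by (simp add: add.assoc add_left_mono)
      also have "\<mu> (F \<inter> A) + \<mu> (P n) \<le> \<mu> ((F \<inter> A) \<union> P n)"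
        by (rule sepd[of 0 "1 / real (n + 1)"]) (auto simp: P_def d_def)
      also have "\<dots> \<le> \<mu> A" by (rule mono) (auto simp: P_def)
      finally show "\<mu> (F \<inter> A) + \<mu> (A - F) \<le> \<mu> A + ennreal e" by (simp add: add_right_mono)
    qed
  qed simp
  have cl: "F \<in> lambda_system UNIV UNIV \<mu>" if "closed F" for F
  \<comment> \<open>\<open>infdist\<close> to the empty set is 0 everywhere, so the argument by
    distances does not cover this case.\<close>
  proof (cases "F = {}")
    case False
    have "\<mu> (F \<inter> A) + \<mu> ((UNIV - F) \<inter> A) = \<mu> A" for A
    proof (rule antisym)
      have eq: "(UNIV - F) \<inter> A = A - F" by auto
      show "\<mu> (F \<inter> A) + \<mu> ((UNIV - F) \<inter> A) \<le> \<mu> A" using main[OF that False] by (simp add: eq)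
      have "A = (F \<inter> A) \<union> ((UNIV - F) \<inter> A)" by auto
      then show "\<mu> A \<le> \<mu> (F \<inter> A) + \<mu> ((UNIV - F) \<inter> A)" using sub2 by metis
    qed
    then show ?thesis by (auto simp: lambda_system_def)
  qed (simp add: lambda_system_def empty)
  have ms: "measure_space UNIV (lambda_system UNIV UNIV \<mu>) \<mu>"
    using caratheodory_lemma[OF oms] .
  then have sa: "sigma_algebra UNIV (lambda_system UNIV UNIV \<mu>)" by (simp add: measure_space_def)
  have "sets borel \<subseteq> lambda_system UNIV UNIV \<mu>"
    unfolding borel_eq_closed using sigma_algebra.sigma_sets_subset[OF sa, of "Collect closed"] cl by auto
  then show ?thesis
    using measure_down[OF ms _ ] sets.sigma_algebra_axioms[of borel] by (metis space_borel)
qed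

section \<open>Hausdorff content at a fixed scale\<close>

definition hausdorff_content :: "nat \<Rightarrow> real \<Rightarrow> 'a::metric_space set \<Rightarrow> ennreal" where
  "hausdorff_content s \<delta> A =
     (INF C\<in>{C :: nat \<Rightarrow> 'a set. A \<subseteq> (\<Union>n. C n) \<and> (\<forall>n. bounded (C n) \<and> diameter (C n) \<le> \<delta>)}.
          (\<Sum>n. ennreal (diameter (C n) ^ s)))"

lemma hausdorff_outer_eq:
  "hausdorff_outer s A = ennreal (unit_ball_vol (real s) / 2 ^ s) * (SUP \<delta>\<in>{0<..}. hausdorff_content s \<delta> A)"
  by (simp add: hausdorff_outer_def hausdorff_content_def)

lemma hausdorff_content_le:
  assumes "A \<subseteq> (\<Union>n. C n)" "\<And>n. bounded (C n)" "\<And>n. diameter (C n) \<le> \<delta>"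
  shows "hausdorff_content s \<delta> A \<le> (\<Sum>n. ennreal (diameter (C n) ^ s))"
  unfolding hausdorff_content_def by (rule INF_lower) (use assms in auto)

lemma hausdorff_content_ge:
  assumes "\<And>C. A \<subseteq> (\<Union>n. C n) \<Longrightarrow> (\<And>n. bounded (C n)) \<Longrightarrow> (\<And>n. diameter (C n) \<le> \<delta>) \<Longrightarrow>
    c \<le> (\<Sum>n. ennreal (diameter (C n) ^ s))"
  shows "c \<le> hausdorff_content s \<delta> A"
  unfolding hausdorff_content_def by (rule INF_greatest) (use assms in auto)

lemma hausdorff_content_mono: "A \<subseteq> B \<Longrightarrow> hausdorff_content s \<delta> A \<le> hausdorff_content s \<delta> B"
  by (rule hausdorff_content_ge, rule hausdorff_content_le) auto

lemma hausdorff_content_antimono: "\<delta> \<le> \<delta>' \<Longrightarrow> hausdorff_content s \<delta>' A \<le> hausdorff_content s \<delta> A"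
  by (rule hausdorff_content_ge, rule hausdorff_content_le) (auto intro: order.trans)

text \<open>The dimension has to be positive: because of \<open>0 ^ 0 = 1\<close>, every empty
  member of a cover would otherwise cost 1.\<close>

lemma hausdorff_content_empty:
  assumes "s \<ge> 1" "0 \<le> \<delta>"
  shows "hausdorff_content s \<delta> ({} :: 'a::metric_space set) = 0"
proof -
  have "hausdorff_content s \<delta> ({} :: 'a set) \<le> (\<Sum>n. ennreal (diameter ({} :: 'a set) ^ s))"
    by (rule hausdorff_content_le) (use assms in auto)
  then show ?thesis using assms by (simp add: power_0_left)
qed

text \<open>Covers of the \<open>A i\<close> that are optimal up to \<open>e * (1/2) ^ Suc i\<close>
  are merged into one sequence by pairing indices; the excesses add up to \<open>e\<close>.\<close>

lemma hausdorff_content_countable_subadditive: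
  fixes A :: "nat \<Rightarrow> 'a::metric_space set"
  shows "hausdorff_content s \<delta> (\<Union>i. A i) \<le> (\<Sum>i. hausdorff_content s \<delta> (A i))"
proof (cases "(\<Sum>i. hausdorff_content s \<delta> (A i)) = \<infinity>")
  case False
  show ?thesis
  proof (rule ennreal_le_epsilon)
    fix e :: real assume e: "0 < e"
    have "\<exists>C. A i \<subseteq> (\<Union>n. C n) \<and> (\<forall>n. bounded (C n)) \<and> (\<forall>n. diameter (C n) \<le> \<delta>) \<and>
        (\<Sum>n. ennreal (diameter (C n) ^ s)) \<le> hausdorff_content s \<delta> (A i) + ennreal (e * (1/2) ^ Suc i)" for i
    proof -
      have "hausdorff_content s \<delta> (A i) \<le> (\<Sum>i. hausdorff_content s \<delta> (A i))"
        using sum_le_suminf[of "\<lambda>i. hausdorff_content s \<delta> (A i)" "{i}"] by simp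
      then have "hausdorff_content s \<delta> (A i) < \<infinity>" using False by (simp add: less_top le_less_trans)
      then have "hausdorff_content s \<delta> (A i) < hausdorff_content s \<delta> (A i) + ennreal (e * (1/2) ^ Suc i)"
        using e by (cases "hausdorff_content s \<delta> (A i)") (auto simp: ennreal_plus[symmetric] simp del: ennreal_plus intro!: ennreal_lessI add_nonneg_pos)
      then show ?thesis
        unfolding hausdorff_content_def[of s \<delta> "A i"] INF_less_iff by (auto intro: less_imp_le)
    qed
    then obtain C where C: "\<And>i. A i \<subseteq> (\<Union>n. C i n)" "\<And>i n. bounded (C i n)" "\<And>i n. diameter (C i n) \<le> \<delta>"
      "\<And>i. (\<Sum>n. ennreal (diameter (C i n) ^ s)) \<le> hausdorff_content s \<delta> (A i) + ennreal (e * (1/2) ^ Suc i)"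
      by metis
    define B where "B = (\<lambda>k. case prod_decode k of (i, n) \<Rightarrow> C i n)"
    have "hausdorff_content s \<delta> (\<Union>i. A i) \<le> (\<Sum>k. ennreal (diameter (B k) ^ s))"
    proof (rule hausdorff_content_le)
      show "(\<Union>i. A i) \<subseteq> (\<Union>k. B k)"
      proof
        fix x assume "x \<in> (\<Union>i. A i)"
        then obtain i n where "x \<in> C i n" using C(1) by blast
        then have "x \<in> B (prod_encode (i, n))" by (simp add: B_def)
        then show "x \<in> (\<Union>k. B k)" by blast
      qed
    qed (use C in \<open>auto simp: B_def split: prod.split\<close>)
    also have "\<dots> = (\<Sum>k. (\<lambda>(i, n). ennreal (diameter (C i n) ^ s)) (prod_decode k))"
      by (intro suminf_cong) (simp add: B_def split: prod.split)
    also have "\<dots> = (\<Sum>i. \<Sum>n. ennreal (diameter (C i n) ^ s))"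
      by (rule suminf_ennreal_2dimen) simp
    also have "\<dots> \<le> (\<Sum>i. hausdorff_content s \<delta> (A i) + ennreal (e * (1/2) ^ Suc i))"
      by (intro suminf_le C) auto
    also have "\<dots> = (\<Sum>i. hausdorff_content s \<delta> (A i)) + (\<Sum>i. ennreal (e * (1/2) ^ Suc i))"
      by (rule suminf_add[symmetric]) auto
    also have "(\<Sum>i. ennreal (e * (1/2) ^ Suc i)) = ennreal e"
      using sums_mult[OF power_half_series, of e] e by (subst suminf_ennreal_eq) (auto simp: sums_iff)
    finally show "hausdorff_content s \<delta> (\<Union>i. A i) \<le> (\<Sum>i. hausdorff_content s \<delta> (A i)) + ennreal e" .
  qed
qed simp

text \<open>A set of diameter below the separation meets at most one of \<open>A\<close> and
  \<open>B\<close>, so a cover of the union splits into a cover of each.\<close>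

lemma hausdorff_content_separated:
  fixes A B :: "'a::metric_space set"
  assumes s: "s \<ge> 1" and "\<delta> < \<epsilon>" "\<And>x y. x \<in> A \<Longrightarrow> y \<in> B \<Longrightarrow> \<epsilon> \<le> dist x y"
  shows "hausdorff_content s \<delta> A + hausdorff_content s \<delta> B \<le> hausdorff_content s \<delta> (A \<union> B)"
proof (rule hausdorff_content_ge)
  fix C :: "nat \<Rightarrow> 'a set" assume C: "A \<union> B \<subseteq> (\<Union>n. C n)" "\<And>n. bounded (C n)" "\<And>n. diameter (C n) \<le> \<delta>"
  \<comment> \<open>Members that miss \<open>X\<close> are replaced by the empty set and not
    removed, which keeps the index set; they cost nothing because \<open>s\<close> is
    positive.\<close>
  define E where "E = (\<lambda>X n. if C n \<inter> X = {} then {} else C n)"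
  have d: "0 \<le> \<delta>" using C(3)[of 0] diameter_ge_0[OF C(2)[of 0]] by simp
  have E: "hausdorff_content s \<delta> X \<le> (\<Sum>n. ennreal (diameter (E X n) ^ s))" if "X \<subseteq> A \<union> B" for X
  proof (rule hausdorff_content_le)
    show "X \<subseteq> (\<Union>n. E X n)"
    proof
      fix x assume x: "x \<in> X"
      then have "x \<in> (\<Union>n. C n)" using C(1) \<open>X \<subseteq> A \<union> B\<close> by blast
      then obtain n where "x \<in> C n" by blast
      with x have "x \<in> E X n" by (auto simp: E_def)
      then show "x \<in> (\<Union>n. E X n)" by blast
    qed
  qed (use C d in \<open>auto simp: E_def\<close>)
  have disj: "E A n = {} \<or> E B n = {}" for n
  proof (rule ccontr)
    assume "\<not> ?thesis"
    then obtain x y where xy: "x \<in> C n" "y \<in> C n" "x \<in> A" "y \<in> B" by (auto simp: E_def split: if_splits)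
    then show False
      using diameter_bounded_bound[OF C(2)[of n] xy(1,2)] C(3)[of n] assms(2) assms(3)[OF xy(3,4)] by simp
  qed
  have le: "ennreal (diameter (E X n) ^ s) \<le> ennreal (diameter (C n) ^ s)" for X n
    using s by (auto simp: E_def power_0_left)
  have "ennreal (diameter (E A n) ^ s) + ennreal (diameter (E B n) ^ s) \<le> ennreal (diameter (C n) ^ s)" for n
    using disj[of n] le[of A n] le[of B n] s by (elim disjE) (simp_all add: power_0_left)
  then have "(\<Sum>n. ennreal (diameter (E A n) ^ s)) + (\<Sum>n. ennreal (diameter (E B n) ^ s)) \<le> (\<Sum>n. ennreal (diameter (C n) ^ s))"
    by (subst suminf_add) (auto intro: suminf_le)
  then show "hausdorff_content s \<delta> A + hausdorff_content s \<delta> B \<le> (\<Sum>n. ennreal (diameter (C n) ^ s))"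
    using add_mono[OF E[of A] E[of B]] by (meson order.trans sup_ge1 sup_ge2)
qed

lemma measure_space_hausdorff_outer:
  assumes s: "s \<ge> 1"
  shows "measure_space UNIV (sets borel) (hausdorff_outer s :: 'a::metric_space set \<Rightarrow> ennreal)"
proof (rule metric_outer_measure_borel)
  let ?c = "ennreal (unit_ball_vol (real s) / 2 ^ s)"
  let ?S = "\<lambda>A :: 'a set. SUP \<delta>\<in>{0<..}. hausdorff_content s \<delta> A"
  show "hausdorff_outer s ({} :: 'a set) = 0"
    using s by (simp add: hausdorff_outer_eq hausdorff_content_empty)
  show "hausdorff_outer s A \<le> hausdorff_outer s B" if "A \<subseteq> B" for A B :: "'a set"
    unfolding hausdorff_outer_eq by (intro mult_left_mono SUP_mono' hausdorff_content_mono that) auto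
  show "hausdorff_outer s (\<Union>i. A i) \<le> (\<Sum>i. hausdorff_outer s (A i))" for A :: "nat \<Rightarrow> 'a set"
  proof -
    have "?S (\<Union>i. A i) \<le> (\<Sum>i. ?S (A i))"
    proof (rule SUP_least)
      fix \<delta> :: real assume "\<delta> \<in> {0<..}"
      then have "(\<Sum>i. hausdorff_content s \<delta> (A i)) \<le> (\<Sum>i. ?S (A i))"
        by (intro suminf_le SUP_upper) auto
      with hausdorff_content_countable_subadditive show "hausdorff_content s \<delta> (\<Union>i. A i) \<le> (\<Sum>i. ?S (A i))"
        by (rule order.trans)
    qed
    then show ?thesis unfolding hausdorff_outer_eq by (simp add: mult_left_mono)
  qed
  show "hausdorff_outer s A + hausdorff_outer s B \<le> hausdorff_outer s (A \<union> B)"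
    if "0 < \<epsilon>" "\<And>x y. x \<in> A \<Longrightarrow> y \<in> B \<Longrightarrow> \<epsilon> \<le> dist x y" for A B :: "'a set" and \<epsilon>
  proof -
    \<comment> \<open>Content grows as the scale shrinks, so two scales can be replaced by the
      smaller one and the suprema may be added.\<close>
    have "?S A + ?S B = (SUP \<delta>\<in>{0<..}. hausdorff_content s \<delta> A + hausdorff_content s \<delta> B)"
    proof (rule SUP_add_directed_ennreal[symmetric])
      fix i j :: real assume "i \<in> {0<..}" "j \<in> {0<..}"
      then show "\<exists>k\<in>{0<..}. hausdorff_content s i A + hausdorff_content s j B \<le> hausdorff_content s k A + hausdorff_content s k B"
        by (intro bexI[of _ "min i j"] add_mono hausdorff_content_antimono) auto
    qed
    also have "\<dots> \<le> ?S (A \<union> B)"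
    proof (rule SUP_least)
      fix \<delta> :: real assume "\<delta> \<in> {0<..}"
      \<comment> \<open>Refining the scale to below \<epsilon> only raises the contents and brings
        them into the range where separation applies.\<close>
      then have "hausdorff_content s \<delta> A + hausdorff_content s \<delta> B
          \<le> hausdorff_content s (min \<delta> (\<epsilon>/2)) A + hausdorff_content s (min \<delta> (\<epsilon>/2)) B"
        by (intro add_mono hausdorff_content_antimono) auto
      also have "\<dots> \<le> hausdorff_content s (min \<delta> (\<epsilon>/2)) (A \<union> B)"
        by (rule hausdorff_content_separated[OF s, of _ \<epsilon>]) (use that in auto)
      also have "\<dots> \<le> ?S (A \<union> B)"
        by (rule SUP_upper) (use that \<open>\<delta> \<in> {0<..}\<close> in auto)
      finally show "hausdorff_content s \<delta> A + hausdorff_content s \<delta> B \<le> ?S (A \<union> B)" .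
    qed
    finally show ?thesis
      unfolding hausdorff_outer_eq by (simp add: mult_left_mono flip: distrib_left)
  qed
qed

section \<open>Surface measure\<close>

lemma sets_surface_measure: "sets (surface_measure \<Omega>) = sets (restrict_space borel (frontier \<Omega>))"
  unfolding surface_measure_def by (intro sets_restrict_space_cong) (metis sets.sets_measure_of_eq space_borel)

text \<open>\<open>measure_of\<close> would return the zero measure if \<open>hausdorff_outer\<close> were not countably additive on Borel sets.\<close>

lemma emeasure_surface_measure:
  fixes \<Omega> :: "(real^'n::finite) set"
  assumes "CARD('n) \<ge> 2" "A \<in> sets borel" "A \<subseteq> frontier \<Omega>"
  shows "emeasure (surface_measure \<Omega>) A = hausdorff_outer (CARD('n) - 1) A"
proof -
  have ms: "measure_space UNIV (sets borel) (hausdorff_outer (CARD('n) - 1) :: (real^'n) set \<Rightarrow> ennreal)"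
    by (rule measure_space_hausdorff_outer) (use assms(1) in simp)
  let ?M = "measure_of UNIV (sets borel) (hausdorff_outer (CARD('n) - 1) :: (real^'n) set \<Rightarrow> ennreal)"
  have S: "sets ?M = sets borel" by (metis sets.sets_measure_of_eq space_borel)
  have "emeasure (surface_measure \<Omega>) A = emeasure ?M A"
    unfolding surface_measure_def
    by (rule emeasure_restrict_space) (use assms(3) S in auto)
  also have "\<dots> = hausdorff_outer (CARD('n) - 1) A"
    by (rule emeasure_measure_of_sigma) (use ms assms(2) in \<open>auto simp: measure_space_def\<close>)
  finally show ?thesis .
qed

section \<open>Test functions and integration by parts\<close>

lemma integrable_lebesgue_on_bounded:
  fixes f :: "'a::euclidean_space \<Rightarrow> 'b::{banach, second_countable_topology}"
  assumes "U \<in> lmeasurable" "f \<in> borel_measurable (lebesgue_on U)" "\<And>x. x \<in> U \<Longrightarrow> norm (f x) \<le> B"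
  shows "integrable (lebesgue_on U) f"
proof -
  interpret finite_measure "lebesgue_on U" by (rule finite_measure_lebesgue_on[OF assms(1)])
  show ?thesis
    by (rule integrable_const_bound[of _ B]) (use assms in \<open>auto intro!: AE_I2\<close>)
qed

lemma borel_measurable_lebesgue_on_continuous:
  fixes f :: "'a::euclidean_space \<Rightarrow> 'b::euclidean_space"
  assumes "continuous_on UNIV f" "U \<in> sets lebesgue"
  shows "f \<in> borel_measurable (lebesgue_on U)"
  using assms continuous_imp_measurable_on_sets_lebesgue continuous_on_subset by blast

lemma continuous_on_bounded_on:
  fixes f :: "'a::euclidean_space \<Rightarrow> 'b::real_normed_vector"
  assumes "continuous_on UNIV f" "bounded U"
  obtains B where "B \<ge> 0" "\<And>x. x \<in> U \<Longrightarrow> norm (f x) \<le> B"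
proof -
  have "compact (f ` closure U)"
    by (rule compact_continuous_image) (use assms continuous_on_subset in \<open>auto simp: compact_closure\<close>)
  then obtain B where B: "\<And>x. x \<in> closure U \<Longrightarrow> norm (f x) \<le> B"
    using compact_imp_bounded bounded_iff by (metis imageI)
  show ?thesis
    by (rule that[of "\<bar>B\<bar>"]) (use B closure_subset in \<open>auto intro: order.trans[OF _ abs_ge_self]\<close>)
qed

lemma integrable_lebesgue_on_continuous:
  fixes f :: "'a::euclidean_space \<Rightarrow> 'b::euclidean_space"
  assumes "continuous_on UNIV f" "bounded U" "U \<in> sets lebesgue"
  shows "integrable (lebesgue_on U) f"
proof -
  obtain B where B: "\<And>x. x \<in> U \<Longrightarrow> norm (f x) \<le> B"
    using continuous_on_bounded_on[OF assms(1,2)] by blast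
  show ?thesis
    by (rule integrable_lebesgue_on_bounded[OF bounded_set_imp_lmeasurable[OF assms(2,3)]
        borel_measurable_lebesgue_on_continuous[OF assms(1,3)] B])
qed

text \<open>For a Borel integrand the integral descends to \<open>lborel\<close>, whose translation
  invariance is an identity of image measures.\<close>

lemma lebesgue_integral_translation:
  fixes f :: "'a::euclidean_space \<Rightarrow> 'b::euclidean_space"
  assumes "f \<in> borel_measurable borel"
  shows "(LINT x|lebesgue. f (x + c)) = (LINT x|lebesgue. f x)"
proof -
  have m: "(\<lambda>x. f (x + c)) \<in> borel_measurable lborel" using assms by measurable
  have "(LINT x|lebesgue. f (x + c)) = (LINT x|lborel. f (c + x))"
    using integral_completion[OF m] by (simp add: add.commute)
  also have "\<dots> = (LINT x|distr lborel borel ((+) c). f x)"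
    by (rule integral_distr[symmetric]) (use assms in auto)
  also have "\<dots> = (LINT x|lebesgue. f x)"
    using integral_completion[of f lborel] assms by (simp add: lborel_distr_plus)
  finally show ?thesis .
qed

section \<open>Limits of difference quotients\<close>

lemma tendsto_partial:
  fixes f :: "real^'n::finite \<Rightarrow> 'b::real_normed_vector"
  assumes "f differentiable (at x)"
    and t: "t \<longlonglongrightarrow> 0" "\<And>n. 0 < t n"
  shows "(\<lambda>n. (1 / t n) *\<^sub>R (f (x + t n *\<^sub>R axis i 1) - f x)) \<longlonglongrightarrow> partial i f x"
proof -
  let ?D = "frechet_derivative f (at x)" and ?e = "axis i 1 :: real^'n"
  have D: "(f has_derivative ?D) (at x)" using assms(1) frechet_derivative_works by blast
  have l: "linear ?D" using linear_frechet_derivative[OF assms(1)] .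
  have lim: "((\<lambda>h. norm (f (x + h) - f x - ?D h) / norm h) \<longlongrightarrow> 0) (at 0)"
    using D unfolding has_derivative_at by blast
  have ne: "norm ?e = 1" by (simp add: norm_axis_1)
  have "(\<lambda>n. t n *\<^sub>R ?e) \<longlonglongrightarrow> 0" using tendsto_scaleR[OF t(1) tendsto_const[of ?e]] by simp
  moreover have "t n *\<^sub>R ?e \<noteq> 0" for n using t(2)[of n] ne by (metis less_irrefl norm_zero scaleR_eq_0_iff zero_neq_one)
  ultimately have "filterlim (\<lambda>n. t n *\<^sub>R ?e) (at 0) sequentially"
    by (simp add: filterlim_at)
  from filterlim_compose[OF lim this]
  have L: "(\<lambda>n. norm (f (x + t n *\<^sub>R ?e) - f x - ?D (t n *\<^sub>R ?e)) / norm (t n *\<^sub>R ?e)) \<longlonglongrightarrow> 0" .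
  have eq: "norm (f (x + t n *\<^sub>R ?e) - f x - ?D (t n *\<^sub>R ?e)) / norm (t n *\<^sub>R ?e)
      = norm ((1 / t n) *\<^sub>R (f (x + t n *\<^sub>R ?e) - f x) - partial i f x)" for n
  proof -
    have "(1 / t n) *\<^sub>R (f (x + t n *\<^sub>R ?e) - f x) - partial i f x
        = (1 / t n) *\<^sub>R (f (x + t n *\<^sub>R ?e) - f x - ?D (t n *\<^sub>R ?e))"
      using t(2)[of n] l by (simp add: linear_cmul partial_def scaleR_diff_right)
    then show ?thesis using t(2)[of n] ne by simp
  qed
  have "(\<lambda>n. norm ((1 / t n) *\<^sub>R (f (x + t n *\<^sub>R ?e) - f x) - partial i f x)) \<longlonglongrightarrow> 0"
    using L unfolding eq .
  from tendsto_norm_zero_cancel[OF this] show ?thesis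
    by (rule LIM_zero_cancel)
qed

text \<open>The difference quotients are dominated by a Lipschitz constant of \<psi>. It is taken on
  a ball with margin 1, which contains the shifted points because every \<open>t n\<close> is at
  most 1.\<close>

lemma integral_difference_quotient_tendsto:
  fixes \<psi> :: "real^'n::finite \<Rightarrow> 'b::euclidean_space"
  assumes \<psi>: "smooth_on UNIV \<psi>" and U: "bounded U" "U \<in> sets lebesgue"
    and t: "t \<longlonglongrightarrow> 0" "\<And>n. 0 < t n" "\<And>n. t n \<le> 1"
  shows "(\<lambda>n. LINT x|lebesgue_on U. (1 / t n) *\<^sub>R (\<psi> (x + t n *\<^sub>R axis i 1) - \<psi> x))
           \<longlonglongrightarrow> (LINT x|lebesgue_on U. partial i \<psi> x)"
proof -
  obtain R where R: "\<And>x. x \<in> U \<Longrightarrow> norm x \<le> R" using U(1) unfolding bounded_iff by auto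
  obtain L where L: "L \<ge> 0" "\<And>x y. x \<in> cball 0 (R + 1) \<Longrightarrow> y \<in> cball 0 (R + 1) \<Longrightarrow> norm (\<psi> x - \<psi> y) \<le> L * norm (x - y)"
    using smooth_on_lipschitz[OF \<psi> compact_cball[of 0 "R + 1"] convex_cball] by auto
  have ne: "norm (axis i 1 :: real^'n) = 1" by (simp add: norm_axis_1)
  note cont = smooth_on_continuous[OF \<psi>]
  show ?thesis
  proof (rule integral_dominated_convergence[where w="\<lambda>_. L"])
    show "partial i \<psi> \<in> borel_measurable (lebesgue_on U)"
      by (rule borel_measurable_lebesgue_on_continuous[OF smooth_on_continuous[OF smooth_on_partial[OF \<psi>]] U(2)])
    show "(\<lambda>x. (1 / t n) *\<^sub>R (\<psi> (x + t n *\<^sub>R axis i 1) - \<psi> x)) \<in> borel_measurable (lebesgue_on U)" for n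
    proof (rule borel_measurable_lebesgue_on_continuous[OF _ U(2)])
      have "continuous_on UNIV (\<lambda>x. x + t n *\<^sub>R axis i 1 :: real^'n)" by (intro continuous_intros)
      then have "continuous_on UNIV (\<lambda>x. \<psi> (x + t n *\<^sub>R axis i 1))"
        by (rule continuous_on_compose2[OF cont]) simp
      then show "continuous_on UNIV (\<lambda>x. (1 / t n) *\<^sub>R (\<psi> (x + t n *\<^sub>R axis i 1) - \<psi> x))"
        using cont by (intro continuous_on_scaleR continuous_on_const continuous_on_diff)
    qed
    show "integrable (lebesgue_on U) (\<lambda>_. L)"
      by (rule integrable_lebesgue_on_bounded[OF bounded_set_imp_lmeasurable[OF U]]) auto
    show "AE x in lebesgue_on U. (\<lambda>n. (1 / t n) *\<^sub>R (\<psi> (x + t n *\<^sub>R axis i 1) - \<psi> x)) \<longlonglongrightarrow> partial i \<psi> x"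
      by (intro AE_I2 tendsto_partial smooth_on_differentiable[OF \<psi>] t) auto
    show "AE x in lebesgue_on U. norm ((1 / t n) *\<^sub>R (\<psi> (x + t n *\<^sub>R axis i 1) - \<psi> x)) \<le> L" for n
    proof (rule AE_I2)
      fix x assume "x \<in> space (lebesgue_on U)"
      then have x: "norm x \<le> R" using R by simp
      have "norm (x + t n *\<^sub>R axis i 1) \<le> norm x + t n"
        using norm_triangle_ineq[of x "t n *\<^sub>R axis i 1"] ne t(2)[of n] by simp
      then have "norm (\<psi> (x + t n *\<^sub>R axis i 1) - \<psi> x) \<le> L * norm (t n *\<^sub>R (axis i 1 :: real^'n))"
        using L(2)[of "x + t n *\<^sub>R axis i 1" x] x t(3)[of n] by simp
      then have le: "norm (\<psi> (x + t n *\<^sub>R axis i 1) - \<psi> x) \<le> L * t n"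
        using t(2)[of n] ne by simp
      have "norm ((1 / t n) *\<^sub>R (\<psi> (x + t n *\<^sub>R axis i 1) - \<psi> x)) = norm (\<psi> (x + t n *\<^sub>R axis i 1) - \<psi> x) / t n"
        unfolding norm_scaleR using t(2)[of n] by simp
      also have "\<dots> \<le> L" using le t(2)[of n] by (simp add: pos_divide_le_eq)
      finally show "norm ((1 / t n) *\<^sub>R (\<psi> (x + t n *\<^sub>R axis i 1) - \<psi> x)) \<le> L" .
    qed
  qed
qed

section \<open>Algebra of test functions\<close>

lemma test_funD:
  assumes "\<phi> \<in> test_fun S"
  shows "smooth_on UNIV \<phi>" "compact (supp \<phi>)" "supp \<phi> \<subseteq> S" "\<And>x. x \<notin> supp \<phi> \<Longrightarrow> \<phi> x = 0"
  using assms closure_subset[of "{x. \<phi> x \<noteq> 0}"] unfolding test_fun_def supp_def by auto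

lemma test_fun_mono: "\<phi> \<in> test_fun S \<Longrightarrow> S \<subseteq> T \<Longrightarrow> \<phi> \<in> test_fun T"
  unfolding test_fun_def by auto

lemma test_funI:
  assumes "smooth_on UNIV \<psi>" "\<phi> \<in> test_fun S" "\<And>x. x \<notin> supp \<phi> \<Longrightarrow> \<psi> x = 0"
  shows "\<psi> \<in> test_fun S" "supp \<psi> \<subseteq> supp \<phi>"
proof -
  have "{x. \<psi> x \<noteq> 0} \<subseteq> supp \<phi>" using assms(3) by blast
  then show *: "supp \<psi> \<subseteq> supp \<phi>"
    unfolding supp_def[of \<psi>] using test_funD(2)[OF assms(2)] by (intro closure_minimal) (auto intro: compact_imp_closed)
  then have "supp \<psi> = supp \<phi> \<inter> closure {x. \<psi> x \<noteq> 0}" by (auto simp: supp_def)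
  then have "compact (supp \<psi>)"
    using compact_Int_closed[OF test_funD(2)[OF assms(2)] closed_closure[of "{x. \<psi> x \<noteq> 0}"]] by simp
  then show "\<psi> \<in> test_fun S" using * assms test_funD[OF assms(2)] by (auto simp: test_fun_def)
qed

text \<open>Outside \<open>S\<close> the function \<open>u\<close> is arbitrary, but the product
  vanishes there: \<open>S\<close> and the complement of the support of \<phi> are open, cover the
  space, and on each of them the product is smooth.\<close>

lemma smooth_on_mult_test_fun:
  assumes S: "open S" and u: "smooth_on S u" and \<phi>: "\<phi> \<in> test_fun S"
  shows "smooth_on UNIV (\<lambda>x. u x * \<phi> x)"
proof -
  have \<phi>S: "smooth_on S \<phi>" using smooth_on_subset[OF test_funD(1)[OF \<phi>]] by simp
  have o: "open (- supp \<phi>)" using test_funD(2)[OF \<phi>] by (simp add: compact_imp_closed open_Compl)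
  have "smooth_on (- supp \<phi>) (\<lambda>x. u x * \<phi> x)"
    by (rule smooth_on_cong[OF o _ smooth_on_const[OF o, of 0]]) (use test_funD(4)[OF \<phi>] in auto)
  from smooth_on_Un[OF smooth_on_mult[OF S u \<phi>S] this] show ?thesis
    by (rule smooth_on_subset) (use test_funD(3)[OF \<phi>] in auto)
qed

lemma test_fun_mult:
  assumes "open S" "smooth_on S u" "\<phi> \<in> test_fun S"
  shows "(\<lambda>x. u x * \<phi> x) \<in> test_fun S" "supp (\<lambda>x. u x * \<phi> x) \<subseteq> supp \<phi>"
  using test_funI[OF smooth_on_mult_test_fun[OF assms] assms(3)] test_funD(4)[OF assms(3)] by auto

lemma partial_zero_outside_supp:
  assumes "\<phi> \<in> test_fun S" "x \<notin> supp \<phi>"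
  shows "partial i \<phi> x = 0"
proof -
  have o: "open (- supp \<phi>)" using test_funD(2)[OF assms(1)] by (simp add: compact_imp_closed open_Compl)
  have "partial i \<phi> x = partial i (\<lambda>_. 0) x"
    by (rule partial_cong_open[OF o]) (use assms test_funD[OF assms(1)] in \<open>auto intro: smooth_on_differentiable\<close>)
  then show ?thesis by simp
qed

lemma test_fun_partial:
  assumes "\<phi> \<in> test_fun S" shows "partial i \<phi> \<in> test_fun S"
  by (rule test_funI(1)[OF smooth_on_partial[OF test_funD(1)[OF assms]] assms partial_zero_outside_supp[OF assms]])

lemma test_fun_linear:
  assumes "\<phi> \<in> test_fun S" "bounded_linear B" shows "(\<lambda>x. B (\<phi> x)) \<in> test_fun S"
  by (rule test_funI(1)[OF smooth_on_linear[OF assms(2) open_UNIV test_funD(1)[OF assms(1)]] assms(1)])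
    (use test_funD(4)[OF assms(1)] linear_0[OF bounded_linear.linear[OF assms(2)]] in auto)

lemma test_fun_lincomb:
  assumes "\<phi> \<in> test_fun S" "\<psi> \<in> test_fun S"
  shows "(\<lambda>x. a * \<phi> x + b * \<psi> x) \<in> test_fun S"
proof -
  have s: "smooth_on UNIV (\<lambda>x. a * \<phi> x + b * \<psi> x)"
    by (intro smooth_on_add smooth_on_mult smooth_on_const test_funD(1)[OF assms(1)] test_funD(1)[OF assms(2)] open_UNIV)
  have "{x. a * \<phi> x + b * \<psi> x \<noteq> 0} \<subseteq> supp \<phi> \<union> supp \<psi>"
  proof
    fix x assume "x \<in> {x. a * \<phi> x + b * \<psi> x \<noteq> 0}"
    then have "\<phi> x \<noteq> 0 \<or> \<psi> x \<noteq> 0" by auto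
    then show "x \<in> supp \<phi> \<union> supp \<psi>"
      using test_funD(4)[OF assms(1)] test_funD(4)[OF assms(2)] by blast
  qed
  then have *: "supp (\<lambda>x. a * \<phi> x + b * \<psi> x) \<subseteq> supp \<phi> \<union> supp \<psi>"
    unfolding supp_def[of "\<lambda>x. a * \<phi> x + b * \<psi> x"]
    by (rule closure_minimal) (simp add: supp_def closed_Un)
  have "compact (supp \<phi> \<union> supp \<psi>)" using assms test_funD(2) by blast
  then have "compact (supp (\<lambda>x. a * \<phi> x + b * \<psi> x))"
    using compact_Int_closed[of "supp \<phi> \<union> supp \<psi>" "supp (\<lambda>x. a * \<phi> x + b * \<psi> x)"] *
    by (simp add: Int_absorb1 supp_def[of "\<lambda>x. a * \<phi> x + b * \<psi> x"])
  then show ?thesis using s * assms test_funD(3) unfolding test_fun_def by blast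
qed

lemma test_fun_bounded:
  assumes "\<phi> \<in> test_fun S"
  obtains B where "\<And>x. norm (\<phi> x) \<le> B"
proof -
  obtain B where B: "B \<ge> 0" "\<And>x. x \<in> supp \<phi> \<Longrightarrow> norm (\<phi> x) \<le> B"
    using continuous_on_bounded_on[OF smooth_on_continuous[OF test_funD(1)[OF assms]] compact_imp_bounded[OF test_funD(2)[OF assms]]] by blast
  have "norm (\<phi> x) \<le> B" for x
    using B test_funD(4)[OF assms] by (cases "x \<in> supp \<phi>") auto
  then show ?thesis by (rule that)
qed

text \<open>By translation invariance, the difference quotients whose limit is the integral all vanish.\<close>

lemma integral_partial_test_fun:
  assumes U: "open U" "bounded U" and \<psi>: "\<psi> \<in> test_fun U"
  shows "(LINT x|lebesgue_on U. partial i \<psi> x) = 0"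
proof -
  note D = test_funD[OF \<psi>]
  have Us: "U \<in> sets lebesgue" using U(1) by auto
  have Ub: "U \<in> sets borel" using U(1) by auto
  obtain \<epsilon> where \<epsilon>: "\<epsilon> > 0" "(\<Union>x\<in>supp \<psi>. ball x \<epsilon>) \<subseteq> U"
    using compact_subset_open_imp_ball_epsilon_subset[OF D(2) U(1) D(3)] by blast
  \<comment> \<open>With \<open>n + 2\<close> in the denominator every shift is at most half of
    \<epsilon>, so a point whose translate lies in the support is itself in
    \<open>U\<close>.\<close>
  define t where "t = (\<lambda>n::nat. min \<epsilon> 1 / real (n + 2))"
  have t0: "0 < t n" "t n \<le> 1" "t n < \<epsilon>" for n
  proof -
    have "t n \<le> min \<epsilon> 1 / 2"
      unfolding t_def by (rule divide_left_mono) (use \<epsilon>(1) in auto)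
    moreover show "0 < t n" using \<epsilon>(1) by (simp add: t_def)
    ultimately show "t n \<le> 1" "t n < \<epsilon>" using \<epsilon>(1) by linarith+
  qed
  have "(\<lambda>n. min \<epsilon> 1 / real (n + 2)) \<longlonglongrightarrow> 0"
    by (rule LIMSEQ_ignore_initial_segment[OF lim_const_over_n])
  then have t: "t \<longlonglongrightarrow> 0" by (simp add: t_def)
  have cont: "continuous_on UNIV \<psi>" by (rule smooth_on_continuous[OF D(1)])
  have bm: "\<psi> \<in> borel_measurable borel" using cont by (simp add: borel_measurable_continuous_onI)
  have ne: "norm (axis i 1 :: real^'a) = 1" by (simp add: norm_axis_1)
  have z: "(LINT x|lebesgue_on U. (1 / t n) *\<^sub>R (\<psi> (x + t n *\<^sub>R axis i 1) - \<psi> x)) = 0" for n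
  proof -
    have "continuous_on UNIV (\<lambda>x. x + t n *\<^sub>R axis i 1 :: real^'a)" by (intro continuous_intros)
    then have c2: "continuous_on UNIV (\<lambda>x. \<psi> (x + t n *\<^sub>R axis i 1))"
      by (rule continuous_on_compose2[OF cont]) simp
    have "(LINT x|lebesgue_on U. \<psi> (x + t n *\<^sub>R axis i 1)) = (LINT x|lebesgue. indicator U x *\<^sub>R \<psi> (x + t n *\<^sub>R axis i 1))"
      using Us by (simp add: integral_restrict_space)
    also have "\<dots> = (LINT x|lebesgue. \<psi> (x + t n *\<^sub>R axis i 1))"
    proof (rule Bochner_Integration.integral_cong[OF refl])
      fix x
      have "x \<in> U" if "\<psi> (x + t n *\<^sub>R axis i 1) \<noteq> 0"
      proof -
        have "x + t n *\<^sub>R axis i 1 \<in> supp \<psi>" using that D(4) by blast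
        moreover have "x \<in> ball (x + t n *\<^sub>R axis i 1) \<epsilon>" using t0[of n] ne by (simp add: dist_norm)
        ultimately show ?thesis using \<epsilon>(2) by blast
      qed
      then show "indicator U x *\<^sub>R \<psi> (x + t n *\<^sub>R axis i 1) = \<psi> (x + t n *\<^sub>R axis i 1)"
        by (auto simp: indicator_def)
    qed
    also have "\<dots> = (LINT x|lebesgue. \<psi> x)" by (rule lebesgue_integral_translation[OF bm])
    also have "\<dots> = (LINT x|lebesgue. indicator U x *\<^sub>R \<psi> x)"
      by (rule Bochner_Integration.integral_cong[OF refl]) (use D(3,4) in \<open>auto simp: indicator_def\<close>)
    also have "\<dots> = (LINT x|lebesgue_on U. \<psi> x)"
      using Us by (simp add: integral_restrict_space)
    finally have e: "(LINT x|lebesgue_on U. \<psi> (x + t n *\<^sub>R axis i 1)) = (LINT x|lebesgue_on U. \<psi> x)" .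
    show ?thesis
      using e integrable_lebesgue_on_continuous[OF cont U(2) Us] integrable_lebesgue_on_continuous[OF c2 U(2) Us]
      by simp
  qed
  show ?thesis
    using integral_difference_quotient_tendsto[OF D(1) U(2) Us t t0(1,2), of i]
    unfolding z LIMSEQ_const_iff by (rule sym)
qed

text \<open>The product of \<open>u\<close> with a test function is again a test function even when
  \<open>u\<close> is smooth only inside \<open>U\<close>, so the integral of its derivative
  vanishes and the product rule gives the rest.\<close>

lemma integral_test_fun_parts:
  assumes U: "open U" "bounded U" and u: "smooth_on U u" and \<phi>: "\<phi> \<in> test_fun U"
  shows "integrable (lebesgue_on U) (\<lambda>x. u x * \<phi> x)"
    "(LINT x|lebesgue_on U. u x * partial i \<phi> x) = - (LINT x|lebesgue_on U. partial i u x * \<phi> x)"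
proof -
  have Us: "U \<in> sets lebesgue" using U(1) by auto
  have int: "integrable (lebesgue_on U) (\<lambda>x. v x * \<theta> x)" if "smooth_on U v" "\<theta> \<in> test_fun U" for v \<theta>
    by (rule integrable_lebesgue_on_continuous[OF smooth_on_continuous[OF smooth_on_mult_test_fun[OF U(1) that]] U(2) Us])
  then show "integrable (lebesgue_on U) (\<lambda>x. u x * \<phi> x)" using u \<phi> .
  have "(LINT x|lebesgue_on U. u x * partial i \<phi> x) + (LINT x|lebesgue_on U. partial i u x * \<phi> x)
      = (LINT x|lebesgue_on U. u x * partial i \<phi> x + partial i u x * \<phi> x)"
    by (rule Bochner_Integration.integral_add[symmetric])
      (intro int u \<phi> smooth_on_partial test_fun_partial)+
  also have "\<dots> = (LINT x|lebesgue_on U. partial i (\<lambda>x. u x * \<phi> x) x)"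
    by (rule Bochner_Integration.integral_cong[OF refl], rule partial_mult[symmetric])
      (use u smooth_on_differentiable[OF test_funD(1)[OF \<phi>]] in \<open>auto intro: smooth_on_differentiable\<close>)
  also have "\<dots> = 0"
    by (rule integral_partial_test_fun[OF U test_fun_mult(1)[OF U(1) u \<phi>]])
  finally show "(LINT x|lebesgue_on U. u x * partial i \<phi> x) = - (LINT x|lebesgue_on U. partial i u x * \<phi> x)"
    by (simp add: eq_neg_iff_add_eq_0)
qed

text \<open>Cutoffs that are 1 on \<open>K\<close> and supported in shrinking neighbourhoods
  converge to the indicator of \<open>K\<close>. Their supports stay in one compact
  \<open>K'\<close> inside \<Omega>, which provides a dominating function although \<open>F\<close>
  is only locally integrable.\<close>

lemma integral_compact_zero:
  fixes F :: "real^'n::finite \<Rightarrow> complex"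
  assumes \<Omega>: "open \<Omega>" and F: "F \<in> borel_measurable (lebesgue_on \<Omega>)"
    and int: "\<And>K. compact K \<Longrightarrow> K \<subseteq> \<Omega> \<Longrightarrow> integrable (lebesgue_on K) F"
    and zero: "\<And>\<phi>. \<phi> \<in> test_fun \<Omega> \<Longrightarrow> (LINT x|lebesgue_on \<Omega>. F x * \<phi> x) = 0"
    and K: "compact K" "K \<subseteq> \<Omega>"
  shows "(LINT x|lebesgue_on K. F x) = 0"
proof -
  obtain \<epsilon> where \<epsilon>: "\<epsilon> > 0" "(\<Union>x\<in>K. ball x \<epsilon>) \<subseteq> \<Omega>"
    using compact_subset_open_imp_ball_epsilon_subset[OF K(1) \<Omega> K(2)] by blast
  define K' where "K' = (\<Union>x\<in>K. cball x (\<epsilon> / 2))"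
  have K'eq: "K' = {x + y |x y. x \<in> K \<and> y \<in> cball 0 (\<epsilon> / 2)}"
  proof (intro set_eqI iffI)
    fix z assume "z \<in> K'"
    then obtain x where "x \<in> K" "dist x z \<le> \<epsilon> / 2" by (auto simp: K'_def)
    then show "z \<in> {x + y |x y. x \<in> K \<and> y \<in> cball 0 (\<epsilon> / 2)}"
      by (intro CollectI exI[of _ x] exI[of _ "z - x"]) (auto simp: dist_norm norm_minus_commute)
  next
    fix z assume "z \<in> {x + y |x y. x \<in> K \<and> y \<in> cball 0 (\<epsilon> / 2)}"
    then obtain x y where "z = x + y" "x \<in> K" "norm y \<le> \<epsilon> / 2" by auto
    then show "z \<in> K'" unfolding K'_def by (intro UN_I[of x]) (auto simp: dist_norm)
  qed
  have K': "compact K'" unfolding K'eq by (rule compact_sums[OF K(1) compact_cball])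
  have K'\<Omega>: "K' \<subseteq> \<Omega>" unfolding K'_def using \<epsilon> by force
  define U where "U = (\<lambda>n::nat. \<Union>x\<in>K. ball x (\<epsilon> / real (n + 2)))"
  have U: "open (U n)" "K \<subseteq> U n" "U n \<subseteq> K'" for n
  proof -
    show "open (U n)" "K \<subseteq> U n" using \<epsilon>(1) by (auto simp: U_def)
    have "\<epsilon> / real (n + 2) \<le> \<epsilon> / 2" by (rule divide_left_mono) (use \<epsilon>(1) in auto)
    then have "ball x (\<epsilon> / real (n + 2)) \<subseteq> cball x (\<epsilon> / 2)" for x :: "real^'n"
      by (meson ball_subset_cball order.trans subset_ball)
    then show "U n \<subseteq> K'" unfolding U_def K'_def by (intro UN_mono) auto
  qed
  have "\<exists>\<kappa>. \<kappa> \<in> test_fun (U n) \<and> (\<forall>x. norm (\<kappa> x) \<le> 1) \<and> (\<forall>x\<in>K. \<kappa> x = 1)" for n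
    using test_fun_cutoff_exists[OF K(1) U(1,2)[of n]] by (metis subsetD)
  then obtain \<kappa> where \<kappa>: "\<And>n. \<kappa> n \<in> test_fun (U n)" "\<And>n x. norm (\<kappa> n x) \<le> 1" "\<And>n x. x \<in> K \<Longrightarrow> \<kappa> n x = 1"
    by metis
  have sets: "\<Omega> \<in> sets lebesgue" "K' \<in> sets lebesgue" "K \<in> sets lebesgue"
    using \<Omega> K(1) K' by (auto intro: lmeasurable_compact fmeasurableD)
  have z: "(LINT x|lebesgue. indicator \<Omega> x *\<^sub>R (F x * \<kappa> n x)) = 0" for n
  proof -
    have "\<kappa> n \<in> test_fun \<Omega>" using test_fun_mono[OF \<kappa>(1)] U(3) K'\<Omega> by blast
    from zero[OF this] show ?thesis using sets by (simp add: integral_restrict_space)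
  qed
  have mF: "(\<lambda>x. indicator \<Omega> x *\<^sub>R F x) \<in> borel_measurable lebesgue"
    using F sets by (simp add: borel_measurable_restrict_space_iff)
  have "(\<lambda>n. LINT x|lebesgue. indicator \<Omega> x *\<^sub>R (F x * \<kappa> n x)) \<longlonglongrightarrow> (LINT x|lebesgue. indicator K x *\<^sub>R F x)"
  proof (rule integral_dominated_convergence[where w="\<lambda>x. norm (indicator K' x *\<^sub>R F x)"])
    show "integrable lebesgue (\<lambda>x. norm (indicator K' x *\<^sub>R F x))"
      using int[OF K' K'\<Omega>] sets by (simp add: integrable_restrict_space del: norm_scaleR)
    show "(\<lambda>x. indicator K x *\<^sub>R F x) \<in> borel_measurable lebesgue"
      using int[OF K] sets by (simp add: integrable_restrict_space)
    show "(\<lambda>x. indicator \<Omega> x *\<^sub>R (F x * \<kappa> n x)) \<in> borel_measurable lebesgue" for n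
    proof -
      have "\<kappa> n \<in> borel_measurable lebesgue"
        using smooth_on_continuous[OF test_funD(1)[OF \<kappa>(1)[of n]]]
        by (simp add: borel_measurable_continuous_onI measurable_completion)
      then have "(\<lambda>x. (indicator \<Omega> x *\<^sub>R F x) * \<kappa> n x) \<in> borel_measurable lebesgue"
        using mF by (intro borel_measurable_times)
      then show ?thesis by simp
    qed
    have Kn: "x \<notin> U n \<Longrightarrow> \<kappa> n x = 0" for n x
      using test_funD(3,4)[OF \<kappa>(1)[of n]] by blast
    show "AE x in lebesgue. norm (indicator \<Omega> x *\<^sub>R (F x * \<kappa> n x)) \<le> norm (indicator K' x *\<^sub>R F x)" for n
    proof (rule AE_I2)
      fix x
      show "norm (indicator \<Omega> x *\<^sub>R (F x * \<kappa> n x)) \<le> norm (indicator K' x *\<^sub>R F x)"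
      proof (cases "x \<in> U n")
        case True
        then have "x \<in> K'" using U(3) by blast
        then show ?thesis using \<kappa>(2)[of n x] by (auto simp: indicator_def norm_mult mult_left_le)
      qed (simp add: Kn)
    qed
    show "AE x in lebesgue. (\<lambda>n. indicator \<Omega> x *\<^sub>R (F x * \<kappa> n x)) \<longlonglongrightarrow> indicator K x *\<^sub>R F x"
    proof (rule AE_I2)
      fix x
      show "(\<lambda>n. indicator \<Omega> x *\<^sub>R (F x * \<kappa> n x)) \<longlonglongrightarrow> indicator K x *\<^sub>R F x"
      proof (cases "x \<in> K")
        case True
        then show ?thesis using \<kappa>(3) K(2) by (auto simp: indicator_def)
      next
        case False
        then obtain \<delta> where \<delta>: "\<delta> > 0" "ball x \<delta> \<subseteq> - K"
          using K(1) by (metis ComplI compact_imp_closed open_Compl open_contains_ball)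
        obtain N where N: "\<epsilon> / \<delta> < real N" using reals_Archimedean2 by blast
        have "\<forall>\<^sub>F n in sequentially. indicator \<Omega> x *\<^sub>R (F x * \<kappa> n x) = indicator K x *\<^sub>R F x"
        proof (rule eventually_sequentiallyI[of N])
          fix n assume "N \<le> n"
          then have "\<epsilon> / \<delta> < real (n + 2)" using N by linarith
          then have "\<epsilon> / real (n + 2) < \<delta>" using \<delta>(1) by (simp add: field_simps)
          then have "x \<notin> U n" using \<delta>(2) by (force simp: U_def dist_commute)
          then show "indicator \<Omega> x *\<^sub>R (F x * \<kappa> n x) = indicator K x *\<^sub>R F x" using Kn False by simp
        qed
        then show ?thesis by (rule tendsto_eventually)
      qed
    qed
  qed
  then have "(LINT x|lebesgue. indicator K x *\<^sub>R F x) = 0"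
    unfolding z by (simp add: LIMSEQ_const_iff)
  then show ?thesis using sets by (simp add: integral_restrict_space)
qed

text \<open>Up to a null set, the set where \<open>f\<close> is positive is a countable union of
  compact sets; on each of them a positive function with integral zero forces measure zero.\<close>

lemma AE_nonpos_if_integral_compact_zero:
  fixes f :: "real^'n::finite \<Rightarrow> real"
  assumes \<Omega>: "\<Omega> \<in> sets lebesgue" and f: "f \<in> borel_measurable (lebesgue_on \<Omega>)"
    and int: "\<And>K. compact K \<Longrightarrow> K \<subseteq> \<Omega> \<Longrightarrow> integrable (lebesgue_on K) f"
    and zero: "\<And>K. compact K \<Longrightarrow> K \<subseteq> \<Omega> \<Longrightarrow> (LINT x|lebesgue_on K. f x) = 0"
  shows "AE x in lebesgue_on \<Omega>. f x \<le> 0"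
proof -
  define P where "P = {x \<in> \<Omega>. 0 < f x}"
  have "{x \<in> space (lebesgue_on \<Omega>). 0 < f x} \<in> sets (lebesgue_on \<Omega>)" using f by measurable
  then have "P \<in> sets lebesgue" using \<Omega> by (auto simp: P_def sets_restrict_space_iff)
  from lebesgue_set_almost_fsigma[OF this] obtain C T
    where CT: "fsigma C" "T \<in> null_sets lebesgue" "C \<union> T = P" by metis
  obtain F :: "nat \<Rightarrow> (real^'n) set" where F: "range F \<subseteq> Collect compact" "C = \<Union>(range F)"
    using CT(1) fsigma_Union_compact[of C] by auto
  have "F k \<in> null_sets lebesgue" for k
  proof -
    have k: "compact (F k)" "F k \<subseteq> \<Omega>" using F CT(3) by (auto simp: P_def)
    have s: "F k \<in> sets lebesgue" using k(1) by (auto intro: lmeasurable_compact fmeasurableD)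
    have pos: "0 < f x" if "x \<in> F k" for x using that F(2) CT(3) by (auto simp: P_def)
    have "AE x in lebesgue_on (F k). f x = 0"
      by (rule integral_nonneg_eq_0_iff_AE[OF int[OF k], THEN iffD1, OF _ zero[OF k]])
        (use pos in \<open>auto intro!: AE_I2 less_imp_le\<close>)
    then have "AE x in lebesgue. x \<in> F k \<longrightarrow> f x = 0"
      using s by (simp add: AE_restrict_space_iff)
    then have "AE x in lebesgue. x \<notin> F k"
      by (rule eventually_mono) (use pos in force)
    then show ?thesis using s by (simp add: AE_iff_null_sets)
  qed
  then have "P \<in> null_sets lebesgue" using CT F by auto
  then have "AE x in lebesgue. x \<notin> P" by (rule AE_not_in)
  then show ?thesis using \<Omega> by (auto simp: AE_restrict_space_iff P_def not_less elim!: eventually_mono)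
qed

text \<open>The previous argument is one-sided and real, so it is applied to the real and imaginary
  parts and to their negatives.\<close>

lemma fundamental_lemma:
  fixes F :: "real^'n::finite \<Rightarrow> complex"
  assumes \<Omega>: "open \<Omega>" and F: "F \<in> borel_measurable (lebesgue_on \<Omega>)"
    and int: "\<And>K. compact K \<Longrightarrow> K \<subseteq> \<Omega> \<Longrightarrow> integrable (lebesgue_on K) F"
    and zero: "\<And>\<phi>. \<phi> \<in> test_fun \<Omega> \<Longrightarrow> (LINT x|lebesgue_on \<Omega>. F x * \<phi> x) = 0"
  shows "AE x in lebesgue_on \<Omega>. F x = 0"
proof -
  have s: "\<Omega> \<in> sets lebesgue" using \<Omega> by auto
  have "AE x in lebesgue_on \<Omega>. B (F x) \<le> 0" if B: "bounded_linear B" for B :: "complex \<Rightarrow> real"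
  proof (rule AE_nonpos_if_integral_compact_zero[OF s])
    show "(\<lambda>x. B (F x)) \<in> borel_measurable (lebesgue_on \<Omega>)"
      using borel_measurable_continuous_on[OF linear_continuous_on[OF B] F] by (simp add: comp_def)
    fix K assume K: "compact K" "K \<subseteq> \<Omega>"
    show "integrable (lebesgue_on K) (\<lambda>x. B (F x))"
      by (rule integrable_bounded_linear[OF B int[OF K]])
    show "(LINT x|lebesgue_on K. B (F x)) = 0"
      using integral_bounded_linear[OF B int[OF K]] integral_compact_zero[OF assms K]
        linear_0[OF bounded_linear.linear[OF B]] by simp
  qed
  note * = this
  have "AE x in lebesgue_on \<Omega>. Re (F x) \<le> 0 \<and> - Re (F x) \<le> 0 \<and> Im (F x) \<le> 0 \<and> - Im (F x) \<le> 0"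
    by (intro AE_conjI *) (auto intro: bounded_linear_Re bounded_linear_Im bounded_linear_minus)
  then show ?thesis by (rule eventually_mono) (simp add: complex_eq_iff)
qed

section \<open>The boundary estimate\<close>

definition strip :: "'n::finite \<Rightarrow> real \<Rightarrow> (real^'n \<Rightarrow> real) \<Rightarrow> (real^'n) set \<Rightarrow> real \<Rightarrow> (real^'n) set" where
  "strip k s h B w = {x \<in> B. \<bar>s * x $ k - h x\<bar> \<le> w}"

text \<open>Projection along axis \<open>k\<close> to the graph \<open>s * x $ k = h x\<close>: the
  new coordinate is \<open>s * h x\<close> because \<open>s * s = 1\<close>, and \<open>h\<close>
  does not change under the projection as it ignores coordinate \<open>k\<close>.\<close>

definition graph_proj :: "'n::finite \<Rightarrow> real \<Rightarrow> (real^'n \<Rightarrow> real) \<Rightarrow> real^'n \<Rightarrow> real^'n" where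
  "graph_proj k s h x = (\<chi> j. if j = k then s * h x else x $ j)"

lemma compact_strip:
  assumes "continuous_on UNIV h" "compact B"
  shows "compact (strip k s h B w)"
proof -
  have "closed {x. \<bar>s * x $ k - h x\<bar> \<le> w}"
    by (intro closed_Collect_le continuous_intros assms(1))
  from compact_Int_closed[OF assms(2) this] show ?thesis
    by (simp add: strip_def Collect_conj_eq)
qed

lemma continuous_graph_proj:
  assumes "continuous_on UNIV h" shows "continuous_on UNIV (graph_proj k s h)"
  unfolding graph_proj_def[abs_def]
proof (rule continuous_on_vec_lambda)
  fix j show "continuous_on UNIV (\<lambda>x. if j = k then s * h x else x $ j)"
    by (cases "j = k") (auto intro!: continuous_intros assms)
qed

text \<open>About \<open>1 / t\<close> vertical translates of the strip are disjoint and stay in a fixed ball.\<close>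

lemma measure_strip_le:
  fixes h :: "real^'n::finite \<Rightarrow> real"
  assumes h: "continuous_on UNIV h" and hk: "\<And>x y. (\<And>j. j \<noteq> k \<Longrightarrow> x $ j = y $ j) \<Longrightarrow> h x = h y"
    and s: "s \<in> {-1, 1}" and c: "c > 0"
  obtains C where "C \<ge> 0" "\<And>t. 0 < t \<Longrightarrow> t \<le> 1 \<Longrightarrow> measure lebesgue (strip k s h (cball p r) (c * t)) \<le> C * t"
proof -
  \<comment> \<open>Below, \<open>N\<close> translates are spaced \<open>3 * c * t\<close> apart and
    \<open>N * t\<close> is at most 2, hence the radius \<open>r + 6 * c\<close>. The spacing
    exceeds the vertical width \<open>2 * c * t\<close> of the strip, which makes the translates
    disjoint.\<close>
  define V where "V = measure lebesgue (cball p (r + 6 * c))"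
  show ?thesis
  proof (rule that[of V])
    fix t :: real assume t: "0 < t" "t \<le> 1"
    let ?S = "strip k s h (cball p r) (c * t)"
    let ?e = "axis k 1 :: real^'n"
    have S: "?S \<in> lmeasurable" using compact_strip[OF h compact_cball] lmeasurable_compact by blast
    define N where "N = nat \<lceil>1 / t\<rceil>"
    have "real N < 1 / t + 1" using t ceiling_correct[of "1 / t"] unfolding N_def by (simp add: of_nat_nat)
    then have "real N * t < (1 / t + 1) * t" using t by (intro mult_strict_right_mono) auto
    moreover have "(1 / t + 1) * t = 1 + t" using t by (simp add: distrib_right)
    ultimately have Nt: "real N * t \<le> 2" using t by linarith
    have N1: "1 / t \<le> real N" unfolding N_def using real_nat_ceiling_ge by blast
    define T where "T = (\<lambda>j::nat. (+) ((3 * c * t * real j) *\<^sub>R ?e) ` ?S)"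
    have Tm: "T j \<in> lmeasurable" for j unfolding T_def by (rule measurable_translation[OF S])
    have disj: "disjoint_family_on T {..<N}"
      unfolding disjoint_family_on_def
    proof (intro ballI impI)
      fix i j :: nat assume "i \<noteq> j"
      show "T i \<inter> T j = {}"
      proof (rule ccontr)
        assume "\<not> ?thesis"
        then obtain u v where uv: "u \<in> ?S" "v \<in> ?S"
          and eq: "(3 * c * t * real i) *\<^sub>R ?e + u = (3 * c * t * real j) *\<^sub>R ?e + v"
          by (auto simp: T_def)
        have "u $ l = v $ l" if "l \<noteq> k" for l
          using arg_cong[OF eq, of "\<lambda>x. x $ l"] that by (simp add: axis_def)
        then have "h u = h v" by (rule hk)
        moreover have "3 * c * t * real i + u $ k = 3 * c * t * real j + v $ k"
          using arg_cong[OF eq, of "\<lambda>x. x $ k"] by (simp add: axis_def)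
        ultimately have "\<bar>3 * (c * t) * (real i - real j)\<bar> \<le> 2 * (c * t)"
          using uv s by (auto simp: strip_def algebra_simps abs_le_iff)
        moreover have "1 \<le> \<bar>real i - real j\<bar>" using \<open>i \<noteq> j\<close> by linarith
        moreover have "0 < c * t" using c t by simp
        moreover have "\<bar>3 * w * e\<bar> \<le> 2 * w \<Longrightarrow> 1 \<le> \<bar>e\<bar> \<Longrightarrow> 0 < w \<Longrightarrow> False" for w e :: real
          using mult_left_mono[of 1 "\<bar>e\<bar>" "3 * w"] by (simp add: abs_mult)
        ultimately show False by blast
      qed
    qed
    have sub: "(\<Union>j\<in>{..<N}. T j) \<subseteq> cball p (r + 6 * c)"
    proof
      fix x assume "x \<in> (\<Union>j\<in>{..<N}. T j)"
      then obtain j u where ju: "j < N" "u \<in> ?S" "x = (3 * c * t * real j) *\<^sub>R ?e + u" by (auto simp: T_def)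
      have "dist p x \<le> dist p u + norm ((3 * c * t * real j) *\<^sub>R ?e)"
        using norm_triangle_ineq4[of "p - u" "(3 * c * t * real j) *\<^sub>R ?e"] ju(3)
        by (simp add: dist_norm algebra_simps)
      also have "\<dots> \<le> r + 3 * c * (real j * t)"
        using ju(2) c t by (simp add: strip_def norm_axis_1)
      also have "\<dots> \<le> r + 3 * c * 2"
      proof -
        have "real j * t \<le> real N * t" using ju(1) t by (intro mult_right_mono) auto
        then show ?thesis using Nt c by (intro add_left_mono mult_left_mono) auto
      qed
      finally show "x \<in> cball p (r + 6 * c)" using c by simp
    qed
    have "real N * measure lebesgue ?S = (\<Sum>j\<in>{..<N}. measure lebesgue (T j))"
      by (simp add: T_def measure_translation)
    also have "\<dots> = measure lebesgue (\<Union>j\<in>{..<N}. T j)"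
      by (rule measure_finite_Union[symmetric])
        (use disj fmeasurableD[OF Tm] fmeasurableD2[OF Tm] in auto)
    also have "\<dots> \<le> V"
      unfolding V_def by (rule measure_mono_fmeasurable[OF sub]) (use Tm in auto)
    finally have "real N * measure lebesgue ?S \<le> V" .
    moreover have "(1 / t) * measure lebesgue ?S \<le> real N * measure lebesgue ?S"
      using N1 by (rule mult_right_mono) simp
    ultimately have "(1 / t) * measure lebesgue ?S \<le> V" by linarith
    then show "measure lebesgue ?S \<le> V * t" using t by (simp add: field_simps)
  qed (simp add: V_def)
qed

text \<open>Only the side in direction \<open>k\<close> has length of order \<open>t\<close>; as
  \<delta> is at most \<open>t\<close>, that side is at most \<open>2 * (c + 1) * t\<close>. The
  other sides contribute exactly the power of \<delta> that Hausdorff content sums.\<close>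

lemma emeasure_lborel_box_le:
  fixes q :: "real^'n::finite"
  assumes "0 \<le> \<delta>" "\<delta> \<le> t" "0 \<le> c"
  shows "emeasure lborel (cbox (q - (\<chi> j. if j = k then c * t + \<delta> else \<delta>)) (q + (\<chi> j. if j = k then c * t + \<delta> else \<delta>)))
    \<le> ennreal (2 ^ CARD('n) * (c + 1) * t) * ennreal (\<delta> ^ (CARD('n) - 1))"
proof -
  let ?v = "(\<chi> j. if j = k then c * t + \<delta> else \<delta>) :: real^'n"
  have v0: "0 \<le> ?v $ j" for j using assms by auto
  have ne: "cbox (q - ?v) (q + ?v) \<noteq> {}"
    using v0 by (auto simp: box_ne_empty Basis_vec_def inner_axis)
  have "measure lborel (cbox (q - ?v) (q + ?v)) = (\<Prod>j\<in>UNIV. 2 * ?v $ j)"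
    using content_cbox_cart[OF ne] by (simp only: vector_minus_component vector_add_component) (simp add: algebra_simps)
  also have "\<dots> = (2 * (c * t + \<delta>)) * (\<Prod>j\<in>UNIV - {k}. 2 * \<delta>)"
    by (subst prod.remove[of UNIV k]) auto
  also have "\<dots> = (2 * (c * t + \<delta>)) * (2 * \<delta>) ^ (CARD('n) - 1)"
    by (simp add: card_Diff_singleton)
  also have "\<dots> = 2 ^ CARD('n) * (c * t + \<delta>) * \<delta> ^ (CARD('n) - 1)"
    by (simp add: power_mult_distrib power_eq_if[of 2 "CARD('n)"])
  also have "\<dots> \<le> 2 ^ CARD('n) * ((c + 1) * t) * \<delta> ^ (CARD('n) - 1)"
    using assms by (intro mult_right_mono mult_left_mono) (auto simp: algebra_simps)
  finally have le: "measure lborel (cbox (q - ?v) (q + ?v)) \<le> 2 ^ CARD('n) * (c + 1) * t * \<delta> ^ (CARD('n) - 1)"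
    by (simp add: mult.assoc)
  have "emeasure lborel (cbox (q - ?v) (q + ?v)) = ennreal (measure lborel (cbox (q - ?v) (q + ?v)))"
    by (rule emeasure_eq_ennreal_measure) (use emeasure_lborel_cbox_finite[of "q - ?v" "q + ?v"] in auto)
  also have "\<dots> \<le> ennreal (2 ^ CARD('n) * (c + 1) * t * \<delta> ^ (CARD('n) - 1))"
    using le by (rule ennreal_leI)
  also have "\<dots> = ennreal (2 ^ CARD('n) * (c + 1) * t) * ennreal (\<delta> ^ (CARD('n) - 1))"
    using assms by (intro ennreal_mult) auto
  finally show ?thesis .
qed

text \<open>A cover of \<open>A\<close> by sets of diameter \<open>\<delta> \<le> t\<close> covers the preimage by boxes of volume \<open>O(\<delta>\<^bsup>d - 1\<^esup> t)\<close>. The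
  isodiametric inequality is not needed, since only a bound up to constants is claimed.\<close>

lemma emeasure_strip_proj_le:
  fixes h :: "real^'n::finite \<Rightarrow> real"
  assumes h: "continuous_on UNIV h" and s: "s \<in> {-1, 1}" and c: "c > 0" and n2: "CARD('n) \<ge> 2"
  obtains K where "K \<ge> 0" "\<And>t A. 0 < t \<Longrightarrow> A \<in> sets borel \<Longrightarrow>
     emeasure lborel {x \<in> strip k s h (cball p r) (c * t). graph_proj k s h x \<in> A}
       \<le> ennreal (K * t) * hausdorff_outer (CARD('n) - 1) A"
proof -
  let ?m = "CARD('n) - 1"
  define K0 where "K0 = 2 ^ CARD('n) * (c + 1)"
  \<comment> \<open>The normalising factor in \<open>hausdorff_outer\<close>; the constant of the
    lemma is divided by it because the covering argument yields the bare content.\<close>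
  define b where "b = unit_ball_vol (real ?m) / 2 ^ ?m"
  have K0: "K0 > 0" using c by (simp add: K0_def)
  have b: "b > 0" by (simp add: b_def)
  show ?thesis
  proof (rule that[of "K0 / b"])
    show "0 \<le> K0 / b" using K0 b by simp
    fix t :: real and A :: "(real^'n) set" assume t: "0 < t" and A: "A \<in> sets borel"
    let ?S = "strip k s h (cball p r) (c * t)"
    let ?W = "{x \<in> ?S. graph_proj k s h x \<in> A}"
    have Kt: "0 < K0 * t" using K0 t by simp
    have inv: "ennreal (1 / (K0 * t)) * ennreal (K0 * t) = 1" "ennreal (K0 * t) * ennreal (1 / (K0 * t)) = 1"
      by (subst ennreal_mult[symmetric]; use Kt K0 t in simp)+
    \<comment> \<open>With the constant on the left, the bound can be checked against each single
      cover. The scale \<open>t\<close> makes all diameters at most \<open>t\<close>, as the box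
      estimate requires.\<close>
    have "ennreal (1 / (K0 * t)) * emeasure lborel ?W \<le> hausdorff_content ?m t A"
    proof (rule hausdorff_content_ge)
      fix C :: "nat \<Rightarrow> (real^'n) set"
      assume C: "A \<subseteq> (\<Union>n. C n)" "\<And>n. bounded (C n)" "\<And>n. diameter (C n) \<le> t"
      \<comment> \<open>A centre inside \<open>C n\<close>. For empty \<open>C n\<close> it is
        unspecified, which is harmless because no point projects into an empty set.\<close>
      define q where "q = (\<lambda>n. SOME q. q \<in> C n)"
      define d where "d = (\<lambda>n. diameter (C n))"
      have d0: "0 \<le> d n" for n unfolding d_def by (rule diameter_ge_0[OF C(2)])
      define v where "v = (\<lambda>n. (\<chi> j. if j = k then c * t + d n else d n) :: real^'n)"
      define Bx where "Bx = (\<lambda>n. cbox (q n - v n) (q n + v n))"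
      have "?W \<subseteq> (\<Union>n. Bx n)"
      proof
        fix x assume x: "x \<in> ?W"
        then have "graph_proj k s h x \<in> (\<Union>n. C n)" using C(1) by blast
        then obtain n where n: "graph_proj k s h x \<in> C n" by blast
        have q: "q n \<in> C n" unfolding q_def using n by (rule someI)
        have "dist (graph_proj k s h x) (q n) \<le> d n"
          unfolding d_def by (rule diameter_bounded_bound[OF C(2) n q])
        then have dj: "\<bar>graph_proj k s h x $ j - q n $ j\<bar> \<le> d n" for j
          using component_le_norm_cart[of "graph_proj k s h x - q n" j] by (simp add: dist_norm)
        have "\<bar>s * x $ k - h x\<bar> \<le> c * t" using x by (simp add: strip_def)
        then have xk: "\<bar>x $ k - s * h x\<bar> \<le> c * t" using s by auto
        have "\<bar>x $ j - q n $ j\<bar> \<le> v n $ j" for j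
          using dj[of j] xk by (cases "j = k") (auto simp: graph_proj_def v_def)
        then have "x \<in> Bx n" unfolding Bx_def mem_box_cart by (simp add: abs_le_iff algebra_simps)
        then show "x \<in> (\<Union>n. Bx n)" by blast
      qed
      then have "emeasure lborel ?W \<le> emeasure lborel (\<Union>n. Bx n)"
        by (rule emeasure_mono) (auto simp: Bx_def)
      also have "\<dots> \<le> (\<Sum>n. emeasure lborel (Bx n))"
        by (rule emeasure_subadditive_countably) (auto simp: Bx_def)
      also have "\<dots> \<le> (\<Sum>n. ennreal (K0 * t) * ennreal (d n ^ ?m))"
        unfolding Bx_def v_def K0_def
        by (intro suminf_le emeasure_lborel_box_le) (use d0 C(3) c in \<open>auto simp: d_def\<close>)
      also have "\<dots> = ennreal (K0 * t) * (\<Sum>n. ennreal (d n ^ ?m))" by simp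
      finally have "ennreal (1 / (K0 * t)) * emeasure lborel ?W
          \<le> ennreal (1 / (K0 * t)) * (ennreal (K0 * t) * (\<Sum>n. ennreal (d n ^ ?m)))"
        by (rule mult_left_mono) simp
      also have "\<dots> = (\<Sum>n. ennreal (d n ^ ?m))"
        by (simp only: mult.assoc[symmetric] inv mult_1_left)
      finally show "ennreal (1 / (K0 * t)) * emeasure lborel ?W \<le> (\<Sum>n. ennreal (diameter (C n) ^ ?m))"
        by (simp add: d_def)
    qed
    then have le: "ennreal (K0 * t) * (ennreal (1 / (K0 * t)) * emeasure lborel ?W) \<le> ennreal (K0 * t) * hausdorff_content ?m t A"
      by (rule mult_left_mono) simp
    have "ennreal (K0 * t) * (ennreal (1 / (K0 * t)) * emeasure lborel ?W) = emeasure lborel ?W"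
      by (simp only: mult.assoc[symmetric] inv mult_1_left)
    with le have "emeasure lborel ?W \<le> ennreal (K0 * t) * hausdorff_content ?m t A" by simp
    also have "\<dots> \<le> ennreal (K0 * t) * (SUP \<delta>\<in>{0<..}. hausdorff_content ?m \<delta> A)"
      by (intro mult_left_mono SUP_upper) (use t in auto)
    also have "ennreal (K0 * t) = ennreal (K0 / b * t) * ennreal b"
      using b K0 t by (simp add: ennreal_mult[symmetric])
    also have "ennreal (K0 / b * t) * ennreal b * (SUP \<delta>\<in>{0<..}. hausdorff_content ?m \<delta> A)
        = ennreal (K0 / b * t) * hausdorff_outer ?m A"
      by (simp add: hausdorff_outer_eq b_def mult.assoc)
    finally show "emeasure lborel ?W \<le> ennreal (K0 / b * t) * hausdorff_outer ?m A" .
  qed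
qed

text \<open>The bound on Borel sets says that the image of Lebesgue measure on \<open>S\<close>
  under the projection is at most a multiple of surface measure. Integrating against both measures
  turns it into a bound for functions.\<close>

lemma nn_integral_strip_proj_le:
  fixes \<Omega> :: "(real^'n::finite) set" and h :: "real^'n \<Rightarrow> real"
  assumes h: "continuous_on UNIV h" and n2: "CARD('n) \<ge> 2"
    and S: "compact S" and SF: "graph_proj k s h ` S \<subseteq> frontier \<Omega>"
    and K: "\<And>A. A \<in> sets borel \<Longrightarrow> emeasure lborel {x \<in> S. graph_proj k s h x \<in> A} \<le> ennreal K * hausdorff_outer (CARD('n) - 1) A"
    and f: "f \<in> borel_measurable borel"
  shows "(\<integral>\<^sup>+x. f (graph_proj k s h x) \<partial>lebesgue_on S) \<le> ennreal K * (\<integral>\<^sup>+x. f x \<partial>surface_measure \<Omega>)"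
proof -
  let ?\<pi> = "graph_proj k s h" and ?F = "restrict_space borel (frontier \<Omega>)"
  have Sb: "S \<in> sets borel" using S by (simp add: borel_closed compact_imp_closed)
  have Sl: "S \<in> sets lebesgue" using Sb by simp
  have p: "?\<pi> \<in> borel_measurable borel"
    using continuous_graph_proj[OF h] by (rule borel_measurable_continuous_onI)
  have pm: "?\<pi> \<in> measurable (restrict_space lborel S) ?F"
  proof (rule measurable_restrict_space2)
    show "?\<pi> \<in> space (restrict_space lborel S) \<rightarrow> frontier \<Omega>"
      using SF by (auto simp: space_restrict_space)
    show "?\<pi> \<in> measurable (restrict_space lborel S) borel"
      using p by (simp add: measurable_restrict_space1)
  qed
  define N where "N = distr (restrict_space lborel S) ?F ?\<pi>"
  have fF: "f \<in> borel_measurable ?F" using f by (rule measurable_restrict_space1)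
  have sets: "sets N = sets ?F" "sets (surface_measure \<Omega>) = sets ?F"
    by (simp_all add: N_def sets_surface_measure)
  have fN: "f \<in> borel_measurable N" "f \<in> borel_measurable (surface_measure \<Omega>)"
    using fF measurable_cong_sets[OF sets(1) refl] measurable_cong_sets[OF sets(2) refl] by blast+
  have Fb: "frontier \<Omega> \<in> sets borel" by (simp add: borel_closed)
  have "N \<le> scale_measure (ennreal K) (surface_measure \<Omega>)"
  proof (subst le_measure)
    show "sets N = sets (scale_measure (ennreal K) (surface_measure \<Omega>))" using sets by simp
    show "\<forall>A\<in>sets N. emeasure N A \<le> emeasure (scale_measure (ennreal K) (surface_measure \<Omega>)) A"
    proof
      fix A assume "A \<in> sets N"
      then have A: "A \<in> sets ?F" using sets by simp
      then have Ab: "A \<in> sets borel" "A \<subseteq> frontier \<Omega>"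
        using Fb by (auto simp: sets_restrict_space_iff)
      have "emeasure N A = emeasure (restrict_space lborel S) (?\<pi> -` A \<inter> space (restrict_space lborel S))"
        unfolding N_def by (rule emeasure_distr[OF pm A])
      also have "?\<pi> -` A \<inter> space (restrict_space lborel S) = {x \<in> S. ?\<pi> x \<in> A}"
        by (auto simp: space_restrict_space)
      also have "emeasure (restrict_space lborel S) \<dots> = emeasure lborel {x \<in> S. ?\<pi> x \<in> A}"
        by (rule emeasure_restrict_space) (use Sb in auto)
      also have "\<dots> \<le> ennreal K * hausdorff_outer (CARD('n) - 1) A" by (rule K[OF Ab(1)])
      also have "\<dots> = emeasure (scale_measure (ennreal K) (surface_measure \<Omega>)) A"
        using emeasure_surface_measure[OF n2 Ab] by simp
      finally show "emeasure N A \<le> emeasure (scale_measure (ennreal K) (surface_measure \<Omega>)) A" .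
    qed
  qed
  then have "integral\<^sup>N N f \<le> integral\<^sup>N (scale_measure (ennreal K) (surface_measure \<Omega>)) f"
    by (intro nn_integral_mono_measure) (use sets in auto)
  also have "\<dots> = ennreal K * (\<integral>\<^sup>+x. f x \<partial>surface_measure \<Omega>)"
    by (rule nn_integral_scale_measure[OF fN(2)])
  also have "integral\<^sup>N N f = (\<integral>\<^sup>+x. f (?\<pi> x) \<partial>restrict_space lborel S)"
    unfolding N_def by (rule nn_integral_distr[OF pm]) (use fN(1) in \<open>simp add: N_def\<close>)
  also have "\<dots> = (\<integral>\<^sup>+x. f (?\<pi> x) * indicator S x \<partial>lborel)"
    using Sb by (simp add: nn_integral_restrict_space)
  also have "\<dots> = (\<integral>\<^sup>+x. f (?\<pi> x) * indicator S x \<partial>lebesgue)"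
    by (rule nn_integral_completion[symmetric])
  also have "\<dots> = (\<integral>\<^sup>+x. f (?\<pi> x) \<partial>lebesgue_on S)"
    using Sl by (simp add: nn_integral_restrict_space)
  finally show ?thesis .
qed

text \<open>Plays the part of the Cauchy-Schwarz inequality: first powers are controlled by squares,
  with a parameter that is chosen only at the very end.\<close>

lemma le_eps_plus_square_div:
  fixes a b e :: real
  assumes "0 < e" shows "a \<le> e / 2 + a\<^sup>2 / (2 * e)"
proof -
  have "0 \<le> (a - e)\<^sup>2" by simp
  then have "2 * e * a \<le> e\<^sup>2 + a\<^sup>2" by (simp add: power2_diff algebra_simps)
  then show ?thesis using assms by (simp add: field_simps power2_eq_square)
qed

lemma integral_le_of_nn_integral:
  assumes "integrable M f" "AE x in M. 0 \<le> f x" "0 \<le> c" "(\<integral>\<^sup>+x. ennreal (f x) \<partial>M) \<le> ennreal c"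
  shows "integral\<^sup>L M f \<le> c"
  using nn_integral_eq_integral[OF assms(1,2)] assms(3,4) by (simp add: ennreal_le_iff)

text \<open>\<open>S t\<close> is a strip that catches the points near \<open>p\<close> at which translation by \<open>t\<close> enters or leaves \<open>\<Omega>\<close>. The
  constant \<open>C\<close>, unlike \<open>D\<close>, does not depend on \<open>\<psi>\<close>.\<close>

definition chart_control ::
    "(real^'n::finite) set \<Rightarrow> real^'n \<Rightarrow> real \<Rightarrow> real \<Rightarrow> real \<Rightarrow> (real \<Rightarrow> (real^'n) set) \<Rightarrow> bool" where
  "chart_control \<Omega> p \<rho> \<tau> C S \<longleftrightarrow> 0 < \<rho> \<and> 0 < \<tau> \<and> 0 \<le> C \<and>
    (\<forall>t. 0 < t \<longrightarrow> t < \<tau> \<longrightarrow> compact (S t)) \<and>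
    (\<forall>t x i. 0 < t \<longrightarrow> t < \<tau> \<longrightarrow> x \<in> ball p \<rho> \<longrightarrow> (x \<in> \<Omega>) \<noteq> (x - t *\<^sub>R axis i 1 \<in> \<Omega>) \<longrightarrow> x \<in> S t) \<and>
    (\<forall>t. 0 < t \<longrightarrow> t < \<tau> \<longrightarrow> measure lebesgue (S t) \<le> C * t) \<and>
    (\<forall>(\<psi> :: real^'n \<Rightarrow> complex) I. smooth_on UNIV \<psi> \<longrightarrow> 0 \<le> I \<longrightarrow>
       (\<integral>\<^sup>+x. ennreal ((norm (\<psi> x))\<^sup>2) \<partial>surface_measure \<Omega>) \<le> ennreal I \<longrightarrow>
       (\<exists>D. \<forall>t. 0 < t \<longrightarrow> t < \<tau> \<longrightarrow> (LINT x|lebesgue_on (S t). (norm (\<psi> x))\<^sup>2) \<le> C * t * I + D * t ^ 3))"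

text \<open>If translation changes membership in \<Omega>, the point and its translate lie on
  different sides of the graph, so the point is within \<open>O(t)\<close> of it. On this strip
  \<psi> is compared with its value at the projected point. The difference is \<open>O(t)\<close>,
  and its square over a set of measure \<open>O(t)\<close> gives the term in \<open>t ^ 3\<close>;
  the main term is bounded by the surface integral.\<close>

lemma chart_control_exists:
  fixes \<Omega> :: "(real^'n::finite) set"
  assumes n2: "CARD('n) \<ge> 2" and \<Omega>: "open \<Omega>" "smooth_boundary \<Omega>" and p: "p \<in> frontier \<Omega>"
  shows "\<exists>\<rho> \<tau> C S. chart_control \<Omega> p \<rho> \<tau> C S"
proof -
  obtain r k s h where r: "r > 0" and s: "s \<in> {-1, 1 :: real}" and h: "smooth_on UNIV h"
    and hk': "\<forall>x y. (\<forall>j. j \<noteq> k \<longrightarrow> x $ j = y $ j) \<longrightarrow> h x = h y"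
    and chart: "\<Omega> \<inter> ball p r = {x \<in> ball p r. s * x $ k > h x}"
    using bspec[OF \<Omega>(2)[unfolded smooth_boundary_def] p] by (elim exE bexE conjE) (rule that)
  have hk: "h x = h y" if "\<And>j. j \<noteq> k \<Longrightarrow> x $ j = y $ j" for x y
    using hk' that by blast
  note hc = smooth_on_continuous[OF h]
  obtain L where L: "L \<ge> 0" "\<And>x y. x \<in> cball p r \<Longrightarrow> y \<in> cball p r \<Longrightarrow> norm (h x - h y) \<le> L * norm (x - y)"
    using smooth_on_lipschitz[OF h compact_cball[of p r] convex_cball] by auto
  \<comment> \<open>A shift by \<open>t\<close> moves \<open>s * x $ k\<close> by at most
    \<open>t\<close> and \<open>h\<close> by at most \<open>L * t\<close>.\<close>
  define c where "c = 1 + L"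
  \<comment> \<open>A quarter of the chart radius: translates, projections and the auxiliary points
    \<open>z\<close> below stay within \<open>3 * \<rho>\<close> of \<open>p\<close>, hence inside
    the chart.\<close>
  define \<rho> where "\<rho> = r / 4"
  define \<tau> where "\<tau> = min 1 (\<rho> / c)"
  have c: "c > 0" "c \<ge> 1" using L(1) by (auto simp: c_def)
  have \<rho>: "\<rho> > 0" using r by (simp add: \<rho>_def)
  have \<tau>: "\<tau> > 0" "\<tau> \<le> 1" "t < \<tau> \<Longrightarrow> c * t < \<rho>" for t
    using c \<rho> by (auto simp: \<tau>_def field_simps)
  have \<tau>\<rho>: "t < \<rho>" if "0 < t" "t < \<tau>" for t
    using \<tau>(3)[OF that(2)] mult_right_mono[of 1 c t] that c by linarith
  let ?\<pi> = "graph_proj k s h"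
  define S where "S = (\<lambda>t. strip k s h (cball p \<rho>) (c * t))"
  obtain C1 where C1: "C1 \<ge> 0" "\<And>t. 0 < t \<Longrightarrow> t \<le> 1 \<Longrightarrow> measure lebesgue (S t) \<le> C1 * t"
    unfolding S_def by (rule measure_strip_le[OF hc hk s c(1), of k p \<rho>]) auto
  obtain K where K: "K \<ge> 0" "\<And>t A. 0 < t \<Longrightarrow> A \<in> sets borel \<Longrightarrow>
     emeasure lborel {x \<in> S t. ?\<pi> x \<in> A} \<le> ennreal (K * t) * hausdorff_outer (CARD('n) - 1) A"
    unfolding S_def by (rule emeasure_strip_proj_le[OF hc s c(1) n2, of k p \<rho>]) auto
  have cS: "compact (S t)" for t unfolding S_def by (rule compact_strip[OF hc compact_cball])
  have \<pi>d: "dist x (?\<pi> x) \<le> c * t" if "x \<in> S t" for x t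
  proof -
    have "x - ?\<pi> x = (x $ k - s * h x) *\<^sub>R axis k 1"
      by (auto simp: graph_proj_def vec_eq_iff axis_def)
    then have "dist x (?\<pi> x) = \<bar>x $ k - s * h x\<bar>" by (simp add: dist_norm norm_axis_1)
    also have "\<dots> = \<bar>s * x $ k - h x\<bar>" using s by auto
    finally show ?thesis using that by (simp add: S_def strip_def)
  qed
  have \<pi>b: "?\<pi> x \<in> ball p (2 * \<rho>)" if "x \<in> S t" "t < \<tau>" for x t
  proof -
    have "dist p (?\<pi> x) \<le> dist p x + dist x (?\<pi> x)" by (rule dist_triangle)
    also have "\<dots> < 2 * \<rho>" using \<pi>d[OF that(1)] \<tau>(3)[OF that(2)] that(1) by (simp add: S_def strip_def)
    finally show ?thesis by simp
  qed
  have \<pi>F: "?\<pi> ` S t \<subseteq> frontier \<Omega>" if t: "t < \<tau>" for t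
  proof
    fix y assume "y \<in> ?\<pi> ` S t"
    then obtain x where x: "x \<in> S t" "y = ?\<pi> x" by blast
    have yb: "y \<in> ball p (2 * \<rho>)" using \<pi>b[OF x(1) t] x(2) by simp
    have hy: "h y = h x" by (rule hk) (simp add: x(2) graph_proj_def)
    have "y $ k = s * h x" by (simp add: x(2) graph_proj_def)
    then have sy: "s * y $ k = h y" using s hy by auto
    have "y \<in> ball p r" using yb \<rho> r by (simp add: \<rho>_def)
    then have nin: "y \<notin> \<Omega>" using chart sy by force
    have "y \<in> closure \<Omega>"
      unfolding closure_approachable
    proof (intro allI impI)
      fix e :: real assume e: "0 < e"
      define a where "a = min (e / 2) \<rho>"
      have a: "0 < a" "a < e" "a \<le> \<rho>" using e \<rho> by (auto simp: a_def)
      \<comment> \<open>Since \<open>y\<close> lies on the graph, a move by \<open>a\<close> along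
        axis \<open>k\<close> in direction \<open>s\<close> leaves \<open>h\<close> unchanged and
        enters \<Omega>.\<close>
      define z where "z = y + (s * a) *\<^sub>R axis k 1"
      have nz: "dist z y = a" using s a by (auto simp: z_def dist_norm norm_axis_1 abs_mult)
      have "dist p z \<le> dist p y + dist z y" by (metis dist_commute dist_triangle)
      then have zb: "z \<in> ball p r" using yb nz a \<rho> by (simp add: \<rho>_def)
      have "h z = h y" by (rule hk) (simp add: z_def axis_def)
      moreover have "s * z $ k = s * y $ k + a" using s by (auto simp: z_def axis_def algebra_simps)
      ultimately have "z \<in> \<Omega>" using zb chart sy a by force
      then show "\<exists>z\<in>\<Omega>. dist z y < e" using nz a by auto
    qed
    then show "y \<in> frontier \<Omega>" using nin \<Omega>(1) by (simp add: frontier_def interior_open)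
  qed
  have "chart_control \<Omega> p \<rho> \<tau> (C1 + 2 * K) S"
    unfolding chart_control_def
  proof (intro conjI allI impI)
    show "\<rho> > 0" "\<tau> > 0" "C1 + 2 * K \<ge> 0" using \<rho> \<tau> C1 K by auto
    show "compact (S t)" for t by (rule cS)
    show "x \<in> S t" if t: "0 < t" "t < \<tau>" and x: "x \<in> ball p \<rho>" "(x \<in> \<Omega>) \<noteq> (x - t *\<^sub>R axis i 1 \<in> \<Omega>)" for t x i
    proof -
      define y where "y = x - t *\<^sub>R axis i 1"
      have dxy: "norm (x - y) = t" using t by (simp add: y_def norm_axis_1)
      have xr: "x \<in> ball p r" using x(1) \<rho> by (simp add: \<rho>_def)
      have "dist p y \<le> dist p x + dist x y" by (rule dist_triangle)
      then have "dist p y < \<rho> + \<rho>" using x(1) dxy \<tau>\<rho>[OF t] by (simp add: dist_norm)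
      then have yr: "y \<in> ball p r" using \<rho> by (simp add: \<rho>_def)
      have sg: "(s * x $ k > h x) \<noteq> (s * y $ k > h y)" using x(2) chart xr yr unfolding y_def[symmetric] by blast
      have "norm (h x - h y) \<le> L * t" using L(2)[of x y] xr yr dxy by simp
      moreover have "\<bar>s * x $ k - s * y $ k\<bar> \<le> t"
        using component_le_norm_cart[of "x - y" k] dxy s by auto
      ultimately have "\<bar>s * x $ k - h x\<bar> \<le> c * t"
        using sg by (auto simp: c_def algebra_simps abs_le_iff)
      then show ?thesis using x(1) by (simp add: S_def strip_def)
    qed
    show "measure lebesgue (S t) \<le> (C1 + 2 * K) * t" if t: "0 < t" "t < \<tau>" for t
      using C1(2)[OF t(1)] t \<tau>(2) mult_nonneg_nonneg[OF K(1) less_imp_le[OF t(1)]] by (simp add: algebra_simps)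
    fix \<psi> :: "real^'n \<Rightarrow> complex" and I :: real
    assume \<psi>: "smooth_on UNIV \<psi>" and I: "0 \<le> I" "(\<integral>\<^sup>+x. ennreal ((norm (\<psi> x))\<^sup>2) \<partial>surface_measure \<Omega>) \<le> ennreal I"
    note \<psi>c = smooth_on_continuous[OF \<psi>]
    obtain M where M: "M \<ge> 0" "\<And>x y. x \<in> cball p r \<Longrightarrow> y \<in> cball p r \<Longrightarrow> norm (\<psi> x - \<psi> y) \<le> M * norm (x - y)"
      using smooth_on_lipschitz[OF \<psi> compact_cball[of p r] convex_cball] by auto
    \<comment> \<open>From twice the square of the oscillation \<open>M * (c * t)\<close> over a
      strip of measure at most \<open>C1 * t\<close>, with \<open>t ^ 3\<close> taken out. The
      dependence on \<psi> is confined to \<open>M\<close>.\<close>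
    define D where "D = 2 * (M * c)\<^sup>2 * C1"
    have "(LINT x|lebesgue_on (S t). (norm (\<psi> x))\<^sup>2) \<le> (C1 + 2 * K) * t * I + D * t ^ 3" if t: "0 < t" "t < \<tau>" for t
    proof -
      have Sl: "S t \<in> sets lebesgue" "bounded (S t)" "S t \<in> lmeasurable"
        using cS[of t] compact_imp_bounded lmeasurable_compact fmeasurableD by blast+
      have \<pi>c: "continuous_on UNIV (\<lambda>x. \<psi> (?\<pi> x))"
        by (rule continuous_on_compose2[OF \<psi>c continuous_graph_proj[OF hc]]) simp
      have i1: "integrable (lebesgue_on (S t)) (\<lambda>x. (norm (\<psi> x))\<^sup>2)"
        by (rule integrable_lebesgue_on_continuous[OF _ Sl(2,1)]) (intro continuous_intros \<psi>c)
      have i2: "integrable (lebesgue_on (S t)) (\<lambda>x. (norm (\<psi> (?\<pi> x)))\<^sup>2)"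
        by (rule integrable_lebesgue_on_continuous[OF _ Sl(2,1)]) (intro continuous_intros \<pi>c)
      have i3: "integrable (lebesgue_on (S t)) (\<lambda>x. 2 * (M * (c * t))\<^sup>2)"
        by (rule integrable_lebesgue_on_continuous[OF _ Sl(2,1)]) (intro continuous_intros)
      have "(\<integral>\<^sup>+x. ennreal ((norm (\<psi> (?\<pi> x)))\<^sup>2) \<partial>lebesgue_on (S t))
          \<le> ennreal (K * t) * (\<integral>\<^sup>+x. ennreal ((norm (\<psi> x))\<^sup>2) \<partial>surface_measure \<Omega>)"
      proof (rule nn_integral_strip_proj_le[OF hc n2 cS \<pi>F[OF t(2)]])
        show "emeasure lborel {x \<in> S t. ?\<pi> x \<in> A} \<le> ennreal (K * t) * hausdorff_outer (CARD('n) - 1) A"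
          if "A \<in> sets borel" for A by (rule K(2)[OF t(1) that])
        show "(\<lambda>x. ennreal ((norm (\<psi> x))\<^sup>2)) \<in> borel_measurable borel"
          using borel_measurable_continuous_onI[OF \<psi>c] by measurable
      qed
      also have "\<dots> \<le> ennreal (K * t) * ennreal I" by (rule mult_left_mono[OF I(2)]) simp
      also have "\<dots> = ennreal (K * t * I)" using K(1) t I(1) by (intro ennreal_mult[symmetric]) auto
      finally have p2: "(LINT x|lebesgue_on (S t). (norm (\<psi> (?\<pi> x)))\<^sup>2) \<le> K * t * I"
        by (intro integral_le_of_nn_integral[OF i2]) (use K(1) t I(1) in auto)
      have "(LINT x|lebesgue_on (S t). (norm (\<psi> x))\<^sup>2)
          \<le> (LINT x|lebesgue_on (S t). 2 * (norm (\<psi> (?\<pi> x)))\<^sup>2 + 2 * (M * (c * t))\<^sup>2)"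
      proof (rule integral_mono[OF i1])
        show "integrable (lebesgue_on (S t)) (\<lambda>x. 2 * (norm (\<psi> (?\<pi> x)))\<^sup>2 + 2 * (M * (c * t))\<^sup>2)"
          using i2 i3 by simp
        fix x assume "x \<in> space (lebesgue_on (S t))"
        then have x: "x \<in> S t" by simp
        have "?\<pi> x \<in> cball p r" using \<pi>b[OF x t(2)] \<rho> by (simp add: \<rho>_def)
        moreover have "x \<in> cball p r" using x \<rho> by (simp add: S_def strip_def \<rho>_def)
        ultimately have "norm (\<psi> x - \<psi> (?\<pi> x)) \<le> M * norm (x - ?\<pi> x)" using M(2) by blast
        also have "\<dots> \<le> M * (c * t)" using \<pi>d[OF x] M(1) by (intro mult_left_mono) (simp_all add: dist_norm)
        finally have d: "norm (\<psi> x - \<psi> (?\<pi> x)) \<le> M * (c * t)" .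
        have "norm (\<psi> x) \<le> norm (\<psi> (?\<pi> x)) + norm (\<psi> x - \<psi> (?\<pi> x))"
          using norm_triangle_sub by blast
        with d have "norm (\<psi> x) \<le> norm (\<psi> (?\<pi> x)) + M * (c * t)" by linarith
        then have "(norm (\<psi> x))\<^sup>2 \<le> (norm (\<psi> (?\<pi> x)) + M * (c * t))\<^sup>2" by (rule power_mono) simp
        also have "\<dots> \<le> 2 * (norm (\<psi> (?\<pi> x)))\<^sup>2 + 2 * (M * (c * t))\<^sup>2"
          using zero_le_power2[of "norm (\<psi> (?\<pi> x)) - M * (c * t)"] unfolding power2_sum power2_diff by linarith
        finally show "(norm (\<psi> x))\<^sup>2 \<le> 2 * (norm (\<psi> (?\<pi> x)))\<^sup>2 + 2 * (M * (c * t))\<^sup>2" .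
      qed
      also have "\<dots> = 2 * (LINT x|lebesgue_on (S t). (norm (\<psi> (?\<pi> x)))\<^sup>2) + 2 * (M * (c * t))\<^sup>2 * measure lebesgue (S t)"
        using i2 i3 Sl by (simp add: measure_restrict_space)
      also have "\<dots> \<le> 2 * (K * t * I) + 2 * (M * (c * t))\<^sup>2 * (C1 * t)"
        using p2 C1(2)[OF t(1)] t \<tau>(2) by (intro add_mono mult_left_mono) auto
      also have "\<dots> \<le> (C1 + 2 * K) * t * I + D * t ^ 3"
        using C1(1) t I(1) by (simp add: D_def algebra_simps power2_eq_square power3_eq_cube)
      finally show ?thesis .
    qed
    then show "\<exists>D. \<forall>t. 0 < t \<longrightarrow> t < \<tau> \<longrightarrow> (LINT x|lebesgue_on (S t). (norm (\<psi> x))\<^sup>2) \<le> (C1 + 2 * K) * t * I + D * t ^ 3"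
      by blast
  qed
  then show ?thesis by blast
qed

text \<open>Taking \<epsilon> to be the square root of \<open>I\<close> would make the right side a
  multiple of the \<open>L2\<close> norm on the boundary; a free \<epsilon> also covers
  \<open>I = 0\<close>. One constant serves all \<psi>, so the bound can be applied along a sequence
  that approximates a trace.\<close>

lemma boundary_estimate:
  fixes \<Omega> :: "(real^'n::finite) set"
  assumes n2: "CARD('n) \<ge> 2" and \<Omega>: "open \<Omega>" "bounded \<Omega>" "smooth_boundary \<Omega>"
  shows "\<exists>C\<ge>0. \<forall>(\<psi> :: real^'n \<Rightarrow> complex) i \<epsilon> I. smooth_on UNIV \<psi> \<longrightarrow> 0 < \<epsilon> \<longrightarrow> 0 \<le> I \<longrightarrow>
      (\<integral>\<^sup>+x. ennreal ((norm (\<psi> x))\<^sup>2) \<partial>surface_measure \<Omega>) \<le> ennreal I \<longrightarrow>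
      norm (LINT x|lebesgue_on \<Omega>. partial i \<psi> x) \<le> C * (\<epsilon> + I / \<epsilon>)"
proof -
  have \<Omega>s: "\<Omega> \<in> sets lebesgue" using \<Omega>(1) by auto
  have "\<forall>p\<in>frontier \<Omega>. \<exists>\<rho> \<tau> C S. chart_control \<Omega> p \<rho> \<tau> C S"
    using chart_control_exists[OF n2 \<Omega>(1,3)] by blast
  then obtain \<rho> \<tau> Cf S where ch: "\<And>p. p \<in> frontier \<Omega> \<Longrightarrow> chart_control \<Omega> p (\<rho> p) (\<tau> p) (Cf p) (S p)"
    by metis
  have pos: "0 < \<rho> p" "0 < \<tau> p" "0 \<le> Cf p" if "p \<in> frontier \<Omega>" for p
    using ch[OF that] by (auto simp: chart_control_def)
  have comp: "compact (S p t)" if "p \<in> frontier \<Omega>" "0 < t" "t < \<tau> p" for p t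
    using ch[OF that(1)] that(2,3) by (auto simp: chart_control_def)
  have jump: "x \<in> S p t" if "p \<in> frontier \<Omega>" "0 < t" "t < \<tau> p" "x \<in> ball p (\<rho> p)"
    "(x \<in> \<Omega>) \<noteq> (x - t *\<^sub>R axis i 1 \<in> \<Omega>)" for p t x i
    using ch[OF that(1)] that(2-) unfolding chart_control_def by blast
  have meas: "measure lebesgue (S p t) \<le> Cf p * t" if "p \<in> frontier \<Omega>" "0 < t" "t < \<tau> p" for p t
    using ch[OF that(1)] that(2,3) by (auto simp: chart_control_def)
  obtain D where D: "D \<subseteq> frontier \<Omega>" "finite D" "frontier \<Omega> \<subseteq> (\<Union>p\<in>D. ball p (\<rho> p / 2))"
    by (rule compactE_image[OF compact_frontier_bounded[OF \<Omega>(2)], of "frontier \<Omega>" "\<lambda>p. ball p (\<rho> p / 2)"])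
      (use pos(1) in auto)
  \<comment> \<open>The cover uses half radii and the shifts are at most
    \<open>\<rho> p / 2\<close>. If the segment from \<open>x\<close> to its translate meets the
    frontier in the half ball about \<open>p\<close>, then \<open>x\<close> lies in the full ball,
    where the chart controls it.\<close>
  define \<tau>0 where "\<tau>0 = Min (insert 1 ((\<lambda>p. min (\<tau> p) (\<rho> p / 2)) ` D))"
  have \<tau>0: "0 < \<tau>0" "\<tau>0 \<le> 1" "\<And>p. p \<in> D \<Longrightarrow> \<tau>0 \<le> \<tau> p" "\<And>p. p \<in> D \<Longrightarrow> \<tau>0 \<le> \<rho> p / 2"
  proof -
    show "0 < \<tau>0" unfolding \<tau>0_def using D(1,2) pos by (subst Min_gr_iff) auto
    show "\<tau>0 \<le> 1" unfolding \<tau>0_def using D(2) by (intro Min_le) auto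
    fix p assume "p \<in> D"
    then have "\<tau>0 \<le> min (\<tau> p) (\<rho> p / 2)" unfolding \<tau>0_def using D(2) by (intro Min_le) auto
    then show "\<tau>0 \<le> \<tau> p" "\<tau>0 \<le> \<rho> p / 2" by auto
  qed
  define t where "t = (\<lambda>n::nat. \<tau>0 / real (n + 2))"
  have t: "0 < t n" "t n < \<tau>0" "t n \<le> 1" for n
  proof -
    have "t n \<le> \<tau>0 / 2" unfolding t_def by (rule divide_left_mono) (use \<tau>0(1) in auto)
    then show "t n < \<tau>0" "t n \<le> 1" using \<tau>0(1,2) by linarith+
    show "0 < t n" using \<tau>0(1) by (simp add: t_def)
  qed
  have "(\<lambda>n. \<tau>0 / real (n + 2)) \<longlonglongrightarrow> 0"
    by (rule LIMSEQ_ignore_initial_segment[OF lim_const_over_n])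
  then have tlim: "t \<longlonglongrightarrow> 0" by (simp add: t_def)
  define C where "C = (\<Sum>p\<in>D. Cf p)"
  have C0: "0 \<le> C" unfolding C_def using D(1) pos(3) by (intro sum_nonneg) auto
  have main: "norm (LINT x|lebesgue_on \<Omega>. partial i \<psi> x) \<le> C * (\<epsilon> + I / \<epsilon>)"
    if \<psi>: "smooth_on UNIV \<psi>" and \<epsilon>: "0 < \<epsilon>" and I: "0 \<le> I"
      "(\<integral>\<^sup>+x. ennreal ((norm (\<psi> x))\<^sup>2) \<partial>surface_measure \<Omega>) \<le> ennreal I" for \<psi> :: "real^'n \<Rightarrow> complex" and i \<epsilon> I
  proof -
    note \<psi>c = smooth_on_continuous[OF \<psi>]
    have "\<forall>p\<in>D. \<exists>d. \<forall>t. 0 < t \<longrightarrow> t < \<tau> p \<longrightarrow> (LINT x|lebesgue_on (S p t). (norm (\<psi> x))\<^sup>2) \<le> Cf p * t * I + d * t ^ 3"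
      using ch D(1) \<psi> I unfolding chart_control_def by blast
    then obtain d where d: "\<And>p t. p \<in> D \<Longrightarrow> 0 < t \<Longrightarrow> t < \<tau> p \<Longrightarrow>
        (LINT x|lebesgue_on (S p t). (norm (\<psi> x))\<^sup>2) \<le> Cf p * t * I + d p * t ^ 3" by metis
    \<comment> \<open>The sum of the strip bounds divided by \<open>s\<close>. As \<open>s\<close>
      tends to 0 the terms with \<open>d p\<close>, the only ones that depend on more of \<psi> than
      \<open>I\<close>, drop out.\<close>
    define E where "E = (\<lambda>s. \<Sum>p\<in>D. Cf p * (\<epsilon> / 2 + I / (2 * \<epsilon>)) + d p * s\<^sup>2 / (2 * \<epsilon>))"
    have strip: "(LINT x|lebesgue_on (S p s). norm (\<psi> x)) \<le> s * (Cf p * (\<epsilon> / 2 + I / (2 * \<epsilon>)) + d p * s\<^sup>2 / (2 * \<epsilon>))"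
      if p: "p \<in> D" and s: "0 < s" "s < \<tau>0" for p s
    proof -
      have pF: "p \<in> frontier \<Omega>" and s': "s < \<tau> p" using p D(1) \<tau>0(3)[OF p] s by auto
      have cS: "compact (S p s)" by (rule comp[OF pF s(1) s'])
      have Sl: "S p s \<in> sets lebesgue" "bounded (S p s)" "S p s \<in> lmeasurable"
        using cS compact_imp_bounded lmeasurable_compact fmeasurableD by blast+
      have i1: "integrable (lebesgue_on (S p s)) (\<lambda>x. norm (\<psi> x))"
        by (rule integrable_lebesgue_on_continuous[OF _ Sl(2,1)]) (intro continuous_intros \<psi>c)
      have i2: "integrable (lebesgue_on (S p s)) (\<lambda>x. (norm (\<psi> x))\<^sup>2)"
        by (rule integrable_lebesgue_on_continuous[OF _ Sl(2,1)]) (intro continuous_intros \<psi>c)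
      have i3: "integrable (lebesgue_on (S p s)) (\<lambda>x. \<epsilon> / 2)"
        by (rule integrable_lebesgue_on_continuous[OF _ Sl(2,1)]) (intro continuous_intros)
      have "(LINT x|lebesgue_on (S p s). norm (\<psi> x)) \<le> (LINT x|lebesgue_on (S p s). \<epsilon> / 2 + (norm (\<psi> x))\<^sup>2 / (2 * \<epsilon>))"
        by (rule integral_mono[OF i1]) (use i2 i3 le_eps_plus_square_div[OF \<epsilon>] in auto)
      also have "\<dots> = \<epsilon> / 2 * measure lebesgue (S p s) + (LINT x|lebesgue_on (S p s). (norm (\<psi> x))\<^sup>2) / (2 * \<epsilon>)"
        using i2 i3 Sl by (simp add: measure_restrict_space)
      also have "\<dots> \<le> \<epsilon> / 2 * (Cf p * s) + (Cf p * s * I + d p * s ^ 3) / (2 * \<epsilon>)"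
        using meas[OF pF s(1) s'] d[OF p s(1) s'] \<epsilon> by (intro add_mono mult_left_mono divide_right_mono) auto
      also have "\<dots> = s * (Cf p * (\<epsilon> / 2 + I / (2 * \<epsilon>)) + d p * s\<^sup>2 / (2 * \<epsilon>))"
        using \<epsilon> by (simp add: field_simps power2_eq_square power3_eq_cube)
      finally show ?thesis .
    qed
    have quot: "norm (LINT x|lebesgue_on \<Omega>. (1 / s) *\<^sub>R (\<psi> (x + s *\<^sub>R axis i 1) - \<psi> x)) \<le> E s"
      if s: "0 < s" "s < \<tau>0" for s
    proof -
      define e where "e = s *\<^sub>R (axis i 1 :: real^'n)"
      have ne: "norm e = s" using s by (simp add: e_def norm_axis_1)
      define \<Omega>' where "\<Omega>' = (+) e ` \<Omega>"
      have \<Omega>': "open \<Omega>'" "bounded \<Omega>'" "\<Omega>' \<in> sets lebesgue"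
        unfolding \<Omega>'_def using \<Omega>(1,2) by (auto intro: open_translation bounded_translation simp: lebesgue_sets_translation)
      have mem: "x \<in> \<Omega>' \<longleftrightarrow> x - e \<in> \<Omega>" for x
      proof
        assume "x - e \<in> \<Omega>"
        then show "x \<in> \<Omega>'" unfolding \<Omega>'_def by (intro image_eqI[of _ _ "x - e"]) auto
      qed (auto simp: \<Omega>'_def)
      have "continuous_on UNIV (\<lambda>x. x + e)" by (intro continuous_intros)
      then have c2: "continuous_on UNIV (\<lambda>x. \<psi> (x + e))"
        by (rule continuous_on_compose2[OF \<psi>c]) simp
      note j1 = integrable_lebesgue_on_continuous[OF \<psi>c \<Omega>(2) \<Omega>s]
      note j2 = integrable_lebesgue_on_continuous[OF c2 \<Omega>(2) \<Omega>s]
      note j3 = integrable_lebesgue_on_continuous[OF \<psi>c \<Omega>'(2,3)]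
      have k1: "integrable lebesgue (\<lambda>x. indicator \<Omega> x *\<^sub>R \<psi> x)"
        using j1 \<Omega>s by (simp add: integrable_restrict_space)
      have k3: "integrable lebesgue (\<lambda>x. indicator \<Omega>' x *\<^sub>R \<psi> x)"
        using j3 \<Omega>'(3) by (simp add: integrable_restrict_space)
      have bm: "(\<lambda>x. indicator \<Omega>' x *\<^sub>R \<psi> x) \<in> borel_measurable borel"
        by (intro borel_measurable_scaleR borel_measurable_indicator borel_open \<Omega>'(1) borel_measurable_continuous_onI \<psi>c)
      have "(LINT x|lebesgue_on \<Omega>. \<psi> (x + e)) = (LINT x|lebesgue. indicator \<Omega> x *\<^sub>R \<psi> (x + e))"
        using \<Omega>s by (simp add: integral_restrict_space)
      also have "\<dots> = (LINT x|lebesgue. indicator \<Omega>' (x + e) *\<^sub>R \<psi> (x + e))"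
        by (rule Bochner_Integration.integral_cong[OF refl]) (simp add: indicator_def mem)
      also have "\<dots> = (LINT x|lebesgue. indicator \<Omega>' x *\<^sub>R \<psi> x)"
        by (rule lebesgue_integral_translation[OF bm])
      finally have e1: "(LINT x|lebesgue_on \<Omega>. \<psi> (x + e)) = (LINT x|lebesgue. indicator \<Omega>' x *\<^sub>R \<psi> x)" .
      have sS: "S p s \<in> sets lebesgue" "integrable lebesgue (\<lambda>x. indicator (S p s) x *\<^sub>R norm (\<psi> x))" if p: "p \<in> D" for p
      proof -
        have cS: "compact (S p s)" by (rule comp) (use p D(1) s \<tau>0(3)[OF p] in auto)
        then show Sl: "S p s \<in> sets lebesgue" by (auto intro: lmeasurable_compact fmeasurableD)
        have "integrable (lebesgue_on (S p s)) (\<lambda>x. norm (\<psi> x))"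
          by (rule integrable_lebesgue_on_continuous[OF _ compact_imp_bounded[OF cS] Sl]) (intro continuous_intros \<psi>c)
        then show "integrable lebesgue (\<lambda>x. indicator (S p s) x *\<^sub>R norm (\<psi> x))"
          using Sl by (simp add: integrable_restrict_space)
      qed
      have pt: "norm (indicator \<Omega>' x *\<^sub>R \<psi> x - indicator \<Omega> x *\<^sub>R \<psi> x) \<le> (\<Sum>p\<in>D. indicator (S p s) x *\<^sub>R norm (\<psi> x))" for x
      proof (cases "(x \<in> \<Omega>) = (x - e \<in> \<Omega>)")
        case True
        then have "norm (indicator \<Omega>' x *\<^sub>R \<psi> x - indicator \<Omega> x *\<^sub>R \<psi> x) = 0" by (simp add: indicator_def mem)
        also have "\<dots> \<le> (\<Sum>p\<in>D. indicator (S p s) x *\<^sub>R norm (\<psi> x))" by (intro sum_nonneg) simp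
        finally show ?thesis .
      next
        case False
        then have "closed_segment x (x - e) \<inter> \<Omega> \<noteq> {}" "closed_segment x (x - e) - \<Omega> \<noteq> {}"
          using ends_in_segment[of x "x - e"] by blast+
        from connected_Int_frontier[OF connected_segment(1) this] obtain z
          where z: "z \<in> closed_segment x (x - e)" "z \<in> frontier \<Omega>" by blast
        obtain p where p: "p \<in> D" "dist p z < \<rho> p / 2" using D(3) z(2) by auto
        have "dist z x \<le> s" using dist_in_closed_segment(1)[OF z(1)] ne by (simp add: dist_norm dist_commute)
        then have "dist p x < \<rho> p" using dist_triangle[of p x z] p s \<tau>0(4)[OF p(1)] by linarith
        then have "x \<in> S p s"
          using jump[of p s x i] p(1) D(1) s \<tau>0(3)[OF p(1)] False by (auto simp: e_def)
        have "norm (indicator \<Omega>' x *\<^sub>R \<psi> x - indicator \<Omega> x *\<^sub>R \<psi> x) \<le> indicator (S p s) x *\<^sub>R norm (\<psi> x)"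
          using \<open>x \<in> S p s\<close> by (auto simp: indicator_def)
        also have "\<dots> \<le> (\<Sum>p\<in>D. indicator (S p s) x *\<^sub>R norm (\<psi> x))"
          by (rule member_le_sum[OF p(1)]) (use D(2) in auto)
        finally show ?thesis .
      qed
      have "(LINT x|lebesgue_on \<Omega>. \<psi> (x + e) - \<psi> x) = (LINT x|lebesgue_on \<Omega>. \<psi> (x + e)) - (LINT x|lebesgue_on \<Omega>. \<psi> x)"
        by (rule Bochner_Integration.integral_diff[OF j2 j1])
      also have "\<dots> = (LINT x|lebesgue. indicator \<Omega>' x *\<^sub>R \<psi> x) - (LINT x|lebesgue. indicator \<Omega> x *\<^sub>R \<psi> x)"
        unfolding e1 using \<Omega>s by (simp add: integral_restrict_space)
      also have "\<dots> = (LINT x|lebesgue. indicator \<Omega>' x *\<^sub>R \<psi> x - indicator \<Omega> x *\<^sub>R \<psi> x)"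
        by (rule Bochner_Integration.integral_diff[OF k3 k1, symmetric])
      finally have "norm (LINT x|lebesgue_on \<Omega>. \<psi> (x + e) - \<psi> x)
          \<le> (LINT x|lebesgue. norm (indicator \<Omega>' x *\<^sub>R \<psi> x - indicator \<Omega> x *\<^sub>R \<psi> x))"
        by (simp only:) (rule integral_norm_bound)
      also have "\<dots> \<le> (LINT x|lebesgue. (\<Sum>p\<in>D. indicator (S p s) x *\<^sub>R norm (\<psi> x)))"
      proof (rule integral_mono[OF _ _ pt])
        show "integrable lebesgue (\<lambda>x. norm (indicator \<Omega>' x *\<^sub>R \<psi> x - indicator \<Omega> x *\<^sub>R \<psi> x))"
          by (rule integrable_norm[OF Bochner_Integration.integrable_diff[OF k3 k1]])
        show "integrable lebesgue (\<lambda>x. \<Sum>p\<in>D. indicator (S p s) x *\<^sub>R norm (\<psi> x))"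
          by (rule Bochner_Integration.integrable_sum[OF sS(2)])
      qed
      also have "\<dots> = (\<Sum>p\<in>D. LINT x|lebesgue. indicator (S p s) x *\<^sub>R norm (\<psi> x))"
        by (rule Bochner_Integration.integral_sum[OF sS(2)])
      also have "\<dots> = (\<Sum>p\<in>D. LINT x|lebesgue_on (S p s). norm (\<psi> x))"
        by (rule sum.cong[OF refl]) (use sS(1) in \<open>simp add: integral_restrict_space\<close>)
      also have "\<dots> \<le> (\<Sum>p\<in>D. s * (Cf p * (\<epsilon> / 2 + I / (2 * \<epsilon>)) + d p * s\<^sup>2 / (2 * \<epsilon>)))"
        by (rule sum_mono) (rule strip[OF _ s])
      also have "\<dots> = s * E s" by (simp only: E_def sum_distrib_left)
      finally have le: "norm (LINT x|lebesgue_on \<Omega>. \<psi> (x + e) - \<psi> x) \<le> s * E s" .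
      have "(LINT x|lebesgue_on \<Omega>. (1 / s) *\<^sub>R (\<psi> (x + e) - \<psi> x)) = (1 / s) *\<^sub>R (LINT x|lebesgue_on \<Omega>. \<psi> (x + e) - \<psi> x)"
        by (rule integral_scaleR_right)
      then have "norm (LINT x|lebesgue_on \<Omega>. (1 / s) *\<^sub>R (\<psi> (x + e) - \<psi> x)) = norm (LINT x|lebesgue_on \<Omega>. \<psi> (x + e) - \<psi> x) / s"
        using s(1) by (simp only: norm_scaleR) simp
      also have "\<dots> \<le> E s" using le s(1) by (simp add: divide_le_eq mult.commute)
      finally show ?thesis unfolding e_def .
    qed
    have lim1: "(\<lambda>n. norm (LINT x|lebesgue_on \<Omega>. (1 / t n) *\<^sub>R (\<psi> (x + t n *\<^sub>R axis i 1) - \<psi> x)))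
        \<longlonglongrightarrow> norm (LINT x|lebesgue_on \<Omega>. partial i \<psi> x)"
      by (rule tendsto_norm[OF integral_difference_quotient_tendsto[OF \<psi> \<Omega>(2) \<Omega>s tlim t(1) t(3)]])
    have "(\<lambda>n. E (t n)) \<longlonglongrightarrow> (\<Sum>p\<in>D. Cf p * (\<epsilon> / 2 + I / (2 * \<epsilon>)) + d p * 0\<^sup>2 / (2 * \<epsilon>))"
      unfolding E_def by (intro tendsto_intros tlim) (use \<epsilon> in auto)
    then have lim2: "(\<lambda>n. E (t n)) \<longlonglongrightarrow> C * (\<epsilon> / 2 + I / (2 * \<epsilon>))"
      by (simp add: C_def sum_distrib_right)
    have "norm (LINT x|lebesgue_on \<Omega>. partial i \<psi> x) \<le> C * (\<epsilon> / 2 + I / (2 * \<epsilon>))"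
      by (rule LIMSEQ_le[OF lim1 lim2]) (use quot[OF t(1,2)] in auto)
    also have "\<dots> \<le> C * (\<epsilon> + I / \<epsilon>)"
      using C0 \<epsilon> I(1) by (intro mult_left_mono add_mono) (auto simp: field_simps)
    finally show ?thesis .
  qed
  show ?thesis using C0 main by blast
qed

section \<open>Weak gradients\<close>

lemma integrable_lebesgue_on_subset:
  fixes f :: "'a::euclidean_space \<Rightarrow> 'b::{banach, second_countable_topology}"
  assumes f: "integrable (lebesgue_on T) f" and "S \<in> sets lebesgue" "T \<in> sets lebesgue" "S \<subseteq> T"
  shows "integrable (lebesgue_on S) f"
proof -
  have "integrable lebesgue (\<lambda>x. indicator T x *\<^sub>R f x)"
    using f assms(3) by (simp add: integrable_restrict_space)
  from integrable_mult_indicator[OF assms(2) this]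
  have "integrable lebesgue (\<lambda>x. indicator S x *\<^sub>R indicator T x *\<^sub>R f x)" .
  moreover have "(\<lambda>x. indicator S x *\<^sub>R indicator T x *\<^sub>R f x) = (\<lambda>x. indicator S x *\<^sub>R f x)"
    using assms(4) by (auto simp: indicator_def fun_eq_iff)
  ultimately have "integrable lebesgue (\<lambda>x. indicator S x *\<^sub>R f x)" by (simp only:)
  then show ?thesis using assms(2) by (simp add: integrable_restrict_space)
qed

lemma norm_vec_nth_le: "norm (v $ i) \<le> norm v"
  unfolding norm_vec_def by (rule member_le_L2_set[of UNIV i "\<lambda>i. norm (v $ i)"]) auto

lemma bounded_bilinear_bdot: "bounded_bilinear (bdot :: complex^'n::finite \<Rightarrow> _)"
proof (rule bounded_bilinear.intro)
  show "\<exists>K. \<forall>a b :: complex^'n. norm (bdot a b) \<le> norm a * norm b * K"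
  proof (intro exI allI)
    fix a b :: "complex^'n"
    have "norm (bdot a b) \<le> (\<Sum>i\<in>UNIV. norm (a $ i * b $ i))" unfolding bdot_def by (rule norm_sum)
    also have "\<dots> \<le> (\<Sum>i\<in>(UNIV :: 'n set). norm a * norm b)"
      by (intro sum_mono) (auto simp: norm_mult intro!: mult_mono norm_vec_nth_le)
    finally show "norm (bdot a b) \<le> norm a * norm b * real CARD('n)" by (simp add: mult.commute)
  qed
qed (simp_all add: bdot_def algebra_simps sum.distrib sum_distrib_left scaleR_sum_right)

text \<open>Since \<open>bdot\<close> is bilinear, a positive quantity arises only by pairing a
  vector with its conjugate; this is what the uniqueness proof for weak solutions uses.\<close>

definition cnj_vec :: "complex^'n::finite \<Rightarrow> complex^'n" where
  "cnj_vec v = (\<chi> i. cnj (v $ i))"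

lemma bounded_linear_cnj_vec: "bounded_linear (cnj_vec :: complex^'n::finite \<Rightarrow> _)"
  by (intro linear_conv_bounded_linear[THEN iffD1] linearI) (auto simp: vec_eq_iff cnj_vec_def)

lemma norm_cnj_vec [simp]: "norm (cnj_vec v) = norm v"
  by (simp add: norm_vec_def cnj_vec_def)

lemma bdot_cnj_vec: "bdot v (cnj_vec v) = complex_of_real ((norm v)\<^sup>2)"
proof -
  have "(norm v)\<^sup>2 = (\<Sum>i\<in>UNIV. (norm (v $ i))\<^sup>2)"
    by (simp add: norm_vec_def L2_set_def sum_nonneg)
  then show ?thesis by (simp add: bdot_def cnj_vec_def complex_norm_square[symmetric])
qed

lemma power2_norm_add_le:
  fixes a b :: "'a::real_normed_vector"
  shows "(norm (a + b))\<^sup>2 \<le> 2 * (norm a)\<^sup>2 + 2 * (norm b)\<^sup>2"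
proof -
  have "(norm (a + b))\<^sup>2 \<le> (norm a + norm b)\<^sup>2" by (intro power_mono norm_triangle_ineq) simp
  also have "\<dots> \<le> 2 * (norm a)\<^sup>2 + 2 * (norm b)\<^sup>2"
    using zero_le_power2[of "norm a - norm b"] unfolding power2_sum power2_diff by linarith
  finally show ?thesis .
qed

lemma power2_norm_diff_le:
  fixes a b :: "'a::real_normed_vector"
  shows "(norm (a - b))\<^sup>2 \<le> 2 * (norm a)\<^sup>2 + 2 * (norm b)\<^sup>2"
  using power2_norm_add_le[of a "- b"] by simp

section \<open>Square-integrable functions\<close>

lemma L2D:
  assumes "f \<in> L2 \<Omega>"
  shows "f \<in> borel_measurable (lebesgue_on \<Omega>)" "integrable (lebesgue_on \<Omega>) (\<lambda>x. (norm (f x))\<^sup>2)"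
  using assms by (auto simp: L2_def)

lemma L2_diff:
  assumes f: "f \<in> L2 \<Omega>" and g: "g \<in> L2 \<Omega>"
  shows "(\<lambda>x. f x - g x) \<in> L2 \<Omega>"
proof -
  note [measurable] = L2D(1)[OF f] L2D(1)[OF g]
  have "integrable (lebesgue_on \<Omega>) (\<lambda>x. (norm (f x - g x))\<^sup>2)"
  proof (rule Bochner_Integration.integrable_bound)
    show "integrable (lebesgue_on \<Omega>) (\<lambda>x. 2 * (norm (f x))\<^sup>2 + 2 * (norm (g x))\<^sup>2)"
      using L2D(2)[OF f] L2D(2)[OF g] by simp
    show "(\<lambda>x. (norm (f x - g x))\<^sup>2) \<in> borel_measurable (lebesgue_on \<Omega>)" by measurable
    show "AE x in lebesgue_on \<Omega>. norm ((norm (f x - g x))\<^sup>2) \<le> norm (2 * (norm (f x))\<^sup>2 + 2 * (norm (g x))\<^sup>2)"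
      by (intro AE_I2) (use power2_norm_diff_le in auto)
  qed
  then show ?thesis by (simp add: L2_def)
qed

lemma L2_linear:
  assumes f: "f \<in> L2 \<Omega>" and B: "bounded_linear B"
  shows "(\<lambda>x. B (f x)) \<in> L2 \<Omega>"
proof -
  obtain K where K: "\<And>x. norm (B x) \<le> norm x * K" using bounded_linear.bounded[OF B] by blast
  have m: "(\<lambda>x. B (f x)) \<in> borel_measurable (lebesgue_on \<Omega>)"
    using borel_measurable_continuous_on[OF linear_continuous_on[OF B] L2D(1)[OF f]] .
  have "integrable (lebesgue_on \<Omega>) (\<lambda>x. (norm (B (f x)))\<^sup>2)"
  proof (rule Bochner_Integration.integrable_bound)
    show "integrable (lebesgue_on \<Omega>) (\<lambda>x. (norm (f x))\<^sup>2 * K\<^sup>2)"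
      using L2D(2)[OF f] by simp
    show "(\<lambda>x. (norm (B (f x)))\<^sup>2) \<in> borel_measurable (lebesgue_on \<Omega>)" using m by measurable
    show "AE x in lebesgue_on \<Omega>. norm ((norm (B (f x)))\<^sup>2) \<le> norm ((norm (f x))\<^sup>2 * K\<^sup>2)"
    proof (rule AE_I2)
      fix x
      have "(norm (B (f x)))\<^sup>2 \<le> (norm (f x) * K)\<^sup>2" by (rule power_mono[OF K]) simp
      then show "norm ((norm (B (f x)))\<^sup>2) \<le> norm ((norm (f x))\<^sup>2 * K\<^sup>2)" by (simp add: power_mult_distrib)
    qed
  qed
  with m show ?thesis by (simp add: L2_def)
qed

lemma L2_integrable_bilinear:
  fixes B :: "'a::euclidean_space \<Rightarrow> 'b::euclidean_space \<Rightarrow> 'c::euclidean_space"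
  assumes B: "bounded_bilinear B" and f: "f \<in> L2 \<Omega>" and g: "g \<in> L2 \<Omega>"
  shows "integrable (lebesgue_on \<Omega>) (\<lambda>x. B (f x) (g x))"
proof -
  obtain K where K: "K > 0" "\<And>a b. norm (B a b) \<le> norm a * norm b * K" using bounded_bilinear.pos_bounded[OF B] by blast
  have c: "continuous_on UNIV (\<lambda>p. B (fst p) (snd p))"
    by (intro bounded_bilinear.continuous_on[OF B] continuous_intros)
  show ?thesis
  proof (rule Bochner_Integration.integrable_bound)
    show "integrable (lebesgue_on \<Omega>) (\<lambda>x. ((norm (f x))\<^sup>2 + (norm (g x))\<^sup>2) * K)"
      using L2D(2)[OF f] L2D(2)[OF g] by simp
    show "(\<lambda>x. B (f x) (g x)) \<in> borel_measurable (lebesgue_on \<Omega>)"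
      by (rule borel_measurable_continuous_Pair[OF L2D(1)[OF f] L2D(1)[OF g] c])
    show "AE x in lebesgue_on \<Omega>. norm (B (f x) (g x)) \<le> norm (((norm (f x))\<^sup>2 + (norm (g x))\<^sup>2) * K)"
    proof (rule AE_I2)
      fix x
      have "norm (f x) * norm (g x) \<le> (norm (f x))\<^sup>2 + (norm (g x))\<^sup>2"
        using sum_squares_bound[of "norm (f x)" "norm (g x)"] mult_nonneg_nonneg[OF norm_ge_zero[of "f x"] norm_ge_zero[of "g x"]]
        by (simp only: mult.assoc)
      then have "norm (f x) * norm (g x) * K \<le> ((norm (f x))\<^sup>2 + (norm (g x))\<^sup>2) * K"
        using K(1) by (intro mult_right_mono) auto
      then have "norm (B (f x) (g x)) \<le> ((norm (f x))\<^sup>2 + (norm (g x))\<^sup>2) * K" using K(2) order.trans by blast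
      then show "norm (B (f x) (g x)) \<le> norm (((norm (f x))\<^sup>2 + (norm (g x))\<^sup>2) * K)" by (rule order.trans) simp
    qed
  qed
qed

text \<open>The gradient of a function that is smooth inside \<Omega> may grow towards the boundary,
  so it is locally integrable without being known to be integrable. Uniqueness of weak gradients is
  therefore proved in this class.\<close>

definition locally_integrable :: "(real^'n::finite) set \<Rightarrow> (real^'n \<Rightarrow> complex) \<Rightarrow> bool" where
  "locally_integrable \<Omega> F \<longleftrightarrow> F \<in> borel_measurable (lebesgue_on \<Omega>) \<and>
     (\<forall>K. compact K \<longrightarrow> K \<subseteq> \<Omega> \<longrightarrow> integrable (lebesgue_on K) F)"

locale bounded_open =
  fixes \<Omega> :: "(real^'n::finite) set"
  assumes open_\<Omega>: "open \<Omega>" and bounded_\<Omega>: "bounded \<Omega>"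
begin

lemma sets_\<Omega>: "\<Omega> \<in> sets lebesgue"
  using open_\<Omega> by auto

lemma lmeasurable_\<Omega>: "\<Omega> \<in> lmeasurable"
  by (rule bounded_set_imp_lmeasurable[OF bounded_\<Omega> sets_\<Omega>])

lemma L2_bounded:
  assumes "f \<in> borel_measurable (lebesgue_on \<Omega>)" "\<And>x. x \<in> \<Omega> \<Longrightarrow> norm (f x) \<le> B"
  shows "f \<in> L2 \<Omega>"
proof -
  have "integrable (lebesgue_on \<Omega>) (\<lambda>x. (norm (f x))\<^sup>2)"
  proof (rule integrable_lebesgue_on_bounded[OF lmeasurable_\<Omega>])
    show "(\<lambda>x. (norm (f x))\<^sup>2) \<in> borel_measurable (lebesgue_on \<Omega>)" using assms(1) by measurable
    show "norm ((norm (f x))\<^sup>2) \<le> B\<^sup>2" if "x \<in> \<Omega>" for x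
      using assms(2)[OF that] by (simp add: power_mono)
  qed
  with assms(1) show ?thesis by (simp add: L2_def)
qed

lemma L2_continuous:
  assumes "continuous_on UNIV f" shows "f \<in> L2 \<Omega>"
proof -
  obtain B where "\<And>x. x \<in> \<Omega> \<Longrightarrow> norm (f x) \<le> B"
    using continuous_on_bounded_on[OF assms bounded_\<Omega>] by blast
  then show ?thesis
    by (rule L2_bounded[OF borel_measurable_lebesgue_on_continuous[OF assms sets_\<Omega>]])
qed

lemma L2_test_fun: "\<phi> \<in> test_fun S \<Longrightarrow> \<phi> \<in> L2 \<Omega>"
  by (rule L2_continuous[OF smooth_on_continuous[OF test_funD(1)]])

lemma L2_mult_integrable:
  fixes f g :: "real^'n \<Rightarrow> complex"
  shows "f \<in> L2 \<Omega> \<Longrightarrow> g \<in> L2 \<Omega> \<Longrightarrow> integrable (lebesgue_on \<Omega>) (\<lambda>x. f x * g x)"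
  by (rule L2_integrable_bilinear[OF bounded_bilinear_mult])

lemma L2_integrable:
  fixes f :: "real^'n \<Rightarrow> complex"
  assumes "f \<in> L2 \<Omega>" shows "integrable (lebesgue_on \<Omega>) f"
  using L2_mult_integrable[OF assms L2_continuous[OF continuous_on_const[of UNIV 1]]] by simp

lemma L2_nth: "f \<in> L2 \<Omega> \<Longrightarrow> (\<lambda>x. f x $ i) \<in> L2 \<Omega>"
  by (rule L2_linear[OF _ bounded_linear_vec_nth])

lemma locally_integrableD: "locally_integrable \<Omega> F \<Longrightarrow> F \<in> borel_measurable (lebesgue_on \<Omega>)"
  "locally_integrable \<Omega> F \<Longrightarrow> compact K \<Longrightarrow> K \<subseteq> \<Omega> \<Longrightarrow> integrable (lebesgue_on K) F"
  by (auto simp: locally_integrable_def)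

lemma locally_integrable_integrable:
  assumes "integrable (lebesgue_on \<Omega>) F" shows "locally_integrable \<Omega> F"
  unfolding locally_integrable_def
proof (intro conjI allI impI)
  show "F \<in> borel_measurable (lebesgue_on \<Omega>)" using assms by (rule borel_measurable_integrable)
  fix K :: "(real^'n) set" assume "compact K" "K \<subseteq> \<Omega>"
  then show "integrable (lebesgue_on K) F"
    by (intro integrable_lebesgue_on_subset[OF assms _ sets_\<Omega>]) (auto intro: lmeasurable_compact fmeasurableD)
qed

lemma locally_integrable_continuous:
  assumes "continuous_on \<Omega> F" shows "locally_integrable \<Omega> F"
  unfolding locally_integrable_def
proof (intro conjI allI impI)
  show "F \<in> borel_measurable (lebesgue_on \<Omega>)" by (rule continuous_imp_measurable_on_sets_lebesgue[OF assms sets_\<Omega>])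
  fix K :: "(real^'n) set" assume K: "compact K" "K \<subseteq> \<Omega>"
  have c: "continuous_on K F" using assms K(2) continuous_on_subset by blast
  have "bounded (F ` K)" using compact_continuous_image[OF c K(1)] compact_imp_bounded by blast
  then obtain B where B: "\<And>x. x \<in> K \<Longrightarrow> norm (F x) \<le> B" unfolding bounded_iff by auto
  show "integrable (lebesgue_on K) F"
    by (rule integrable_lebesgue_on_bounded[OF lmeasurable_compact[OF K(1)] _ B])
      (use continuous_imp_measurable_on_sets_lebesgue[OF c] K(1) in \<open>auto intro: lmeasurable_compact fmeasurableD\<close>)
qed

lemma locally_integrable_mult_test_fun:
  assumes F: "locally_integrable \<Omega> F" and \<phi>: "\<phi> \<in> test_fun \<Omega>"
  shows "integrable (lebesgue_on \<Omega>) (\<lambda>x. F x * \<phi> x)"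
proof -
  note D = test_funD[OF \<phi>]
  have s: "supp \<phi> \<in> sets lebesgue" using D(2) by (auto intro: lmeasurable_compact fmeasurableD)
  have i: "integrable (lebesgue_on (supp \<phi>)) F" by (rule locally_integrableD(2)[OF F D(2,3)])
  obtain B where B: "\<And>x. norm (\<phi> x) \<le> B" using test_fun_bounded[OF \<phi>] by blast
  have m\<phi>: "\<phi> \<in> borel_measurable (lebesgue_on (supp \<phi>))"
    by (rule borel_measurable_lebesgue_on_continuous[OF smooth_on_continuous[OF D(1)] s])
  have "integrable (lebesgue_on (supp \<phi>)) (\<lambda>x. F x * \<phi> x)"
  proof (rule Bochner_Integration.integrable_bound)
    show "integrable (lebesgue_on (supp \<phi>)) (\<lambda>x. F x * complex_of_real B)" using i by simp
    show "(\<lambda>x. F x * \<phi> x) \<in> borel_measurable (lebesgue_on (supp \<phi>))"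
      using borel_measurable_integrable[OF i] m\<phi> by measurable
    show "AE x in lebesgue_on (supp \<phi>). norm (F x * \<phi> x) \<le> norm (F x * complex_of_real B)"
    proof (rule AE_I2)
      fix x
      have "norm (\<phi> x) \<le> \<bar>B\<bar>" using B[of x] by linarith
      then show "norm (F x * \<phi> x) \<le> norm (F x * complex_of_real B)" by (simp add: norm_mult mult_left_mono)
    qed
  qed
  then have "integrable lebesgue (\<lambda>x. indicator (supp \<phi>) x *\<^sub>R (F x * \<phi> x))"
    using s by (simp add: integrable_restrict_space)
  moreover have "indicator (supp \<phi>) x *\<^sub>R (F x * \<phi> x) = indicator \<Omega> x *\<^sub>R (F x * \<phi> x)" for x
    using D(3,4) by (auto simp: indicator_def)
  ultimately show ?thesis using sets_\<Omega> by (simp add: integrable_restrict_space)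
qed

lemma locally_integrable_diff:
  assumes "locally_integrable \<Omega> F" "locally_integrable \<Omega> G"
  shows "locally_integrable \<Omega> (\<lambda>x. F x - G x)"
  using assms unfolding locally_integrable_def by auto

lemma AE_eq_if_integral_test_fun_eq:
  assumes F: "locally_integrable \<Omega> F" and G: "locally_integrable \<Omega> G"
    and eq: "\<And>\<phi>. \<phi> \<in> test_fun \<Omega> \<Longrightarrow> (LINT x|lebesgue_on \<Omega>. F x * \<phi> x) = (LINT x|lebesgue_on \<Omega>. G x * \<phi> x)"
  shows "AE x in lebesgue_on \<Omega>. F x = G x"
proof -
  note FG = locally_integrable_diff[OF F G]
  have "AE x in lebesgue_on \<Omega>. F x - G x = 0"
  proof (rule fundamental_lemma[OF open_\<Omega> locally_integrableD(1)[OF FG] locally_integrableD(2)[OF FG]])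
    fix \<phi> assume \<phi>: "\<phi> \<in> test_fun \<Omega>"
    show "(LINT x|lebesgue_on \<Omega>. (F x - G x) * \<phi> x) = 0"
      using eq[OF \<phi>] locally_integrable_mult_test_fun[OF F \<phi>] locally_integrable_mult_test_fun[OF G \<phi>]
      by (simp add: left_diff_distrib)
  qed
  then show ?thesis by (rule eventually_mono) simp
qed

section \<open>Uniqueness and calculus of weak gradients\<close>

lemma weak_gradientD:
  "weak_gradient \<Omega> u G \<Longrightarrow> \<phi> \<in> test_fun \<Omega> \<Longrightarrow>
    (LINT x|lebesgue_on \<Omega>. u x * partial i \<phi> x) = - (LINT x|lebesgue_on \<Omega>. G x $ i * \<phi> x)"
  unfolding weak_gradient_def by blast

text \<open>The chosen \<open>wgrad\<close> can be replaced by any known weak gradient: testing the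
  difference against all test functions makes each coordinate vanish almost everywhere.\<close>

lemma weak_gradient_unique:
  assumes u: "weak_gradient \<Omega> u G" "weak_gradient \<Omega> u H"
    and "\<And>i. locally_integrable \<Omega> (\<lambda>x. G x $ i)" "\<And>i. locally_integrable \<Omega> (\<lambda>x. H x $ i)"
  shows "AE x in lebesgue_on \<Omega>. G x = H x"
proof -
  have "AE x in lebesgue_on \<Omega>. G x $ i = H x $ i" for i
    by (rule AE_eq_if_integral_test_fun_eq[OF assms(3,4)])
      (use weak_gradientD[OF u(1), of _ i] weak_gradientD[OF u(2), of _ i] in auto)
  then have "AE x in lebesgue_on \<Omega>. \<forall>i\<in>UNIV. G x $ i = H x $ i"
    by (intro AE_finite_allI) auto
  then show ?thesis by (rule eventually_mono) (simp add: vec_eq_iff)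
qed

lemma H1D:
  assumes "u \<in> H1 \<Omega>"
  shows "u \<in> L2 \<Omega>" "wgrad \<Omega> u \<in> L2 \<Omega>" "weak_gradient \<Omega> u (wgrad \<Omega> u)"
proof -
  show "u \<in> L2 \<Omega>" using assms by (simp add: H1_def)
  have "\<exists>G. G \<in> L2 \<Omega> \<and> weak_gradient \<Omega> u G" using assms by (auto simp: H1_def)
  from someI_ex[OF this] show "wgrad \<Omega> u \<in> L2 \<Omega>" "weak_gradient \<Omega> u (wgrad \<Omega> u)"
    unfolding wgrad_def by auto
qed

lemma L2_locally_integrable:
  fixes f :: "real^'n \<Rightarrow> complex"
  shows "f \<in> L2 \<Omega> \<Longrightarrow> locally_integrable \<Omega> f"
  by (rule locally_integrable_integrable[OF L2_integrable])

lemma wgrad_AE_eq: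
  assumes "u \<in> H1 \<Omega>" "weak_gradient \<Omega> u G" "\<And>i. locally_integrable \<Omega> (\<lambda>x. G x $ i)"
  shows "AE x in lebesgue_on \<Omega>. wgrad \<Omega> u x = G x"
  by (rule weak_gradient_unique[OF H1D(3)[OF assms(1)] assms(2) _ assms(3)])
    (intro L2_locally_integrable L2_nth H1D(2)[OF assms(1)])

lemma wgrad_AE_eq_L2:
  assumes "u \<in> L2 \<Omega>" "weak_gradient \<Omega> u G" "G \<in> L2 \<Omega>"
  shows "u \<in> H1 \<Omega>" "AE x in lebesgue_on \<Omega>. wgrad \<Omega> u x = G x"
proof -
  show u: "u \<in> H1 \<Omega>" using assms by (auto simp: H1_def)
  show "AE x in lebesgue_on \<Omega>. wgrad \<Omega> u x = G x"
    by (rule wgrad_AE_eq[OF u assms(2)]) (intro L2_locally_integrable L2_nth assms(3))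
qed

lemma H1_diff:
  assumes u: "u \<in> H1 \<Omega>" and v: "v \<in> H1 \<Omega>"
  shows "(\<lambda>x. u x - v x) \<in> H1 \<Omega>"
    "AE x in lebesgue_on \<Omega>. wgrad \<Omega> (\<lambda>x. u x - v x) x = wgrad \<Omega> u x - wgrad \<Omega> v x"
proof -
  have "weak_gradient \<Omega> (\<lambda>x. u x - v x) (\<lambda>x. wgrad \<Omega> u x - wgrad \<Omega> v x)"
    unfolding weak_gradient_def
  proof (intro ballI allI)
    fix \<phi> i assume \<phi>: "\<phi> \<in> test_fun \<Omega>"
    note p = L2_test_fun[OF test_fun_partial[OF \<phi>]] and q = L2_test_fun[OF \<phi>]
    show "(LINT x|lebesgue_on \<Omega>. (u x - v x) * partial i \<phi> x)
        = - (LINT x|lebesgue_on \<Omega>. (wgrad \<Omega> u x - wgrad \<Omega> v x) $ i * \<phi> x)"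
      using weak_gradientD[OF H1D(3)[OF u] \<phi>, of i] weak_gradientD[OF H1D(3)[OF v] \<phi>, of i]
        L2_mult_integrable[OF H1D(1)[OF u] p] L2_mult_integrable[OF H1D(1)[OF v] p]
        L2_mult_integrable[OF L2_nth[OF H1D(2)[OF u]] q] L2_mult_integrable[OF L2_nth[OF H1D(2)[OF v]] q]
      by (simp add: left_diff_distrib)
  qed
  from wgrad_AE_eq_L2[OF L2_diff[OF H1D(1)[OF u] H1D(1)[OF v]] this L2_diff[OF H1D(2)[OF u] H1D(2)[OF v]]]
  show "(\<lambda>x. u x - v x) \<in> H1 \<Omega>"
    "AE x in lebesgue_on \<Omega>. wgrad \<Omega> (\<lambda>x. u x - v x) x = wgrad \<Omega> u x - wgrad \<Omega> v x" .
qed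

lemma H1_cnj:
  assumes u: "u \<in> H1 \<Omega>"
  shows "(\<lambda>x. cnj (u x)) \<in> H1 \<Omega>"
    "AE x in lebesgue_on \<Omega>. wgrad \<Omega> (\<lambda>x. cnj (u x)) x = cnj_vec (wgrad \<Omega> u x)"
proof -
  have "weak_gradient \<Omega> (\<lambda>x. cnj (u x)) (\<lambda>x. cnj_vec (wgrad \<Omega> u x))"
    unfolding weak_gradient_def
  proof (intro ballI allI)
    fix \<phi> i assume \<phi>: "\<phi> \<in> test_fun \<Omega>"
    have c: "(\<lambda>x. cnj (\<phi> x)) \<in> test_fun \<Omega>" by (rule test_fun_linear[OF \<phi> bounded_linear_cnj])
    have pc: "partial i (\<lambda>x. cnj (\<phi> x)) x = cnj (partial i \<phi> x)" for x
      by (rule partial_linear[OF bounded_linear_cnj smooth_on_differentiable[OF test_funD(1)[OF \<phi>]]]) simp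
    have "(LINT x|lebesgue_on \<Omega>. cnj (u x) * partial i \<phi> x) = cnj (LINT x|lebesgue_on \<Omega>. u x * cnj (partial i \<phi> x))"
      using Bochner_Integration.integral_cnj[of "lebesgue_on \<Omega>" "\<lambda>x. u x * cnj (partial i \<phi> x)"] by simp
    also have "\<dots> = - cnj (LINT x|lebesgue_on \<Omega>. wgrad \<Omega> u x $ i * cnj (\<phi> x))"
      using weak_gradientD[OF H1D(3)[OF u] c, of i] unfolding pc by simp
    also have "cnj (LINT x|lebesgue_on \<Omega>. wgrad \<Omega> u x $ i * cnj (\<phi> x)) = (LINT x|lebesgue_on \<Omega>. cnj_vec (wgrad \<Omega> u x) $ i * \<phi> x)"
      using Bochner_Integration.integral_cnj[of "lebesgue_on \<Omega>" "\<lambda>x. wgrad \<Omega> u x $ i * cnj (\<phi> x)"] by (simp add: cnj_vec_def)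
    finally show "(LINT x|lebesgue_on \<Omega>. cnj (u x) * partial i \<phi> x)
        = - (LINT x|lebesgue_on \<Omega>. cnj_vec (wgrad \<Omega> u x) $ i * \<phi> x)" .
  qed
  from wgrad_AE_eq_L2[OF L2_linear[OF H1D(1)[OF u] bounded_linear_cnj] this L2_linear[OF H1D(2)[OF u] bounded_linear_cnj_vec]]
  show "(\<lambda>x. cnj (u x)) \<in> H1 \<Omega>"
    "AE x in lebesgue_on \<Omega>. wgrad \<Omega> (\<lambda>x. cnj (u x)) x = cnj_vec (wgrad \<Omega> u x)" .
qed

lemma weak_gradient_smooth: "smooth_on \<Omega> u \<Longrightarrow> weak_gradient \<Omega> u (cgrad u)"
  unfolding weak_gradient_def cgrad_def
  using integral_test_fun_parts(2)[OF open_\<Omega> bounded_\<Omega>] by auto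

lemma wgrad_smooth_on:
  assumes "smooth_on \<Omega> u" "u \<in> H1 \<Omega>"
  shows "AE x in lebesgue_on \<Omega>. wgrad \<Omega> u x = cgrad u x"
  by (rule wgrad_AE_eq[OF assms(2) weak_gradient_smooth[OF assms(1)]])
    (auto simp: cgrad_def intro!: locally_integrable_continuous smooth_on_continuous smooth_on_partial assms(1))

lemma continuous_on_cgrad: "smooth_on S u \<Longrightarrow> continuous_on S (cgrad u)"
  unfolding cgrad_def[abs_def] by (intro continuous_on_vec_lambda smooth_on_continuous smooth_on_partial)

lemma H1_smooth:
  assumes u: "smooth_on UNIV u"
  shows "u \<in> H1 \<Omega>" "AE x in lebesgue_on \<Omega>. wgrad \<Omega> u x = cgrad u x"
  using wgrad_AE_eq_L2[OF L2_continuous[OF smooth_on_continuous[OF u]]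
      weak_gradient_smooth[OF smooth_on_subset[OF u]] L2_continuous[OF continuous_on_cgrad[OF u]]] by auto

text \<open>The square of \<open>H1_norm\<close>. Convergence to 0 means the same for both, and
  estimates for the square are free of roots.\<close>

definition energy :: "(real^'n \<Rightarrow> complex) \<Rightarrow> real" where
  "energy u = (LINT x|lebesgue_on \<Omega>. (norm (u x))\<^sup>2) + (LINT x|lebesgue_on \<Omega>. (norm (wgrad \<Omega> u x))\<^sup>2)"

lemma energy_nonneg: "0 \<le> energy u"
  unfolding energy_def by (intro add_nonneg_nonneg Bochner_Integration.integral_nonneg) auto

lemma H1_norm_energy: "H1_norm \<Omega> u = sqrt (energy u)"
  by (simp add: H1_norm_def energy_def)

lemma H1_norm_tendsto_0: "(\<lambda>n. H1_norm \<Omega> (u n)) \<longlonglongrightarrow> 0 \<longleftrightarrow> (\<lambda>n. energy (u n)) \<longlonglongrightarrow> 0"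
proof
  assume "(\<lambda>n. H1_norm \<Omega> (u n)) \<longlonglongrightarrow> 0"
  from tendsto_power[OF this, of 2] show "(\<lambda>n. energy (u n)) \<longlonglongrightarrow> 0"
    by (simp add: H1_norm_energy energy_nonneg)
next
  assume "(\<lambda>n. energy (u n)) \<longlonglongrightarrow> 0"
  from tendsto_real_sqrt[OF this] show "(\<lambda>n. H1_norm \<Omega> (u n)) \<longlonglongrightarrow> 0" by (simp add: H1_norm_energy)
qed

lemma energy_diff_le:
  assumes u: "u \<in> H1 \<Omega>" and v: "v \<in> H1 \<Omega>"
  shows "energy (\<lambda>x. u x - v x) \<le> 2 * energy u + 2 * energy v"
proof -
  have *: "(LINT x|lebesgue_on \<Omega>. (norm (f x - g x))\<^sup>2)
      \<le> 2 * (LINT x|lebesgue_on \<Omega>. (norm (f x))\<^sup>2) + 2 * (LINT x|lebesgue_on \<Omega>. (norm (g x))\<^sup>2)"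
    if f: "f \<in> L2 \<Omega>" and g: "g \<in> L2 \<Omega>" for f g :: "real^'n \<Rightarrow> 'x::euclidean_space"
  proof -
    have "(LINT x|lebesgue_on \<Omega>. (norm (f x - g x))\<^sup>2) \<le> (LINT x|lebesgue_on \<Omega>. 2 * (norm (f x))\<^sup>2 + 2 * (norm (g x))\<^sup>2)"
      by (rule integral_mono) (use L2D(2)[OF L2_diff[OF f g]] L2D(2)[OF f] L2D(2)[OF g] power2_norm_diff_le in auto)
    also have "\<dots> = 2 * (LINT x|lebesgue_on \<Omega>. (norm (f x))\<^sup>2) + 2 * (LINT x|lebesgue_on \<Omega>. (norm (g x))\<^sup>2)"
      using L2D(2)[OF f] L2D(2)[OF g] by simp
    finally show ?thesis .
  qed
  have "(LINT x|lebesgue_on \<Omega>. (norm (wgrad \<Omega> (\<lambda>x. u x - v x) x))\<^sup>2)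
      = (LINT x|lebesgue_on \<Omega>. (norm (wgrad \<Omega> u x - wgrad \<Omega> v x))\<^sup>2)"
    by (rule integral_cong_AE)
      (use L2D(2)[OF H1D(2)[OF H1_diff(1)[OF u v]]] L2D(2)[OF L2_diff[OF H1D(2)[OF u] H1D(2)[OF v]]] H1_diff(2)[OF u v]
       in \<open>auto intro: borel_measurable_integrable elim!: eventually_mono\<close>)
  then show ?thesis
    unfolding energy_def using *[OF H1D(1)[OF u] H1D(1)[OF v]] *[OF H1D(2)[OF u] H1D(2)[OF v]] by simp
qed

lemma energy_cnj:
  assumes u: "u \<in> H1 \<Omega>" shows "energy (\<lambda>x. cnj (u x)) = energy u"
proof -
  have "(LINT x|lebesgue_on \<Omega>. (norm (wgrad \<Omega> (\<lambda>x. cnj (u x)) x))\<^sup>2) = (LINT x|lebesgue_on \<Omega>. (norm (wgrad \<Omega> u x))\<^sup>2)"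
    by (rule integral_cong_AE)
      (use L2D(2)[OF H1D(2)[OF H1_cnj(1)[OF u]]] L2D(2)[OF H1D(2)[OF u]] H1_cnj(2)[OF u]
       in \<open>auto intro: borel_measurable_integrable elim!: eventually_mono\<close>)
  then show ?thesis by (simp add: energy_def)
qed

lemma energy_zero: "energy (\<lambda>_. 0) = 0"
proof -
  have z: "smooth_on UNIV (\<lambda>_ :: real^'n. 0 :: complex)" by (intro smooth_on_const open_UNIV)
  have "(LINT x|lebesgue_on \<Omega>. (norm (wgrad \<Omega> (\<lambda>_. 0) x))\<^sup>2) = (LINT x|lebesgue_on \<Omega>. 0)"
    by (rule integral_cong_AE)
      (use L2D(2)[OF H1D(2)[OF H1_smooth(1)[OF z]]] H1_smooth(2)[OF z]
       in \<open>auto intro: borel_measurable_integrable elim!: eventually_mono simp: cgrad_def vec_eq_iff\<close>)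
  then show ?thesis by (simp add: energy_def)
qed

end

section \<open>Traces and harmonic functions\<close>

locale smooth_domain = bounded_open \<Omega> for \<Omega> :: "(real^'n::finite) set" +
  assumes dim_ge_2: "CARD('n) \<ge> 2" and smooth_boundary_\<Omega>: "smooth_boundary \<Omega>"
begin

abbreviation bdry_sq :: "(real^'n \<Rightarrow> complex) \<Rightarrow> ennreal" where
  "bdry_sq f \<equiv> \<integral>\<^sup>+ x. ennreal ((norm (f x))\<^sup>2) \<partial>surface_measure \<Omega>"

lemma borel_measurable_surface_measure:
  assumes "continuous_on UNIV f" shows "f \<in> borel_measurable (surface_measure \<Omega>)"
proof -
  have "f \<in> borel_measurable (restrict_space borel (frontier \<Omega>))"
    using borel_measurable_continuous_onI[OF assms] by (rule measurable_restrict_space1)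
  then show ?thesis using measurable_cong_sets[OF sets_surface_measure refl] by blast
qed

lemma bdry_sq_diff_le:
  assumes "f \<in> borel_measurable (surface_measure \<Omega>)" "g \<in> borel_measurable (surface_measure \<Omega>)"
  shows "bdry_sq (\<lambda>x. f x - g x) \<le> 2 * bdry_sq f + 2 * bdry_sq g"
proof -
  note [measurable] = assms
  have "ennreal ((norm (f x - g x))\<^sup>2) \<le> 2 * ennreal ((norm (f x))\<^sup>2) + 2 * ennreal ((norm (g x))\<^sup>2)" for x
  proof -
    have "ennreal ((norm (f x - g x))\<^sup>2) \<le> ennreal (2 * (norm (f x))\<^sup>2 + 2 * (norm (g x))\<^sup>2)"
      by (rule ennreal_leI[OF power2_norm_diff_le])
    then show ?thesis by (simp add: ennreal_plus ennreal_mult')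
  qed
  then have "bdry_sq (\<lambda>x. f x - g x)
      \<le> (\<integral>\<^sup>+ x. 2 * ennreal ((norm (f x))\<^sup>2) + 2 * ennreal ((norm (g x))\<^sup>2) \<partial>surface_measure \<Omega>)"
    by (intro nn_integral_mono) auto
  also have "\<dots> = 2 * bdry_sq f + 2 * bdry_sq g"
    by (simp add: nn_integral_add nn_integral_cmult)
  finally show ?thesis .
qed

section \<open>Traces as limits of smooth functions\<close>

lemma has_traceD:
  assumes "has_trace \<Omega> u f"
  shows "u \<in> H1 \<Omega>" "f \<in> borel_measurable (surface_measure \<Omega>)"
  using assms by (auto simp: has_trace_def)

lemma has_traceI:
  assumes "u \<in> H1 \<Omega>" "f \<in> borel_measurable (surface_measure \<Omega>)"
    "\<And>n. smooth_on UNIV (\<phi> n)" "(\<lambda>n. energy (\<lambda>x. \<phi> n x - u x)) \<longlonglongrightarrow> 0" "(\<lambda>n. bdry_sq (\<lambda>x. \<phi> n x - f x)) \<longlonglongrightarrow> 0"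
  shows "has_trace \<Omega> u f"
  unfolding has_trace_def using assms H1_norm_tendsto_0[of "\<lambda>n x. \<phi> n x - u x"] by blast

lemma has_trace_sequence:
  assumes "has_trace \<Omega> u f"
  obtains \<phi> where "\<And>n. smooth_on UNIV (\<phi> n)" "(\<lambda>n. energy (\<lambda>x. \<phi> n x - u x)) \<longlonglongrightarrow> 0"
    "(\<lambda>n. bdry_sq (\<lambda>x. \<phi> n x - f x)) \<longlonglongrightarrow> 0"
proof -
  obtain \<phi> where \<phi>: "\<forall>n. smooth_on UNIV (\<phi> n)" "(\<lambda>n. H1_norm \<Omega> (\<lambda>x. \<phi> n x - u x)) \<longlonglongrightarrow> 0"
    "(\<lambda>n. bdry_sq (\<lambda>x. \<phi> n x - f x)) \<longlonglongrightarrow> 0"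
    using assms unfolding has_trace_def by auto
  show ?thesis
    by (rule that[of \<phi>]) (use \<phi> H1_norm_tendsto_0[of "\<lambda>n x. \<phi> n x - u x"] in auto)
qed

lemma has_trace_smooth:
  assumes \<phi>: "smooth_on UNIV \<phi>" shows "has_trace \<Omega> \<phi> \<phi>"
  by (rule has_traceI[where \<phi>="\<lambda>_. \<phi>"])
    (use H1_smooth(1)[OF \<phi>] borel_measurable_surface_measure[OF smooth_on_continuous[OF \<phi>]] \<phi> energy_zero in auto)

lemma has_trace_diff:
  assumes u: "has_trace \<Omega> u f" and v: "has_trace \<Omega> v g"
  shows "has_trace \<Omega> (\<lambda>x. u x - v x) (\<lambda>x. f x - g x)"
proof -
  obtain \<phi> where \<phi>: "\<And>n. smooth_on UNIV (\<phi> n)" "(\<lambda>n. energy (\<lambda>x. \<phi> n x - u x)) \<longlonglongrightarrow> 0"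
    "(\<lambda>n. bdry_sq (\<lambda>x. \<phi> n x - f x)) \<longlonglongrightarrow> 0" using has_trace_sequence[OF u] by blast
  obtain \<psi> where \<psi>: "\<And>n. smooth_on UNIV (\<psi> n)" "(\<lambda>n. energy (\<lambda>x. \<psi> n x - v x)) \<longlonglongrightarrow> 0"
    "(\<lambda>n. bdry_sq (\<lambda>x. \<psi> n x - g x)) \<longlonglongrightarrow> 0" using has_trace_sequence[OF v] by blast
  note uH = has_traceD(1)[OF u] and vH = has_traceD(1)[OF v]
  note fm = has_traceD(2)[OF u] and gm = has_traceD(2)[OF v]
  have d: "(\<lambda>x. (\<phi> n x - \<psi> n x) - (a x - b x)) = (\<lambda>x. (\<phi> n x - a x) - (\<psi> n x - b x))" for n a b
    by (auto simp: fun_eq_iff)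
  have d2: "\<phi> n x - \<psi> n x - (f x - g x) = (\<phi> n x - f x) - (\<psi> n x - g x)" for n x by simp
  show ?thesis
  proof (rule has_traceI[where \<phi>="\<lambda>n x. \<phi> n x - \<psi> n x"])
    show "(\<lambda>x. u x - v x) \<in> H1 \<Omega>" by (rule H1_diff(1)[OF uH vH])
    show "(\<lambda>x. f x - g x) \<in> borel_measurable (surface_measure \<Omega>)" using fm gm by measurable
    show "smooth_on UNIV (\<lambda>x. \<phi> n x - \<psi> n x)" for n by (intro smooth_on_diff \<phi> \<psi> open_UNIV)
    show "(\<lambda>n. energy (\<lambda>x. \<phi> n x - \<psi> n x - (u x - v x))) \<longlonglongrightarrow> 0"
    proof (rule tendsto_sandwich[OF _ _ tendsto_const])
      show "\<forall>\<^sub>F n in sequentially. 0 \<le> energy (\<lambda>x. \<phi> n x - \<psi> n x - (u x - v x))" by (simp add: energy_nonneg)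
      show "\<forall>\<^sub>F n in sequentially. energy (\<lambda>x. \<phi> n x - \<psi> n x - (u x - v x))
          \<le> 2 * energy (\<lambda>x. \<phi> n x - u x) + 2 * energy (\<lambda>x. \<psi> n x - v x)"
        unfolding d by (intro always_eventually allI energy_diff_le H1_diff(1) H1_smooth(1) \<phi> \<psi> uH vH)
      have "(\<lambda>n. 2 * energy (\<lambda>x. \<phi> n x - u x) + 2 * energy (\<lambda>x. \<psi> n x - v x)) \<longlonglongrightarrow> 2 * 0 + 2 * 0"
        by (intro tendsto_intros \<phi> \<psi>)
      then show "(\<lambda>n. 2 * energy (\<lambda>x. \<phi> n x - u x) + 2 * energy (\<lambda>x. \<psi> n x - v x)) \<longlonglongrightarrow> 0" by simp
    qed
    show "(\<lambda>n. bdry_sq (\<lambda>x. \<phi> n x - \<psi> n x - (f x - g x))) \<longlonglongrightarrow> 0"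
    proof (rule tendsto_sandwich[OF _ _ tendsto_const])
      show "\<forall>\<^sub>F n in sequentially. 0 \<le> bdry_sq (\<lambda>x. \<phi> n x - \<psi> n x - (f x - g x))" by simp
      have m: "(\<lambda>x. \<phi> n x - f x) \<in> borel_measurable (surface_measure \<Omega>)"
        "(\<lambda>x. \<psi> n x - g x) \<in> borel_measurable (surface_measure \<Omega>)" for n
        using borel_measurable_surface_measure[OF smooth_on_continuous[OF \<phi>(1)[of n]]]
          borel_measurable_surface_measure[OF smooth_on_continuous[OF \<psi>(1)[of n]]] fm gm by measurable
      show "\<forall>\<^sub>F n in sequentially. bdry_sq (\<lambda>x. \<phi> n x - \<psi> n x - (f x - g x))
          \<le> 2 * bdry_sq (\<lambda>x. \<phi> n x - f x) + 2 * bdry_sq (\<lambda>x. \<psi> n x - g x)"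
        unfolding d2 by (intro always_eventually allI bdry_sq_diff_le m)
      have "(\<lambda>n. 2 * bdry_sq (\<lambda>x. \<phi> n x - f x) + 2 * bdry_sq (\<lambda>x. \<psi> n x - g x)) \<longlonglongrightarrow> 2 * 0 + 2 * 0"
        by (intro tendsto_add ennreal_tendsto_cmult \<phi> \<psi>) auto
      then show "(\<lambda>n. 2 * bdry_sq (\<lambda>x. \<phi> n x - f x) + 2 * bdry_sq (\<lambda>x. \<psi> n x - g x)) \<longlonglongrightarrow> 0" by simp
    qed
  qed
qed

text \<open>The weak form is bilinear, so the uniqueness proof tests with a conjugate, which must
  again have zero trace.\<close>

lemma has_trace_cnj:
  assumes u: "has_trace \<Omega> u f"
  shows "has_trace \<Omega> (\<lambda>x. cnj (u x)) (\<lambda>x. cnj (f x))"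
proof -
  obtain \<phi> where \<phi>: "\<And>n. smooth_on UNIV (\<phi> n)" "(\<lambda>n. energy (\<lambda>x. \<phi> n x - u x)) \<longlonglongrightarrow> 0"
    "(\<lambda>n. bdry_sq (\<lambda>x. \<phi> n x - f x)) \<longlonglongrightarrow> 0" using has_trace_sequence[OF u] by blast
  note uH = has_traceD(1)[OF u] and fm = has_traceD(2)[OF u]
  have e: "energy (\<lambda>x. cnj (\<phi> n x) - cnj (u x)) = energy (\<lambda>x. \<phi> n x - u x)" for n
    using energy_cnj[OF H1_diff(1)[OF H1_smooth(1)[OF \<phi>(1)[of n]] uH]] by simp
  have b: "bdry_sq (\<lambda>x. cnj (\<phi> n x) - cnj (f x)) = bdry_sq (\<lambda>x. \<phi> n x - f x)" for n
    by (simp flip: complex_cnj_diff)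
  show ?thesis
  proof (rule has_traceI[where \<phi>="\<lambda>n x. cnj (\<phi> n x)"])
    show "(\<lambda>x. cnj (u x)) \<in> H1 \<Omega>" by (rule H1_cnj(1)[OF uH])
    show "(\<lambda>x. cnj (f x)) \<in> borel_measurable (surface_measure \<Omega>)"
      using borel_measurable_continuous_on[OF linear_continuous_on[OF bounded_linear_cnj] fm] .
    show "smooth_on UNIV (\<lambda>x. cnj (\<phi> n x))" for n by (rule smooth_on_linear[OF bounded_linear_cnj open_UNIV \<phi>(1)])
  qed (use \<phi> e b in auto)
qed

text \<open>For harmonic \<open>e\<close> the integrand is the divergence of \<phi> times the
  gradient of \<open>e\<close>, so the boundary estimate applies to each component
  \<open>\<phi> * partial i e\<close>. Passing from \<phi> to such a component costs the square of
  \<open>M\<close>, a bound for the partial derivatives of \<open>e\<close> on the frontier.\<close>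

lemma integral_divergence_le:
  assumes e: "smooth_on UNIV e" and harm: "\<And>x. (\<Sum>i\<in>UNIV. partial i (partial i e) x) = 0"
  obtains C where "C \<ge> 0" "\<And>\<phi> \<epsilon> I. smooth_on UNIV \<phi> \<Longrightarrow> 0 < \<epsilon> \<Longrightarrow> 0 \<le> I \<Longrightarrow> bdry_sq \<phi> \<le> ennreal I \<Longrightarrow>
    norm (LINT x|lebesgue_on \<Omega>. bdot (cgrad e x) (cgrad \<phi> x)) \<le> C * (\<epsilon> + I / \<epsilon>)"
proof -
  obtain C where C: "C \<ge> 0" and est: "\<And>(\<psi> :: real^'n \<Rightarrow> complex) i \<epsilon> I. smooth_on UNIV \<psi> \<Longrightarrow> 0 < \<epsilon> \<Longrightarrow> 0 \<le> I \<Longrightarrow>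
      bdry_sq \<psi> \<le> ennreal I \<Longrightarrow> norm (LINT x|lebesgue_on \<Omega>. partial i \<psi> x) \<le> C * (\<epsilon> + I / \<epsilon>)"
    using boundary_estimate[OF dim_ge_2 open_\<Omega> bounded_\<Omega> smooth_boundary_\<Omega>] by auto
  have "\<exists>B. \<forall>x\<in>frontier \<Omega>. norm (partial i e x) \<le> B" for i
    using continuous_on_bounded_on[OF smooth_on_continuous[OF smooth_on_partial[OF e]] compact_imp_bounded[OF compact_frontier_bounded[OF bounded_\<Omega>]]] by metis
  then obtain B where B: "\<And>i x. x \<in> frontier \<Omega> \<Longrightarrow> norm (partial i e x) \<le> B i" by metis
  define M where "M = (\<Sum>i\<in>UNIV. \<bar>B i\<bar>)"
  have M: "norm (partial i e x) \<le> M" if "x \<in> frontier \<Omega>" for x i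
  proof -
    have "norm (partial i e x) \<le> \<bar>B i\<bar>" using B[OF that, of i] by simp
    also have "\<dots> \<le> M" unfolding M_def by (rule member_le_sum) auto
    finally show ?thesis .
  qed
  have M0: "0 \<le> M" unfolding M_def by (intro sum_nonneg) simp
  show ?thesis
  proof (rule that[of "real CARD('n) * (C * (1 + M\<^sup>2))"])
    show "0 \<le> real CARD('n) * (C * (1 + M\<^sup>2))" using C by simp
    fix \<phi> :: "real^'n \<Rightarrow> complex" and \<epsilon> I :: real
    assume \<phi>: "smooth_on UNIV \<phi>" and \<epsilon>: "0 < \<epsilon>" and I: "0 \<le> I" "bdry_sq \<phi> \<le> ennreal I"
    define \<psi> where "\<psi> = (\<lambda>i x. \<phi> x * partial i e x)"
    have s\<psi>: "smooth_on UNIV (\<psi> i)" for i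
      unfolding \<psi>_def by (intro smooth_on_mult smooth_on_partial \<phi> e open_UNIV)
    have D\<psi>: "partial i (\<psi> i) x = \<phi> x * partial i (partial i e) x + partial i \<phi> x * partial i e x" for i x
      unfolding \<psi>_def
      by (rule partial_mult) (use smooth_on_differentiable[OF \<phi>] smooth_on_differentiable[OF smooth_on_partial[OF e]] in auto)
    have "bdot (cgrad e x) (cgrad \<phi> x) = (\<Sum>i\<in>UNIV. partial i (\<psi> i) x)" for x
    proof -
      have "(\<Sum>i\<in>UNIV. partial i (\<psi> i) x) = \<phi> x * (\<Sum>i\<in>UNIV. partial i (partial i e) x) + (\<Sum>i\<in>UNIV. partial i \<phi> x * partial i e x)"
        by (simp add: D\<psi> sum.distrib sum_distrib_left)
      then show ?thesis by (simp add: harm bdot_def cgrad_def mult.commute)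
    qed
    then have "(LINT x|lebesgue_on \<Omega>. bdot (cgrad e x) (cgrad \<phi> x)) = (\<Sum>i\<in>UNIV. LINT x|lebesgue_on \<Omega>. partial i (\<psi> i) x)"
      by (simp only:) (intro Bochner_Integration.integral_sum L2_integrable L2_continuous smooth_on_continuous smooth_on_partial s\<psi>)
    then have "norm (LINT x|lebesgue_on \<Omega>. bdot (cgrad e x) (cgrad \<phi> x)) \<le> (\<Sum>i\<in>UNIV. norm (LINT x|lebesgue_on \<Omega>. partial i (\<psi> i) x))"
      by (simp only: norm_sum)
    also have "\<dots> \<le> (\<Sum>i\<in>(UNIV :: 'n set). C * (\<epsilon> + (M\<^sup>2 * I) / \<epsilon>))"
    proof (rule sum_mono)
      fix i
      have "bdry_sq (\<psi> i) \<le> (\<integral>\<^sup>+ x. ennreal (M\<^sup>2) * ennreal ((norm (\<phi> x))\<^sup>2) \<partial>surface_measure \<Omega>)"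
      proof (rule nn_integral_mono)
        fix x assume "x \<in> space (surface_measure \<Omega>)"
        then have x: "x \<in> frontier \<Omega>" by (simp add: surface_measure_def space_restrict_space)
        have "(norm (partial i e x))\<^sup>2 \<le> M\<^sup>2" by (rule power_mono[OF M[OF x]]) simp
        then have "(norm (partial i e x))\<^sup>2 * (norm (\<phi> x))\<^sup>2 \<le> M\<^sup>2 * (norm (\<phi> x))\<^sup>2" by (rule mult_right_mono) simp
        then have "(norm (\<psi> i x))\<^sup>2 \<le> M\<^sup>2 * (norm (\<phi> x))\<^sup>2"
          by (simp add: \<psi>_def norm_mult power_mult_distrib mult.commute)
        then have "ennreal ((norm (\<psi> i x))\<^sup>2) \<le> ennreal (M\<^sup>2 * (norm (\<phi> x))\<^sup>2)" by (rule ennreal_leI)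
        then show "ennreal ((norm (\<psi> i x))\<^sup>2) \<le> ennreal (M\<^sup>2) * ennreal ((norm (\<phi> x))\<^sup>2)" by (simp add: ennreal_mult')
      qed
      also have "\<dots> = ennreal (M\<^sup>2) * bdry_sq \<phi>"
        by (rule nn_integral_cmult) (use borel_measurable_surface_measure[OF smooth_on_continuous[OF \<phi>]] in measurable)
      also have "\<dots> \<le> ennreal (M\<^sup>2) * ennreal I" by (rule mult_left_mono[OF I(2)]) simp
      also have "\<dots> = ennreal (M\<^sup>2 * I)" by (rule ennreal_mult'[symmetric]) (use I in simp)
      finally show "norm (LINT x|lebesgue_on \<Omega>. partial i (\<psi> i) x) \<le> C * (\<epsilon> + (M\<^sup>2 * I) / \<epsilon>)"
        by (intro est[OF s\<psi> \<epsilon>]) (use I in auto)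
    qed
    also have "\<dots> = real CARD('n) * (C * (\<epsilon> + M\<^sup>2 * (I / \<epsilon>)))" by simp
    also have "\<dots> \<le> real CARD('n) * (C * ((1 + M\<^sup>2) * (\<epsilon> + I / \<epsilon>)))"
    proof -
      have "\<epsilon> + M\<^sup>2 * (I / \<epsilon>) \<le> (1 + M\<^sup>2) * (\<epsilon> + I / \<epsilon>)"
        using \<epsilon> I(1) by (simp add: algebra_simps add_nonneg_nonneg)
      then show ?thesis using C by (intro mult_left_mono) auto
    qed
    finally show "norm (LINT x|lebesgue_on \<Omega>. bdot (cgrad e x) (cgrad \<phi> x)) \<le> real CARD('n) * (C * (1 + M\<^sup>2)) * (\<epsilon> + I / \<epsilon>)"
      by (simp only: mult.assoc)
  qed
qed

lemma energy_gradient_le: "(LINT x|lebesgue_on \<Omega>. (norm (wgrad \<Omega> u x))\<^sup>2) \<le> energy u"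
  unfolding energy_def by (simp add: Bochner_Integration.integral_nonneg)

text \<open>Smooth approximants of \<open>v\<close> have boundary values tending to 0 in
  \<open>L2\<close>, so the integrals of their gradients against that of \<open>e\<close> become
  small; convergence in energy carries this over to \<open>v\<close>.\<close>

lemma harmonic_weak:
  assumes e: "smooth_on UNIV e" and harm: "\<And>x. (\<Sum>i\<in>UNIV. partial i (partial i e) x) = 0"
    and v: "has_trace \<Omega> v (\<lambda>_. 0)"
  shows "(LINT x|lebesgue_on \<Omega>. bdot (cgrad e x) (wgrad \<Omega> v x)) = 0"
proof -
  obtain \<phi> where \<phi>: "\<And>n. smooth_on UNIV (\<phi> n)" "(\<lambda>n. energy (\<lambda>x. \<phi> n x - v x)) \<longlonglongrightarrow> 0"
    "(\<lambda>n. bdry_sq (\<lambda>x. \<phi> n x - 0)) \<longlonglongrightarrow> 0" using has_trace_sequence[OF v] by blast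
  note vH = has_traceD(1)[OF v]
  obtain C where C: "C \<ge> 0" "\<And>\<phi> \<epsilon> I. smooth_on UNIV \<phi> \<Longrightarrow> 0 < \<epsilon> \<Longrightarrow> 0 \<le> I \<Longrightarrow> bdry_sq \<phi> \<le> ennreal I \<Longrightarrow>
    norm (LINT x|lebesgue_on \<Omega>. bdot (cgrad e x) (cgrad \<phi> x)) \<le> C * (\<epsilon> + I / \<epsilon>)"
    using integral_divergence_le[OF e harm] by blast
  have ce: "continuous_on UNIV (cgrad e)" by (rule continuous_on_cgrad[OF e])
  have eL2: "cgrad e \<in> L2 \<Omega>" by (rule L2_continuous[OF ce])
  obtain M where M: "M \<ge> 0" "\<And>x. x \<in> \<Omega> \<Longrightarrow> norm (cgrad e x) \<le> M"
    using continuous_on_bounded_on[OF ce bounded_\<Omega>] by blast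
  obtain K where K: "K > 0" "\<And>a b :: complex^'n. norm (bdot a b) \<le> norm a * norm b * K"
    using bounded_bilinear.pos_bounded[OF bounded_bilinear_bdot] by blast
  let ?J = "LINT x|lebesgue_on \<Omega>. bdot (cgrad e x) (wgrad \<Omega> v x)"
  define V where "V = measure lebesgue \<Omega>"
  have V0: "0 \<le> V" by (simp add: V_def)
  have bound: "norm ?J \<le> (2 * C + M * K * (V + 1)) * \<epsilon>" if \<epsilon>: "0 < \<epsilon>" for \<epsilon>
  proof -
    \<comment> \<open>With \<open>I = \<epsilon>\<^sup>2\<close> the boundary estimate becomes
      \<open>2 * C * \<epsilon>\<close>. The same threshold for the energy makes the gradient error
      of order \<epsilon> too.\<close>
    have "\<forall>\<^sub>F n in sequentially. bdry_sq (\<lambda>x. \<phi> n x - 0) < ennreal (\<epsilon>\<^sup>2)"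
      by (rule order_tendstoD(2)[OF \<phi>(3)]) (use \<epsilon> in simp)
    moreover have "\<forall>\<^sub>F n in sequentially. energy (\<lambda>x. \<phi> n x - v x) < \<epsilon>\<^sup>2"
      by (rule order_tendstoD(2)[OF \<phi>(2)]) (use \<epsilon> in simp)
    ultimately have "\<forall>\<^sub>F n in sequentially. bdry_sq (\<lambda>x. \<phi> n x - 0) < ennreal (\<epsilon>\<^sup>2) \<and> energy (\<lambda>x. \<phi> n x - v x) < \<epsilon>\<^sup>2"
      by (rule eventually_conj)
    then obtain n where n: "bdry_sq (\<lambda>x. \<phi> n x - 0) < ennreal (\<epsilon>\<^sup>2)" "energy (\<lambda>x. \<phi> n x - v x) < \<epsilon>\<^sup>2"
      by (auto simp: eventually_sequentially)
    note \<phi>H = H1_smooth[OF \<phi>(1)[of n]]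
    note dH = H1_diff[OF \<phi>H(1) vH]
    let ?w = "wgrad \<Omega> (\<lambda>x. \<phi> n x - v x)"
    have wL2: "?w \<in> L2 \<Omega>" by (rule H1D(2)[OF dH(1)])
    have a: "norm (LINT x|lebesgue_on \<Omega>. bdot (cgrad e x) (cgrad (\<phi> n) x)) \<le> C * (\<epsilon> + \<epsilon>\<^sup>2 / \<epsilon>)"
      by (rule C(2)[OF \<phi>(1) \<epsilon>]) (use n(1) in auto)
    have g\<phi>: "cgrad (\<phi> n) \<in> L2 \<Omega>" by (rule L2_continuous[OF continuous_on_cgrad[OF \<phi>(1)]])
    have i1: "integrable (lebesgue_on \<Omega>) (\<lambda>x. bdot (cgrad e x) (cgrad (\<phi> n) x))"
      and i2: "integrable (lebesgue_on \<Omega>) (\<lambda>x. bdot (cgrad e x) (?w x))"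
      and i3: "integrable (lebesgue_on \<Omega>) (\<lambda>x. bdot (cgrad e x) (wgrad \<Omega> v x))"
      by (rule L2_integrable_bilinear[OF bounded_bilinear_bdot eL2]; fact g\<phi> wL2 H1D(2)[OF vH])+
    \<comment> \<open>The gradient of \<open>v\<close> is that of the approximant minus that of the
      error. The first is handled by the boundary estimate, the second by the energy.\<close>
    have "?J = (LINT x|lebesgue_on \<Omega>. bdot (cgrad e x) (cgrad (\<phi> n) x) - bdot (cgrad e x) (?w x))"
    proof (rule integral_cong_AE)
      show "AE x in lebesgue_on \<Omega>. bdot (cgrad e x) (wgrad \<Omega> v x) = bdot (cgrad e x) (cgrad (\<phi> n) x) - bdot (cgrad e x) (?w x)"
        using dH(2) \<phi>H(2)
      proof eventually_elim
        case (elim x)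
        then have "wgrad \<Omega> v x = cgrad (\<phi> n) x - ?w x" by simp
        then show ?case by (simp add: bounded_bilinear.diff_right[OF bounded_bilinear_bdot])
      qed
    qed (use i1 i2 i3 in auto)
    also have "\<dots> = (LINT x|lebesgue_on \<Omega>. bdot (cgrad e x) (cgrad (\<phi> n) x)) - (LINT x|lebesgue_on \<Omega>. bdot (cgrad e x) (?w x))"
      by (rule Bochner_Integration.integral_diff[OF i1 i2])
    finally have J: "norm ?J \<le> norm (LINT x|lebesgue_on \<Omega>. bdot (cgrad e x) (cgrad (\<phi> n) x))
        + norm (LINT x|lebesgue_on \<Omega>. bdot (cgrad e x) (?w x))"
      by (simp only: norm_triangle_ineq4)
    have ic: "integrable (lebesgue_on \<Omega>) (\<lambda>x. \<epsilon> / 2)"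
      by (rule integrable_lebesgue_on_continuous[OF _ bounded_\<Omega> sets_\<Omega>]) (intro continuous_intros)
    have "norm (LINT x|lebesgue_on \<Omega>. bdot (cgrad e x) (?w x)) \<le> (LINT x|lebesgue_on \<Omega>. norm (bdot (cgrad e x) (?w x)))"
      by (rule integral_norm_bound)
    also have "\<dots> \<le> (LINT x|lebesgue_on \<Omega>. M * K * (\<epsilon> / 2 + (norm (?w x))\<^sup>2 / (2 * \<epsilon>)))"
    proof (rule integral_mono[OF integrable_norm[OF i2]])
      show "integrable (lebesgue_on \<Omega>) (\<lambda>x. M * K * (\<epsilon> / 2 + (norm (?w x))\<^sup>2 / (2 * \<epsilon>)))"
        using ic L2D(2)[OF wL2] by simp
      fix x assume "x \<in> space (lebesgue_on \<Omega>)"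
      then have x: "x \<in> \<Omega>" by simp
      have "norm (bdot (cgrad e x) (?w x)) \<le> norm (cgrad e x) * norm (?w x) * K" by (rule K(2))
      also have "\<dots> \<le> M * norm (?w x) * K" using M(2)[OF x] K(1) by (intro mult_right_mono) auto
      also have "\<dots> = M * K * norm (?w x)" by simp
      also have "\<dots> \<le> M * K * (\<epsilon> / 2 + (norm (?w x))\<^sup>2 / (2 * \<epsilon>))"
        using M(1) K(1) by (intro mult_left_mono le_eps_plus_square_div[OF \<epsilon>]) auto
      finally show "norm (bdot (cgrad e x) (?w x)) \<le> M * K * (\<epsilon> / 2 + (norm (?w x))\<^sup>2 / (2 * \<epsilon>))" .
    qed
    also have "\<dots> = M * K * (\<epsilon> / 2 * V + (LINT x|lebesgue_on \<Omega>. (norm (?w x))\<^sup>2) / (2 * \<epsilon>))"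
      using ic L2D(2)[OF wL2] sets_\<Omega> by (simp add: V_def measure_restrict_space)
    also have "\<dots> \<le> M * K * (\<epsilon> / 2 * V + \<epsilon>\<^sup>2 / (2 * \<epsilon>))"
      using M(1) K(1) \<epsilon> energy_gradient_le[of "\<lambda>x. \<phi> n x - v x"] n(2)
      by (intro mult_left_mono add_left_mono divide_right_mono) auto
    also have "\<dots> \<le> M * K * (V + 1) * \<epsilon>"
    proof -
      have "\<epsilon> / 2 * V + \<epsilon>\<^sup>2 / (2 * \<epsilon>) \<le> (V + 1) * \<epsilon>"
        using \<epsilon> mult_nonneg_nonneg[OF V0 less_imp_le[OF \<epsilon>]] by (simp add: power2_eq_square algebra_simps)
      then have "M * K * (\<epsilon> / 2 * V + \<epsilon>\<^sup>2 / (2 * \<epsilon>)) \<le> M * K * ((V + 1) * \<epsilon>)"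
        using M(1) K(1) by (intro mult_left_mono) auto
      then show ?thesis by (simp only: mult.assoc)
    qed
    finally have b: "norm (LINT x|lebesgue_on \<Omega>. bdot (cgrad e x) (?w x)) \<le> M * K * (V + 1) * \<epsilon>" .
    have "C * (\<epsilon> + \<epsilon>\<^sup>2 / \<epsilon>) = 2 * C * \<epsilon>" using \<epsilon> by (simp add: power2_eq_square)
    with a b J show ?thesis by (simp add: distrib_right)
  qed
  have "norm ?J \<le> 0"
  proof (rule field_le_epsilon)
    fix d :: real assume d: "0 < d"
    \<comment> \<open>Dividing by \<open>c + 1\<close> below keeps the denominator positive when
      \<open>c\<close> is 0.\<close>
    define c where "c = 2 * C + M * K * (V + 1)"
    have c: "0 \<le> c" unfolding c_def using C(1) M(1) K(1) V0 by simp
    have "norm ?J \<le> c * (d / (c + 1))" using bound[of "d / (c + 1)"] c d by (simp add: c_def)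
    also have "\<dots> \<le> d" using c d by (simp add: field_simps)
    finally show "norm ?J \<le> 0 + d" by simp
  qed
  then show ?thesis by simp
qed

section \<open>Weak solutions with isotropic boundary data in view\<close>

lemma integrable_wgrad_product:
  assumes "u \<in> H1 \<Omega>" "v \<in> H1 \<Omega>"
  shows "integrable (lebesgue_on \<Omega>) (\<lambda>x. bdot (wgrad \<Omega> u x) (wgrad \<Omega> v x))"
  by (rule L2_integrable_bilinear[OF bounded_bilinear_bdot H1D(2)[OF assms(1)] H1D(2)[OF assms(2)]])

lemma weak_solution_harmonic:
  assumes e: "smooth_on UNIV e" and harm: "\<And>x. (\<Sum>i\<in>UNIV. partial i (partial i e) x) = 0"
  shows "weak_solution \<Omega> (\<lambda>_. 1) e e"
  unfolding weak_solution_def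
proof (intro conjI allI impI)
  show "e \<in> H1 \<Omega>" by (rule H1_smooth(1)[OF e])
  show "has_trace \<Omega> e e" by (rule has_trace_smooth[OF e])
  fix v assume v: "has_trace \<Omega> v (\<lambda>_. 0)"
  have "(LINT x|lebesgue_on \<Omega>. bdot (wgrad \<Omega> e x) (wgrad \<Omega> v x)) = (LINT x|lebesgue_on \<Omega>. bdot (cgrad e x) (wgrad \<Omega> v x))"
  proof (rule integral_cong_AE)
    show "AE x in lebesgue_on \<Omega>. bdot (wgrad \<Omega> e x) (wgrad \<Omega> v x) = bdot (cgrad e x) (wgrad \<Omega> v x)"
      using H1_smooth(2)[OF e] by (rule eventually_mono) simp
    show "(\<lambda>x. bdot (wgrad \<Omega> e x) (wgrad \<Omega> v x)) \<in> borel_measurable (lebesgue_on \<Omega>)"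
      using integrable_wgrad_product[OF H1_smooth(1)[OF e] has_traceD(1)[OF v]] by (rule borel_measurable_integrable)
    show "(\<lambda>x. bdot (cgrad e x) (wgrad \<Omega> v x)) \<in> borel_measurable (lebesgue_on \<Omega>)"
      using L2_integrable_bilinear[OF bounded_bilinear_bdot L2_continuous[OF continuous_on_cgrad[OF e]] H1D(2)[OF has_traceD(1)[OF v]]]
      by (rule borel_measurable_integrable)
  qed
  then show "(LINT x|lebesgue_on \<Omega>. complex_of_real 1 * bdot (wgrad \<Omega> e x) (wgrad \<Omega> v x)) = 0"
    using harmonic_weak[OF e harm v] by simp
qed

text \<open>Testing both equations with the conjugate of the difference \<open>w\<close> shows that
  the integral of the squared norm of its gradient is 0. Agreement of the gradients is enough,
  because \<open>dPhi1_Linf\<close> and \<open>dPhi1_E\<close> see solutions only through their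
  gradients.\<close>

lemma weak_solution_unique:
  assumes u: "weak_solution \<Omega> (\<lambda>_. 1) f u" and v: "weak_solution \<Omega> (\<lambda>_. 1) f v"
  shows "AE x in lebesgue_on \<Omega>. wgrad \<Omega> u x = wgrad \<Omega> v x"
proof -
  have uH: "u \<in> H1 \<Omega>" and ut: "has_trace \<Omega> u f" and vH: "v \<in> H1 \<Omega>" and vt: "has_trace \<Omega> v f"
    using u v by (auto simp: weak_solution_def)
  define w where "w = (\<lambda>x. u x - v x)"
  have wH: "w \<in> H1 \<Omega>" and dw: "AE x in lebesgue_on \<Omega>. wgrad \<Omega> w x = wgrad \<Omega> u x - wgrad \<Omega> v x"
    unfolding w_def by (rule H1_diff[OF uH vH])+
  have wt: "has_trace \<Omega> w (\<lambda>_. 0)" using has_trace_diff[OF ut vt] by (simp add: w_def)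
  define z where "z = (\<lambda>x. cnj (w x))"
  have zt: "has_trace \<Omega> z (\<lambda>_. 0)" using has_trace_cnj[OF wt] by (simp add: z_def)
  have zH: "z \<in> H1 \<Omega>" and dz: "AE x in lebesgue_on \<Omega>. wgrad \<Omega> z x = cnj_vec (wgrad \<Omega> w x)"
    unfolding z_def by (rule H1_cnj[OF wH])+
  have "(LINT x|lebesgue_on \<Omega>. bdot (wgrad \<Omega> u x) (wgrad \<Omega> z x)) = 0"
    "(LINT x|lebesgue_on \<Omega>. bdot (wgrad \<Omega> v x) (wgrad \<Omega> z x)) = 0"
    using u v zt unfolding weak_solution_def by auto
  then have "(LINT x|lebesgue_on \<Omega>. bdot (wgrad \<Omega> u x) (wgrad \<Omega> z x) - bdot (wgrad \<Omega> v x) (wgrad \<Omega> z x)) = 0"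
    using integrable_wgrad_product[OF uH zH] integrable_wgrad_product[OF vH zH] by simp
  also have "(LINT x|lebesgue_on \<Omega>. bdot (wgrad \<Omega> u x) (wgrad \<Omega> z x) - bdot (wgrad \<Omega> v x) (wgrad \<Omega> z x))
      = (LINT x|lebesgue_on \<Omega>. complex_of_real ((norm (wgrad \<Omega> w x))\<^sup>2))"
  proof (rule integral_cong_AE)
    show "AE x in lebesgue_on \<Omega>. bdot (wgrad \<Omega> u x) (wgrad \<Omega> z x) - bdot (wgrad \<Omega> v x) (wgrad \<Omega> z x)
        = complex_of_real ((norm (wgrad \<Omega> w x))\<^sup>2)"
      using dw dz
    proof eventually_elim
      case (elim x)
      then show ?case
        by (simp only: bounded_bilinear.diff_left[OF bounded_bilinear_bdot, symmetric] bdot_cnj_vec elim(1)[symmetric])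
    qed
    show "(\<lambda>x. bdot (wgrad \<Omega> u x) (wgrad \<Omega> z x) - bdot (wgrad \<Omega> v x) (wgrad \<Omega> z x)) \<in> borel_measurable (lebesgue_on \<Omega>)"
      using integrable_wgrad_product[OF uH zH] integrable_wgrad_product[OF vH zH] by auto
    show "(\<lambda>x. complex_of_real ((norm (wgrad \<Omega> w x))\<^sup>2)) \<in> borel_measurable (lebesgue_on \<Omega>)"
      using L2D(1)[OF H1D(2)[OF wH]] by measurable
  qed
  finally have "(LINT x|lebesgue_on \<Omega>. (norm (wgrad \<Omega> w x))\<^sup>2) = 0"
    unfolding integral_complex_of_real by simp
  then have "AE x in lebesgue_on \<Omega>. (norm (wgrad \<Omega> w x))\<^sup>2 = 0"
    using integral_nonneg_eq_0_iff_AE[OF L2D(2)[OF H1D(2)[OF wH]]] by simp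
  with dw show ?thesis by eventually_elim simp
qed

text \<open>The function \<open>e\<close> solves its own boundary value problem, so the predicate
  behind \<open>sol\<close> has a witness, and uniqueness of the gradient identifies the chosen
  solution with it.\<close>

lemma sol_harmonic:
  assumes e: "smooth_on UNIV e" and harm: "\<And>x. (\<Sum>i\<in>UNIV. partial i (partial i e) x) = 0"
  shows "AE x in lebesgue_on \<Omega>. wgrad \<Omega> (sol \<Omega> (\<lambda>_. 1) e) x = cgrad e x"
proof -
  have s: "weak_solution \<Omega> (\<lambda>_. 1) e (sol \<Omega> (\<lambda>_. 1) e)"
    unfolding sol_def by (rule someI[where P="weak_solution \<Omega> (\<lambda>_. 1) e", OF weak_solution_harmonic[OF e harm]])
  show ?thesis
    using weak_solution_unique[OF s weak_solution_harmonic[OF e harm]] H1_smooth(2)[OF e]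
    by eventually_elim simp
qed

text \<open>Distributions see point values, so almost everywhere equality has to be upgraded. Both
  gradients are continuous in \<Omega>, the set where they differ is open and null, and an open null
  set is empty.\<close>

lemma harmonic_sol_gradient:
  assumes e: "smooth_on UNIV e" and harm: "\<And>x. (\<Sum>i\<in>UNIV. partial i (partial i e) x) = 0" and x: "x \<in> \<Omega>"
  shows "cgrad (harmonic_sol \<Omega> e) x = cgrad e x"
proof -
  let ?u = "harmonic_sol \<Omega> e"
  have "weak_solution \<Omega> (\<lambda>_. 1) e e \<and> smooth_on \<Omega> e"
    using weak_solution_harmonic[OF e harm] smooth_on_subset[OF e] by auto
  from someI[of "\<lambda>u. weak_solution \<Omega> (\<lambda>_. 1) e u \<and> smooth_on \<Omega> u", OF this]
  have s: "weak_solution \<Omega> (\<lambda>_. 1) e ?u" and sm: "smooth_on \<Omega> ?u" by (auto simp: harmonic_sol_def)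
  have uH: "?u \<in> H1 \<Omega>" using s by (simp add: weak_solution_def)
  have "AE x in lebesgue_on \<Omega>. cgrad ?u x = cgrad e x"
    using weak_solution_unique[OF s weak_solution_harmonic[OF e harm]] H1_smooth(2)[OF e] wgrad_smooth_on[OF sm uH]
    by eventually_elim simp
  then have ae: "AE x in lebesgue. x \<in> \<Omega> \<longrightarrow> cgrad ?u x = cgrad e x"
    using sets_\<Omega> by (simp add: AE_restrict_space_iff)
  define N where "N = {x \<in> \<Omega>. cgrad ?u x \<noteq> cgrad e x}"
  have "open N"
  proof -
    have c: "continuous_on \<Omega> (\<lambda>x. cgrad ?u x - cgrad e x)"
      by (intro continuous_on_diff continuous_on_cgrad[OF sm] continuous_on_cgrad smooth_on_subset[OF e]) auto
    have "N = \<Omega> \<inter> (\<lambda>x. cgrad ?u x - cgrad e x) -` (- {0})" by (auto simp: N_def)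
    then show ?thesis using continuous_on_open_vimage[OF open_\<Omega>, of "\<lambda>x. cgrad ?u x - cgrad e x"] c by (metis open_Compl closed_singleton Int_commute)
  qed
  moreover have "negligible N"
  proof -
    have "AE x in lebesgue. x \<notin> N" using ae by (rule eventually_mono) (auto simp: N_def)
    then show ?thesis using \<open>open N\<close> by (simp add: AE_iff_null_sets negligible_iff_null_sets)
  qed
  ultimately have "N = {}" using open_not_negligible by blast
  then show ?thesis using x by (auto simp: N_def)
qed

end

section \<open>Compactly supported distributions\<close>

lemma distribution_lincomb:
  assumes "S \<in> E_prime \<Omega>" "\<phi> \<in> test_fun \<Omega>" "\<psi> \<in> test_fun \<Omega>"
  shows "S (\<lambda>x. a * \<phi> x + b * \<psi> x) = a * S \<phi> + b * S \<psi>"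
  using assms unfolding E_prime_def distribution_on_def by blast

lemma distribution_diff:
  assumes "S \<in> E_prime \<Omega>" "\<phi> \<in> test_fun \<Omega>" "\<psi> \<in> test_fun \<Omega>"
  shows "S (\<lambda>x. \<phi> x - \<psi> x) = S \<phi> - S \<psi>"
  using distribution_lincomb[OF assms, of 1 "-1"] by simp

definition carries :: "(real^'n::finite) set \<Rightarrow> (real^'n) set \<Rightarrow> ((real^'n \<Rightarrow> complex) \<Rightarrow> complex) \<Rightarrow> bool" where
  "carries \<Omega> K S \<longleftrightarrow> compact K \<and> K \<subseteq> \<Omega> \<and> (\<forall>\<phi>\<in>test_fun \<Omega>. supp \<phi> \<inter> K = {} \<longrightarrow> S \<phi> = 0)"

lemma E_prime_carries:
  assumes "S \<in> E_prime \<Omega>" obtains K where "carries \<Omega> K S"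
  using assms unfolding E_prime_def carries_def by blast

text \<open>The value 1 is asked for on a neighbourhood and not only on \<open>K\<close>: the
  support of \<open>\<kappa> x * \<phi> x - \<phi> x\<close> is a closure, and it must miss
  \<open>K\<close>.\<close>

definition cutoff_near :: "(real^'n::finite) set \<Rightarrow> (real^'n) set \<Rightarrow> (real^'n \<Rightarrow> complex) \<Rightarrow> bool" where
  "cutoff_near \<Omega> K \<kappa> \<longleftrightarrow> \<kappa> \<in> test_fun \<Omega> \<and> (\<exists>V. open V \<and> K \<subseteq> V \<and> (\<forall>x\<in>V. \<kappa> x = 1))"

lemma cutoff_near_exists:
  assumes "compact K" "open \<Omega>" "K \<subseteq> \<Omega>" obtains \<kappa> where "cutoff_near \<Omega> K \<kappa>"
  using test_fun_cutoff_exists[OF assms] unfolding cutoff_near_def by metis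

lemma cutoff_near_mono: "cutoff_near \<Omega> K \<kappa> \<Longrightarrow> L \<subseteq> K \<Longrightarrow> cutoff_near \<Omega> L \<kappa>"
  unfolding cutoff_near_def by blast

lemma cutoff_near_absorb:
  assumes S: "S \<in> E_prime \<Omega>" and K: "carries \<Omega> K S" and \<kappa>: "cutoff_near \<Omega> K \<kappa>" and \<Omega>: "open \<Omega>"
    and \<phi>: "\<phi> \<in> test_fun \<Omega>"
  shows "S (\<lambda>x. \<kappa> x * \<phi> x) = S \<phi>"
proof -
  obtain V where V: "open V" "K \<subseteq> V" "\<And>x. x \<in> V \<Longrightarrow> \<kappa> x = 1" and \<kappa>t: "\<kappa> \<in> test_fun \<Omega>"
    using \<kappa> by (auto simp: cutoff_near_def)
  have \<kappa>\<phi>: "(\<lambda>x. \<kappa> x * \<phi> x) \<in> test_fun \<Omega>"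
    by (rule test_fun_mult(1)[OF \<Omega> smooth_on_subset[OF test_funD(1)[OF \<kappa>t]] \<phi>]) simp
  have d: "(\<lambda>x. \<kappa> x * \<phi> x - \<phi> x) \<in> test_fun \<Omega>"
    using test_fun_lincomb[OF \<kappa>\<phi> \<phi>, of 1 "-1"] by simp
  have "supp (\<lambda>x. \<kappa> x * \<phi> x - \<phi> x) \<subseteq> - V"
    unfolding supp_def by (rule closure_minimal) (use V in \<open>auto simp: closed_Compl\<close>)
  then have "S (\<lambda>x. \<kappa> x * \<phi> x - \<phi> x) = 0"
    using K d V(2) unfolding carries_def by blast
  then show ?thesis using distribution_diff[OF S \<kappa>\<phi> \<phi>] by simp
qed

lemma cutoff_spec:
  assumes S: "S \<in> E_prime \<Omega>" and \<Omega>: "open \<Omega>"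
  shows "cutoff \<Omega> S \<in> test_fun \<Omega>" "\<phi> \<in> test_fun \<Omega> \<Longrightarrow> S (\<lambda>x. cutoff \<Omega> S x * \<phi> x) = S \<phi>"
proof -
  obtain K where K: "carries \<Omega> K S" using E_prime_carries[OF S] .
  then have cK: "compact K" "K \<subseteq> \<Omega>" by (auto simp: carries_def)
  obtain \<kappa> where \<kappa>: "cutoff_near \<Omega> K \<kappa>" using cutoff_near_exists[OF cK(1) \<Omega> cK(2)] .
  have "\<exists>\<kappa>. \<kappa> \<in> test_fun \<Omega> \<and> (\<forall>\<phi>\<in>test_fun \<Omega>. S (\<lambda>x. \<kappa> x * \<phi> x) = S \<phi>)"
    using cutoff_near_absorb[OF S K \<kappa> \<Omega>] \<kappa> unfolding cutoff_near_def by blast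
  from someI_ex[OF this] show "cutoff \<Omega> S \<in> test_fun \<Omega>" "\<phi> \<in> test_fun \<Omega> \<Longrightarrow> S (\<lambda>x. cutoff \<Omega> S x * \<phi> x) = S \<phi>"
    unfolding cutoff_def by auto
qed

lemma E_pair_test_fun: "S \<in> E_prime \<Omega> \<Longrightarrow> open \<Omega> \<Longrightarrow> \<phi> \<in> test_fun \<Omega> \<Longrightarrow> E_pair \<Omega> S \<phi> = S \<phi>"
  unfolding E_pair_def by (rule cutoff_spec(2))

lemma test_fun_mult': "open S \<Longrightarrow> smooth_on S u \<Longrightarrow> \<phi> \<in> test_fun S \<Longrightarrow> (\<lambda>x. \<phi> x * u x) \<in> test_fun S"
  using test_fun_mult(1)[of S u \<phi>] by (simp add: mult.commute)

text \<open>Cutoffs commute: \<kappa> is inserted in front of the chosen \<open>cutoff\<close>,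
  which is then absorbed in turn. The pairing can thus be computed with one cutoff common to several
  distributions.\<close>

lemma E_pair_cutoff_near:
  assumes S: "S \<in> E_prime \<Omega>" and \<Omega>: "open \<Omega>" and K: "carries \<Omega> K S" and \<kappa>: "cutoff_near \<Omega> K \<kappa>"
    and \<phi>: "smooth_on \<Omega> \<phi>"
  shows "E_pair \<Omega> S \<phi> = S (\<lambda>x. \<kappa> x * \<phi> x)"
proof -
  note c = cutoff_spec[OF S \<Omega>]
  have \<kappa>t: "\<kappa> \<in> test_fun \<Omega>" using \<kappa> by (simp add: cutoff_near_def)
  have "E_pair \<Omega> S \<phi> = S (\<lambda>x. \<kappa> x * (cutoff \<Omega> S x * \<phi> x))"
    unfolding E_pair_def
    by (rule cutoff_near_absorb[OF S K \<kappa> \<Omega> test_fun_mult'[OF \<Omega> \<phi> c(1)], symmetric])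
  also have "(\<lambda>x. \<kappa> x * (cutoff \<Omega> S x * \<phi> x)) = (\<lambda>x. cutoff \<Omega> S x * (\<kappa> x * \<phi> x))" by (simp add: mult_ac)
  also have "S \<dots> = S (\<lambda>x. \<kappa> x * \<phi> x)" by (rule c(2)[OF test_fun_mult'[OF \<Omega> \<phi> \<kappa>t]])
  finally show ?thesis .
qed

text \<open>The cutoff vanishes outside \<Omega>. This is how a harmonic solution, whose gradient is
  known only inside \<Omega>, is exchanged for an exponential.\<close>

lemma E_pair_cong:
  assumes S: "S \<in> E_prime \<Omega>" and \<Omega>: "open \<Omega>" and eq: "\<And>x. x \<in> \<Omega> \<Longrightarrow> \<phi> x = \<psi> x"
  shows "E_pair \<Omega> S \<phi> = E_pair \<Omega> S \<psi>"
proof -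
  have "cutoff \<Omega> S x * \<phi> x = cutoff \<Omega> S x * \<psi> x" for x
    using eq test_funD(3,4)[OF cutoff_spec(1)[OF S \<Omega>]] by (cases "x \<in> \<Omega>") auto
  then have "(\<lambda>x. cutoff \<Omega> S x * \<phi> x) = (\<lambda>x. cutoff \<Omega> S x * \<psi> x)" by (rule ext)
  then show ?thesis by (simp only: E_pair_def)
qed

lemma E_pair_lincomb:
  assumes S: "S \<in> E_prime \<Omega>" and \<Omega>: "open \<Omega>" and \<phi>: "smooth_on \<Omega> \<phi>" and \<psi>: "smooth_on \<Omega> \<psi>"
  shows "E_pair \<Omega> S (\<lambda>x. a * \<phi> x + b * \<psi> x) = a * E_pair \<Omega> S \<phi> + b * E_pair \<Omega> S \<psi>"
proof -
  note c = cutoff_spec(1)[OF S \<Omega>]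
  have "(\<lambda>x. cutoff \<Omega> S x * (a * \<phi> x + b * \<psi> x)) = (\<lambda>x. a * (cutoff \<Omega> S x * \<phi> x) + b * (cutoff \<Omega> S x * \<psi> x))"
    by (simp add: algebra_simps)
  then show ?thesis unfolding E_pair_def
    using distribution_lincomb[OF S test_fun_mult'[OF \<Omega> \<phi> c] test_fun_mult'[OF \<Omega> \<psi> c]] by simp
qed

section \<open>Seminorm bounds for distributions with compact support\<close>

lemma partials_add:
  assumes "smooth_on UNIV f" "smooth_on UNIV g"
  shows "partials is (\<lambda>x. f x + g x) = (\<lambda>x. partials is f x + partials is g x)"
proof (induction "is")
  case (Cons i "is")
  have "partial i (\<lambda>x. partials is f x + partials is g x) x = partial i (partials is f) x + partial i (partials is g) x" for x
    by (rule partial_add) (use assms smooth_on_partials smooth_on_differentiable in blast)+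
  then show ?case using Cons by auto
qed simp

lemma partials_linear:
  assumes "smooth_on UNIV f" "bounded_linear B"
  shows "partials is (\<lambda>x. B (f x)) = (\<lambda>x. B (partials is f x))"
proof (induction "is")
  case (Cons i "is")
  have "partial i (\<lambda>x. B (partials is f x)) x = B (partial i (partials is f) x)" for x
    by (rule partial_linear[OF assms(2)]) (use assms smooth_on_partials smooth_on_differentiable in blast)
  then show ?case using Cons by auto
qed simp

lemma partials_diff:
  assumes "smooth_on UNIV f" "smooth_on UNIV g"
  shows "partials is (\<lambda>x. f x - g x) = (\<lambda>x. partials is f x - partials is g x)"
  using partials_add[OF assms(1) smooth_on_minus[OF open_UNIV assms(2)], of "is"]
    partials_linear[OF assms(2) bounded_linear_minus[OF bounded_linear_ident], of "is"] by simp

text \<open>Induction on the order for all cutoffs at once, since the product rule replaces \<kappa>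
  by \<open>partial i \<kappa>\<close>. Bounds for \<phi> on \<Omega> suffice because \<kappa> and
  its derivatives vanish elsewhere.\<close>

lemma leibniz_bound:
  assumes "\<kappa> \<in> test_fun \<Omega>"
  shows "\<exists>A\<ge>0. \<forall>\<phi> M. smooth_on UNIV \<phi> \<longrightarrow> (\<forall>is. length is \<le> N \<longrightarrow> (\<forall>x\<in>\<Omega>. norm (partials is \<phi> x) \<le> M)) \<longrightarrow> 0 \<le> M \<longrightarrow>
     (\<forall>is. length is \<le> N \<longrightarrow> (\<forall>x. norm (partials is (\<lambda>x. \<kappa> x * \<phi> x) x) \<le> A * M))"
  using assms
proof (induction N arbitrary: \<kappa>)
  case 0
  obtain B where B: "\<And>x. norm (\<kappa> x) \<le> B" using test_fun_bounded[OF 0] by blast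
  have B0: "0 \<le> B" using order.trans[OF norm_ge_zero B] .
  show ?case
  proof (intro exI[of _ B] conjI allI impI B0)
    fix \<phi> :: "real^'a \<Rightarrow> complex" and M :: real and "is" :: "'a list" and x
    assume h: "\<forall>is. length is \<le> 0 \<longrightarrow> (\<forall>x\<in>\<Omega>. norm (partials is \<phi> x) \<le> M)" "0 \<le> M" "length is \<le> 0"
    have "norm (\<kappa> x * \<phi> x) \<le> B * M"
    proof (cases "x \<in> \<Omega>")
      case True
      then have "norm (\<phi> x) \<le> M" using h(1)[rule_format, of "[]" x] by simp
      then show ?thesis using B[of x] B0 by (simp add: norm_mult mult_mono)
    next
      case False
      then have "\<kappa> x = 0" using test_funD(3,4)[OF 0] by blast
      then show ?thesis using B0 h(2) by simp
    qed
    then show "norm (partials is (\<lambda>x. \<kappa> x * \<phi> x) x) \<le> B * M" using h(3) by simp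
  qed
next
  case (Suc N)
  obtain B where B: "\<And>x. norm (\<kappa> x) \<le> B" using test_fun_bounded[OF Suc.prems] by blast
  have B0: "0 \<le> B" using order.trans[OF norm_ge_zero B] .
  \<comment> \<open>The claim at order \<open>N\<close> for one cutoff and one constant; it is used
    for \<kappa> and for each of its partial derivatives.\<close>
  define P where "P = (\<lambda>(\<kappa> :: real^'a \<Rightarrow> complex) A. 0 \<le> A \<and> (\<forall>\<phi> M. smooth_on UNIV \<phi> \<longrightarrow> (\<forall>is. length is \<le> N \<longrightarrow> (\<forall>x\<in>\<Omega>. norm (partials is \<phi> x) \<le> M)) \<longrightarrow> 0 \<le> M \<longrightarrow>
     (\<forall>is. length is \<le> N \<longrightarrow> (\<forall>x. norm (partials is (\<lambda>x. \<kappa> x * \<phi> x) x) \<le> A * M))))"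
  have ex: "\<exists>A. P \<kappa> A" if "\<kappa> \<in> test_fun \<Omega>" for \<kappa> unfolding P_def by (rule Suc.IH[OF that])
  obtain A where A: "P \<kappa> A" using ex[OF Suc.prems] by blast
  have "\<forall>i. \<exists>A. P (partial i \<kappa>) A" using ex[OF test_fun_partial[OF Suc.prems]] by blast
  then obtain D where D: "\<And>i. P (partial i \<kappa>) (D i)" by metis
  have A0: "0 \<le> A" using A by (simp add: P_def)
  have D0: "0 \<le> D i" for i using D[of i] by (simp add: P_def)
  define E where "E = B + A + (\<Sum>i\<in>UNIV. D i)"
  have Ds: "D i \<le> (\<Sum>i\<in>UNIV. D i)" for i by (rule member_le_sum) (use D0 in auto)
  have E0: "0 \<le> E" unfolding E_def using B0 A0 D0 by (intro add_nonneg_nonneg sum_nonneg) auto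
  show ?case
  proof (intro exI[of _ E] conjI allI impI E0)
    fix \<phi> :: "real^'a \<Rightarrow> complex" and M :: real and "is" :: "'a list" and x
    assume \<phi>: "smooth_on UNIV \<phi>" and h: "\<forall>is. length is \<le> Suc N \<longrightarrow> (\<forall>x\<in>\<Omega>. norm (partials is \<phi> x) \<le> M)"
      and M: "0 \<le> M" and l: "length is \<le> Suc N"
    note s\<kappa> = test_funD(1)[OF Suc.prems]
    show "norm (partials is (\<lambda>x. \<kappa> x * \<phi> x) x) \<le> E * M"
    \<comment> \<open>The last index of the list is the derivative taken first, so splitting at the
      end exposes the product rule on \<open>\<kappa> x * \<phi> x\<close> itself.\<close>
    proof (cases "is" rule: rev_cases)
      case Nil
      have "norm (\<kappa> x * \<phi> x) \<le> B * M"
      proof (cases "x \<in> \<Omega>")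
        case True
        then have "norm (\<phi> x) \<le> M" using h[rule_format, of "[]" x] by simp
        then show ?thesis using B[of x] B0 by (simp add: norm_mult mult_mono)
      next
        case False
        then have "\<kappa> x = 0" using test_funD(3,4)[OF Suc.prems] by blast
        then show ?thesis using B0 M by simp
      qed
      also have "\<dots> \<le> E * M" unfolding E_def using A0 D0 M
        by (intro mult_right_mono) (auto intro!: add_nonneg_nonneg sum_nonneg)
      finally show ?thesis using Nil by simp
    next
      case (snoc js i)
      have lj: "length js \<le> N" using l snoc by simp
      have "partial i (\<lambda>x. \<kappa> x * \<phi> x) = (\<lambda>x. \<kappa> x * partial i \<phi> x + partial i \<kappa> x * \<phi> x)"
        by (rule ext, rule partial_mult) (use s\<kappa> \<phi> smooth_on_differentiable in auto)
      then have "partials is (\<lambda>x. \<kappa> x * \<phi> x) x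
          = partials js (\<lambda>x. \<kappa> x * partial i \<phi> x) x + partials js (\<lambda>x. partial i \<kappa> x * \<phi> x) x"
        unfolding snoc partials_snoc
        using partials_add[of "\<lambda>x. \<kappa> x * partial i \<phi> x" "\<lambda>x. partial i \<kappa> x * \<phi> x" js]
        by (simp add: smooth_on_mult smooth_on_partial s\<kappa> \<phi>)
      then have "norm (partials is (\<lambda>x. \<kappa> x * \<phi> x) x)
          \<le> norm (partials js (\<lambda>x. \<kappa> x * partial i \<phi> x) x) + norm (partials js (\<lambda>x. partial i \<kappa> x * \<phi> x) x)"
        by (simp only: norm_triangle_ineq)
      also have "\<dots> \<le> A * M + D i * M"
      proof (rule add_mono)
        have "norm (partials js' (partial i \<phi>) x) \<le> M" if "length js' \<le> N" "x \<in> \<Omega>" for js' x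
          using h[rule_format, of "js' @ [i]" x] that by (simp add: partials_snoc)
        then show "norm (partials js (\<lambda>x. \<kappa> x * partial i \<phi> x) x) \<le> A * M"
          using A smooth_on_partial[OF \<phi>, of i] M lj unfolding P_def by blast
        have "norm (partials js' \<phi> x) \<le> M" if "length js' \<le> N" "x \<in> \<Omega>" for js' x
          using h[rule_format, of js' x] that by simp
        then show "norm (partials js (\<lambda>x. partial i \<kappa> x * \<phi> x) x) \<le> D i * M"
          using D[of i] \<phi> M lj unfolding P_def by blast
      qed
      also have "\<dots> = (A + D i) * M" by (simp add: distrib_right)
      also have "\<dots> \<le> E * M" unfolding E_def using B0 Ds[of i] M by (intro mult_right_mono) auto
      finally show ?thesis .
    qed
  qed
qed

text \<open>Products with the chosen cutoff have their supports in one compact set, so a single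
  seminorm estimate of \<open>S\<close> covers them all, and the Leibniz bound transfers it from the
  product to \<phi>.\<close>

lemma E_pair_bound:
  assumes S: "S \<in> E_prime \<Omega>" and \<Omega>: "open \<Omega>"
  shows "\<exists>C N. \<forall>\<phi> M. smooth_on UNIV \<phi> \<longrightarrow> (\<forall>is. length is \<le> N \<longrightarrow> (\<forall>x\<in>\<Omega>. norm (partials is \<phi> x) \<le> M)) \<longrightarrow> 0 \<le> M \<longrightarrow>
    norm (E_pair \<Omega> S \<phi>) \<le> C * M"
proof -
  let ?\<kappa> = "cutoff \<Omega> S"
  note c = cutoff_spec(1)[OF S \<Omega>]
  have K: "compact (supp ?\<kappa>)" "supp ?\<kappa> \<subseteq> \<Omega>" using test_funD[OF c] by auto
  have "distribution_on \<Omega> S" using S by (simp add: E_prime_def)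
  then have "\<exists>C N. \<forall>\<phi>\<in>test_fun \<Omega>. supp \<phi> \<subseteq> supp ?\<kappa> \<longrightarrow>
           (\<forall>M. (\<forall>is x. length is \<le> N \<longrightarrow> norm (partials is \<phi> x) \<le> M) \<longrightarrow> norm (S \<phi>) \<le> C * M)"
    using K unfolding distribution_on_def by blast
  then obtain C N where C: "\<And>\<phi> M. \<phi> \<in> test_fun \<Omega> \<Longrightarrow> supp \<phi> \<subseteq> supp ?\<kappa> \<Longrightarrow>
      (\<forall>is x. length is \<le> N \<longrightarrow> norm (partials is \<phi> x) \<le> M) \<Longrightarrow> norm (S \<phi>) \<le> C * M" by blast
  obtain A where A: "A \<ge> 0" "\<And>\<phi> M is x. smooth_on UNIV \<phi> \<Longrightarrow> (\<forall>is. length is \<le> N \<longrightarrow> (\<forall>x\<in>\<Omega>. norm (partials is \<phi> x) \<le> M)) \<Longrightarrow> 0 \<le> M \<Longrightarrow>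
     length is \<le> N \<Longrightarrow> norm (partials is (\<lambda>x. ?\<kappa> x * \<phi> x) x) \<le> A * M"
    using leibniz_bound[OF c, of N] by auto
  have "norm (E_pair \<Omega> S \<phi>) \<le> (C * A) * M"
    if \<phi>: "smooth_on UNIV \<phi>" and h: "\<forall>is. length is \<le> N \<longrightarrow> (\<forall>x\<in>\<Omega>. norm (partials is \<phi> x) \<le> M)" "0 \<le> M" for \<phi> M
  proof -
    have s: "smooth_on \<Omega> \<phi>" by (rule smooth_on_subset[OF \<phi>]) simp
    have "norm (S (\<lambda>x. ?\<kappa> x * \<phi> x)) \<le> C * (A * M)"
    proof (rule C)
      show "(\<lambda>x. ?\<kappa> x * \<phi> x) \<in> test_fun \<Omega>" by (rule test_fun_mult'[OF \<Omega> s c])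
      show "supp (\<lambda>x. ?\<kappa> x * \<phi> x) \<subseteq> supp ?\<kappa>"
        using test_fun_mult(2)[OF \<Omega> s c] by (simp add: mult.commute)
      show "\<forall>is x. length is \<le> N \<longrightarrow> norm (partials is (\<lambda>x. ?\<kappa> x * \<phi> x) x) \<le> A * M"
        using A(2)[OF \<phi> h] by blast
    qed
    then show ?thesis by (simp add: E_pair_def mult.assoc)
  qed
  then show ?thesis by blast
qed

context bounded_open
begin

text \<open>Extends a decomposed distribution to smooth functions that need not vanish near the
  boundary. The values of \<open>fourier\<close>, and those of \<open>dPhi1\<close> at isotropic
  exponentials up to a factor, are values of this functional.\<close>

definition pairing :: "(real^'n \<Rightarrow> complex) \<times> ((real^'n \<Rightarrow> complex) \<Rightarrow> complex) \<Rightarrow> (real^'n \<Rightarrow> complex) \<Rightarrow> complex" where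
  "pairing D \<phi> = (LINT x|lebesgue_on \<Omega>. fst D x * \<phi> x) + E_pair \<Omega> (snd D) \<phi>"

lemma decompositionD:
  assumes "decomposition V \<Omega> T D"
  shows "fst D \<in> V" "snd D \<in> E_prime \<Omega>"
    "\<And>\<phi>. \<phi> \<in> test_fun \<Omega> \<Longrightarrow> T \<phi> = (LINT x|lebesgue_on \<Omega>. fst D x * \<phi> x) + snd D \<phi>"
  using assms by (auto simp: decomposition_def split: prod.splits)

lemma pairing_test_fun:
  "decomposition V \<Omega> T D \<Longrightarrow> \<phi> \<in> test_fun \<Omega> \<Longrightarrow> pairing D \<phi> = T \<phi>"
  using decompositionD[of V T D] E_pair_test_fun[OF _ open_\<Omega>, of "snd D" \<phi>] by (simp add: pairing_def)

lemma Linf_subset_L1: "Linf \<Omega> \<subseteq> L1 \<Omega>"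
proof
  fix F :: "real^'n \<Rightarrow> complex" assume "F \<in> Linf \<Omega>"
  then obtain C where "F \<in> borel_measurable (lebesgue_on \<Omega>)" "AE x in lebesgue_on \<Omega>. norm (F x) \<le> C"
    by (auto simp: Linf_def)
  then show "F \<in> L1 \<Omega>" unfolding L1_def
    using finite_measure.integrable_const_bound[OF finite_measure_lebesgue_on[OF lmeasurable_\<Omega>]] by auto
qed

lemma L1_mult_bounded:
  assumes "F \<in> L1 \<Omega>" "continuous_on UNIV \<phi>"
  shows "integrable (lebesgue_on \<Omega>) (\<lambda>x. F x * \<phi> x)"
proof -
  have F: "integrable (lebesgue_on \<Omega>) F" using assms(1) by (simp add: L1_def)
  obtain B where B: "\<And>x. x \<in> \<Omega> \<Longrightarrow> norm (\<phi> x) \<le> B" "B \<ge> 0"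
    using continuous_on_bounded_on[OF assms(2) bounded_\<Omega>] by blast
  show ?thesis
  proof (rule Bochner_Integration.integrable_bound)
    show "integrable (lebesgue_on \<Omega>) (\<lambda>x. F x * complex_of_real B)" using F by simp
    show "(\<lambda>x. F x * \<phi> x) \<in> borel_measurable (lebesgue_on \<Omega>)"
      using borel_measurable_integrable[OF F] borel_measurable_lebesgue_on_continuous[OF assms(2) sets_\<Omega>] by measurable
    show "AE x in lebesgue_on \<Omega>. norm (F x * \<phi> x) \<le> norm (F x * complex_of_real B)"
      by (rule AE_I2) (use B in \<open>auto simp: norm_mult intro!: mult_left_mono\<close>)
  qed
qed

lemma pairing_lincomb:
  assumes D: "fst D \<in> L1 \<Omega>" "snd D \<in> E_prime \<Omega>" and \<phi>: "smooth_on UNIV \<phi>" and \<psi>: "smooth_on UNIV \<psi>"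
  shows "pairing D (\<lambda>x. a * \<phi> x + b * \<psi> x) = a * pairing D \<phi> + b * pairing D \<psi>"
proof -
  note i1 = L1_mult_bounded[OF D(1) smooth_on_continuous[OF \<phi>]] and i2 = L1_mult_bounded[OF D(1) smooth_on_continuous[OF \<psi>]]
  have "(LINT x|lebesgue_on \<Omega>. fst D x * (a * \<phi> x + b * \<psi> x))
      = (LINT x|lebesgue_on \<Omega>. a * (fst D x * \<phi> x) + b * (fst D x * \<psi> x))"
    by (simp add: algebra_simps)
  also have "\<dots> = a * (LINT x|lebesgue_on \<Omega>. fst D x * \<phi> x) + b * (LINT x|lebesgue_on \<Omega>. fst D x * \<psi> x)"
    using i1 i2 by simp
  finally show ?thesis
    using E_pair_lincomb[OF D(2) open_\<Omega> smooth_on_subset[OF \<phi>] smooth_on_subset[OF \<psi>], of a b]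
    by (simp add: pairing_def algebra_simps)
qed

lemma pairing_bound:
  assumes D: "fst D \<in> L1 \<Omega>" "snd D \<in> E_prime \<Omega>"
  shows "\<exists>C N. \<forall>\<phi> M. smooth_on UNIV \<phi> \<longrightarrow> (\<forall>is. length is \<le> N \<longrightarrow> (\<forall>x\<in>\<Omega>. norm (partials is \<phi> x) \<le> M)) \<longrightarrow> 0 \<le> M \<longrightarrow>
    norm (pairing D \<phi>) \<le> C * M"
proof -
  obtain C N where C: "\<And>\<phi> M. smooth_on UNIV \<phi> \<Longrightarrow> (\<forall>is. length is \<le> N \<longrightarrow> (\<forall>x\<in>\<Omega>. norm (partials is \<phi> x) \<le> M)) \<Longrightarrow> 0 \<le> M \<Longrightarrow>
    norm (E_pair \<Omega> (snd D) \<phi>) \<le> C * M" using E_pair_bound[OF D(2) open_\<Omega>] by blast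
  have F: "integrable (lebesgue_on \<Omega>) (fst D)" using D(1) by (simp add: L1_def)
  define B where "B = (LINT x|lebesgue_on \<Omega>. norm (fst D x))"
  have "norm (pairing D \<phi>) \<le> (B + C) * M"
    if \<phi>: "smooth_on UNIV \<phi>" and h: "\<forall>is. length is \<le> N \<longrightarrow> (\<forall>x\<in>\<Omega>. norm (partials is \<phi> x) \<le> M)" "0 \<le> M" for \<phi> M
  proof -
    have p: "norm (\<phi> x) \<le> M" if "x \<in> \<Omega>" for x using h(1)[rule_format, of "[]" x] that by simp
    have "norm (LINT x|lebesgue_on \<Omega>. fst D x * \<phi> x) \<le> (LINT x|lebesgue_on \<Omega>. norm (fst D x * \<phi> x))"
      by (rule integral_norm_bound)
    also have "\<dots> \<le> (LINT x|lebesgue_on \<Omega>. norm (fst D x) * M)"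
      by (rule integral_mono[OF integrable_norm[OF L1_mult_bounded[OF D(1) smooth_on_continuous[OF \<phi>]]]])
        (use F p in \<open>auto simp: norm_mult intro!: mult_left_mono\<close>)
    also have "\<dots> = B * M" by (simp add: B_def)
    finally have "norm (LINT x|lebesgue_on \<Omega>. fst D x * \<phi> x) \<le> B * M" .
    moreover have "norm (E_pair \<Omega> (snd D) \<phi>) \<le> C * M" by (rule C[OF \<phi> h])
    ultimately show ?thesis
      unfolding pairing_def distrib_right by (rule order.trans[OF norm_triangle_ineq add_mono])
  qed
  then show ?thesis by blast
qed

text \<open>Off the carriers of the two distributional parts the function parts agree almost everywhere, so
  \<open>\<phi>\<close> may be multiplied by a cutoff that is \<open>1\<close> near them.\<close>

lemma pairing_decomposition_unique:
  assumes D: "decomposition (L1 \<Omega>) \<Omega> T D" and D': "decomposition (L1 \<Omega>) \<Omega> T D'" and \<phi>: "smooth_on UNIV \<phi>"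
  shows "pairing D \<phi> = pairing D' \<phi>"
proof -
  obtain F S F' S' where eq: "D = (F, S)" "D' = (F', S')" by (metis surj_pair)
  have F: "F \<in> L1 \<Omega>" "F' \<in> L1 \<Omega>" and S: "S \<in> E_prime \<Omega>" "S' \<in> E_prime \<Omega>"
    and TD: "\<And>\<theta>. \<theta> \<in> test_fun \<Omega> \<Longrightarrow> (LINT x|lebesgue_on \<Omega>. F x * \<theta> x) + S \<theta> = (LINT x|lebesgue_on \<Omega>. F' x * \<theta> x) + S' \<theta>"
    using decompositionD[OF D] decompositionD[OF D'] by (auto simp: eq)
  have iF: "integrable (lebesgue_on \<Omega>) F" "integrable (lebesgue_on \<Omega>) F'" using F by (auto simp: L1_def)
  obtain K where K: "carries \<Omega> K S" using E_prime_carries[OF S(1)] .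
  obtain K' where K': "carries \<Omega> K' S'" using E_prime_carries[OF S(2)] .
  have cK: "compact (K \<union> K')" "K \<union> K' \<subseteq> \<Omega>" using K K' by (auto simp: carries_def)
  obtain \<kappa> where \<kappa>: "cutoff_near \<Omega> (K \<union> K') \<kappa>" using cutoff_near_exists[OF cK(1) open_\<Omega> cK(2)] .
  have s: "smooth_on \<Omega> \<phi>" by (rule smooth_on_subset[OF \<phi>]) simp
  have \<kappa>t: "\<kappa> \<in> test_fun \<Omega>" and \<kappa>1: "\<And>x. x \<in> K \<union> K' \<Longrightarrow> \<kappa> x = 1" using \<kappa> by (auto simp: cutoff_near_def)
  have t: "(\<lambda>x. \<kappa> x * \<phi> x) \<in> test_fun \<Omega>" by (rule test_fun_mult'[OF open_\<Omega> s \<kappa>t])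
  define U where "U = \<Omega> - (K \<union> K')"
  have oU: "open U" unfolding U_def by (intro open_Diff open_\<Omega> compact_imp_closed cK(1))
  interpret U: bounded_open U
    by unfold_locales (use oU bounded_subset[OF bounded_\<Omega>] in \<open>auto simp: U_def\<close>)
  have U\<Omega>: "U \<subseteq> \<Omega>" by (auto simp: U_def)
  have "AE x in lebesgue_on U. F x = F' x"
  proof (rule U.AE_eq_if_integral_test_fun_eq)
    show "locally_integrable U F" "locally_integrable U F'"
      by (intro U.locally_integrable_integrable integrable_lebesgue_on_subset[OF _ U.sets_\<Omega> sets_\<Omega> U\<Omega>] iF)+
    fix \<theta> assume \<theta>: "\<theta> \<in> test_fun U"
    then have \<theta>\<Omega>: "\<theta> \<in> test_fun \<Omega>" using test_fun_mono U\<Omega> by blast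
    have "supp \<theta> \<inter> K = {}" "supp \<theta> \<inter> K' = {}" using test_funD(3)[OF \<theta>] by (auto simp: U_def)
    then have "S \<theta> = 0" "S' \<theta> = 0" using K K' \<theta>\<Omega> by (auto simp: carries_def)
    then have e: "(LINT x|lebesgue_on \<Omega>. F x * \<theta> x) = (LINT x|lebesgue_on \<Omega>. F' x * \<theta> x)" using TD[OF \<theta>\<Omega>] by simp
    have r: "(LINT x|lebesgue_on \<Omega>. G x * \<theta> x) = (LINT x|lebesgue_on U. G x * \<theta> x)" for G
    proof -
      have "indicator \<Omega> x *\<^sub>R (G x * \<theta> x) = indicator U x *\<^sub>R (G x * \<theta> x)" for x
        using test_funD(3,4)[OF \<theta>] U\<Omega> by (auto simp: indicator_def)
      then have "(\<lambda>x. indicator \<Omega> x *\<^sub>R (G x * \<theta> x)) = (\<lambda>x. indicator U x *\<^sub>R (G x * \<theta> x))" by (rule ext)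
      moreover have "(LINT x|lebesgue_on \<Omega>. G x * \<theta> x) = (LINT x|lebesgue. indicator \<Omega> x *\<^sub>R (G x * \<theta> x))"
        by (rule integral_restrict_space) (use sets_\<Omega> in simp)
      moreover have "(LINT x|lebesgue_on U. G x * \<theta> x) = (LINT x|lebesgue. indicator U x *\<^sub>R (G x * \<theta> x))"
        by (rule integral_restrict_space) (use U.sets_\<Omega> in simp)
      ultimately show ?thesis by (simp only:)
    qed
    show "(LINT x|lebesgue_on U. F x * \<theta> x) = (LINT x|lebesgue_on U. F' x * \<theta> x)"
      using e unfolding r .
  qed
  then have ae: "AE x in lebesgue. x \<in> U \<longrightarrow> F x = F' x"
    using U.sets_\<Omega> by (simp add: AE_restrict_space_iff)
  note c\<phi> = smooth_on_continuous[OF \<phi>] and c\<kappa> = smooth_on_continuous[OF test_funD(1)[OF t]]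
  \<comment> \<open>Off the carriers the function parts cancel almost everywhere, and on the
    carriers \<kappa> is 1; so inserting \<kappa> does not change the difference.\<close>
  have "(LINT x|lebesgue_on \<Omega>. F x * \<phi> x - F' x * \<phi> x)
      = (LINT x|lebesgue_on \<Omega>. F x * (\<kappa> x * \<phi> x) - F' x * (\<kappa> x * \<phi> x))"
  proof (rule integral_cong_AE)
    have "AE x in lebesgue. x \<in> \<Omega> \<longrightarrow> F x * \<phi> x - F' x * \<phi> x = F x * (\<kappa> x * \<phi> x) - F' x * (\<kappa> x * \<phi> x)"
      using ae by (rule eventually_mono) (use \<kappa>1 in \<open>auto simp: U_def\<close>)
    then show "AE x in lebesgue_on \<Omega>. F x * \<phi> x - F' x * \<phi> x = F x * (\<kappa> x * \<phi> x) - F' x * (\<kappa> x * \<phi> x)"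
      using sets_\<Omega> by (simp add: AE_restrict_space_iff)
  qed (use L1_mult_bounded[OF F(1) c\<phi>] L1_mult_bounded[OF F(2) c\<phi>] L1_mult_bounded[OF F(1) c\<kappa>] L1_mult_bounded[OF F(2) c\<kappa>] in auto)
  then have e1: "(LINT x|lebesgue_on \<Omega>. F x * \<phi> x) - (LINT x|lebesgue_on \<Omega>. F' x * \<phi> x)
      = (LINT x|lebesgue_on \<Omega>. F x * (\<kappa> x * \<phi> x)) - (LINT x|lebesgue_on \<Omega>. F' x * (\<kappa> x * \<phi> x))"
    using L1_mult_bounded[OF F(1) c\<phi>] L1_mult_bounded[OF F(2) c\<phi>] L1_mult_bounded[OF F(1) c\<kappa>] L1_mult_bounded[OF F(2) c\<kappa>]
    by simp
  have e2: "E_pair \<Omega> S \<phi> = S (\<lambda>x. \<kappa> x * \<phi> x)"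
    by (rule E_pair_cutoff_near[OF S(1) open_\<Omega> K cutoff_near_mono[OF \<kappa>] s]) simp
  have e3: "E_pair \<Omega> S' \<phi> = S' (\<lambda>x. \<kappa> x * \<phi> x)"
    by (rule E_pair_cutoff_near[OF S(2) open_\<Omega> K' cutoff_near_mono[OF \<kappa>] s]) simp
  have alg: "a - a' = b - b' \<Longrightarrow> b + s = b' + s' \<Longrightarrow> a + s = a' + s'" for a a' b b' s s' :: complex
    by algebra
  show ?thesis
    unfolding pairing_def eq fst_conv snd_conv e2 e3 by (rule alg[OF e1 TD[OF t]])
qed

lemma decomposition_L1: "decomposition (Linf \<Omega>) \<Omega> T D \<Longrightarrow> decomposition (L1 \<Omega>) \<Omega> T D"
  using Linf_subset_L1 by (auto simp: decomposition_def split: prod.splits)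

lemma bdot_imaginary: "bdot (- \<i> *s cvec \<xi>) (cvec x) = - \<i> * complex_of_real (x \<bullet> \<xi>)"
  by (simp add: bdot_def cvec_def inner_vec_def sum_distrib_left mult_ac sum_negf)

text \<open>\<open>fourier\<close> chooses a decomposition with an \<open>L1\<close> part and
  \<open>dPhi1\<close> one with an \<open>Linf\<close> part. Independence of the choice allows both
  to be evaluated on the same \<open>D\<close>.\<close>

lemma fourier_eq_pairing:
  assumes D: "decomposition (L1 \<Omega>) \<Omega> T D"
  shows "fourier \<Omega> T \<xi> = pairing D (e_exp (- \<i> *s cvec \<xi>))"
proof -
  let ?e = "e_exp (- \<i> *s cvec \<xi>)"
  have e: "?e = (\<lambda>x. exp (- \<i> * complex_of_real (x \<bullet> \<xi>)))"
    unfolding e_exp_def[abs_def] bdot_imaginary ..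
  have s: "decomposition (L1 \<Omega>) \<Omega> T (SOME D. decomposition (L1 \<Omega>) \<Omega> T D)" by (rule someI[where P="decomposition (L1 \<Omega>) \<Omega> T", OF D])
  have "fourier \<Omega> T \<xi> = pairing (SOME D. decomposition (L1 \<Omega>) \<Omega> T D) ?e"
    unfolding fourier_def pairing_def fourier_L1_def fourier_E_def e Let_def case_prod_unfold
    by (simp only: mult.commute)
  also have "\<dots> = pairing D ?e"
    by (rule pairing_decomposition_unique[OF s D smooth_on_e_exp[OF open_UNIV]])
  finally show ?thesis .
qed

end

section \<open>Trigonometric approximation\<close>

definition wave :: "real^'n::finite \<Rightarrow> real^'n \<Rightarrow> complex" where
  "wave \<xi> = e_exp (- \<i> *s cvec \<xi>)"

lemma smooth_on_wave: "open S \<Longrightarrow> smooth_on S (wave \<xi>)"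
  unfolding wave_def by (rule smooth_on_e_exp)

lemma partial_wave: "partial i (wave \<xi>) = (\<lambda>x. - \<i> * complex_of_real (\<xi> $ i) * wave \<xi> x)"
  unfolding wave_def partial_e_exp by (simp add: cvec_def)

lemma wave_eq: "wave \<xi> x = exp (- \<i> * complex_of_real (x \<bullet> \<xi>))"
  by (simp add: wave_def e_exp_def bdot_def cvec_def inner_vec_def sum_distrib_left mult_ac sum_negf)

text \<open>Generated by binary combinations, so that identities linear in the function extend from
  waves by rule induction.\<close>

inductive trig :: "(real^'n::finite) set \<Rightarrow> (real^'n \<Rightarrow> complex) \<Rightarrow> bool" for W where
  wave: "\<xi> \<in> W \<Longrightarrow> trig W (wave \<xi>)"
| lincomb: "trig W f \<Longrightarrow> trig W g \<Longrightarrow> trig W (\<lambda>x. a * f x + b * g x)"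

lemma trig_cmult: "trig W f \<Longrightarrow> trig W (\<lambda>x. a * f x)"
  using trig.lincomb[of W f f a 0] by simp

lemma smooth_on_trig: "trig W f \<Longrightarrow> smooth_on UNIV f"
  by (induction rule: trig.induct) (auto intro!: smooth_on_wave smooth_on_add smooth_on_mult smooth_on_const)

lemma wave_add: "wave (\<xi> + \<zeta>) x = wave \<xi> x * wave \<zeta> x"
  by (simp add: wave_eq inner_add_right exp_add[symmetric] algebra_simps)

lemma wave_diff_arg: "wave \<xi> (x - y) = wave \<xi> x * wave (- \<xi>) y"
  by (simp add: wave_eq inner_diff_left exp_add[symmetric] algebra_simps)

lemma norm_wave: "norm (wave \<xi> x) = 1"
  by (simp add: wave_eq norm_exp_eq_Re)

lemma cos_wave: "complex_of_real (cos (c * z $ j)) = (wave (c *\<^sub>R axis j 1) z + wave (- c *\<^sub>R axis j 1) z) / 2"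
proof -
  have "wave (t *\<^sub>R axis j 1) z = exp (- \<i> * complex_of_real (t * z $ j))" for t
    by (simp add: wave_eq inner_axis)
  note w = this
  show ?thesis unfolding w by (simp add: cos_of_real[symmetric] cos_exp_eq add.commute)
qed

text \<open>The lattice of spacing \<open>c\<close> displaced by \<open>c / 2\<close> in each
  coordinate. It is stable under the axis shifts by \<open>c\<close> that multiplication with
  \<open>cos (c * z $ j)\<close> produces, and for nonzero \<open>c\<close> it misses 0 because an
  odd integer is not 0.\<close>

definition shifted_lattice :: "real \<Rightarrow> (real^'n::finite) set" where
  "shifted_lattice c = {\<xi>. \<forall>j. \<exists>a::int. \<xi> $ j = c * (of_int a + 1 / 2)}"

lemma shifted_lattice_nonzero:
  assumes "c \<noteq> 0" "\<xi> \<in> shifted_lattice c" shows "\<xi> \<noteq> 0"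
proof
  assume "\<xi> = 0"
  then obtain a :: int where "0 = c * (of_int a + 1 / 2)" using assms(2) by (auto simp: shifted_lattice_def)
  then have "2 * of_int a + 1 = (0::real)" using assms(1) by auto
  then have "real_of_int (2 * a + 1) = 0" by simp
  then have "2 * a + 1 = 0" by (simp only: of_int_eq_0_iff)
  then show False by presburger
qed

lemma shifted_lattice_add:
  assumes "\<xi> \<in> shifted_lattice c"
  shows "\<xi> + c *\<^sub>R axis j 1 \<in> shifted_lattice c" "\<xi> + - c *\<^sub>R axis j 1 \<in> shifted_lattice c"
proof -
  have *: "\<xi> + (c * of_int s) *\<^sub>R axis j 1 \<in> shifted_lattice c" for s :: int
    unfolding shifted_lattice_def
  proof (intro CollectI allI)
    fix l
    obtain a :: int where a: "\<xi> $ l = c * (of_int a + 1 / 2)" using assms by (auto simp: shifted_lattice_def)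
    show "\<exists>b::int. (\<xi> + (c * of_int s) *\<^sub>R axis j 1) $ l = c * (of_int b + 1 / 2)"
      by (rule exI[of _ "if l = j then a + s else a"]) (simp add: a axis_def algebra_simps)
  qed
  show "\<xi> + c *\<^sub>R axis j 1 \<in> shifted_lattice c" "\<xi> + - c *\<^sub>R axis j 1 \<in> shifted_lattice c"
    using *[of 1] *[of "-1"] by simp_all
qed

lemma trig_mult_cos:
  assumes "trig (shifted_lattice c) f"
  shows "trig (shifted_lattice c) (\<lambda>z. complex_of_real (cos (c * z $ j)) * f z)"
  using assms
proof (induction rule: trig.induct)
  case (wave \<xi>)
  have "(\<lambda>z. complex_of_real (cos (c * z $ j)) * wave \<xi> z)
      = (\<lambda>z. 1 / 2 * wave (\<xi> + c *\<^sub>R axis j 1) z + 1 / 2 * wave (\<xi> + - c *\<^sub>R axis j 1) z)"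
    unfolding cos_wave wave_add by (simp add: fun_eq_iff algebra_simps)
  then show ?case
    using trig.lincomb[OF trig.wave[OF shifted_lattice_add(1)[OF wave, of j]] trig.wave[OF shifted_lattice_add(2)[OF wave, of j]], of "1/2" "1/2"]
    by simp
next
  case (lincomb f g a b)
  have "(\<lambda>z. complex_of_real (cos (c * z $ j)) * (a * f z + b * g z))
      = (\<lambda>z. a * (complex_of_real (cos (c * z $ j)) * f z) + b * (complex_of_real (cos (c * z $ j)) * g z))"
    by (simp add: fun_eq_iff algebra_simps)
  then show ?case using trig.lincomb[OF lincomb.IH, of a b] by simp
qed

lemma trig_sum:
  assumes "finite A" "A \<noteq> {}" "\<And>j. j \<in> A \<Longrightarrow> trig W (f j)"
  shows "trig W (\<lambda>x. \<Sum>j\<in>A. f j x)"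
  using assms
proof (induction rule: finite_ne_induct)
  case (insert j A)
  then show ?case using trig.lincomb[of W "f j" "\<lambda>x. \<Sum>j\<in>A. f j x" 1 1] by simp
qed simp

text \<open>The average of the cosines is 1 at the origin and strictly smaller at other points with
  \<bar>c\<bar> times \<open>norm z\<close> at most 1 (for nonzero \<open>c\<close>), where it is
  still positive. Being a sum of cosines, it acts on trigonometric sums through
  \<open>trig_mult_cos\<close>.\<close>

definition bump_kernel :: "real \<Rightarrow> real^'n::finite \<Rightarrow> real" where
  "bump_kernel c z = (\<Sum>j\<in>UNIV. cos (c * z $ j)) / real CARD('n)"

text \<open>The powers alone have frequencies in the unshifted lattice, which contains 0; the factor
  of frequency \<open>c / 2\<close> in each coordinate moves all of them off it.\<close>

lemma trig_bump_kernel_power: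
  "trig (shifted_lattice c) (\<lambda>z :: real^'n::finite. complex_of_real (bump_kernel c z ^ m) * wave (\<chi> j. c / 2) z)"
proof (induction m)
  case 0
  have "(\<chi> j. c / 2) \<in> shifted_lattice c" by (auto simp: shifted_lattice_def intro!: exI[of _ 0])
  then show ?case using trig.wave by fastforce
next
  case (Suc m)
  let ?f = "\<lambda>z :: real^'n. complex_of_real (bump_kernel c z ^ m) * wave (\<chi> j. c / 2) z"
  have "trig (shifted_lattice c) (\<lambda>z. 1 / of_nat CARD('n) * (\<Sum>j\<in>UNIV. complex_of_real (cos (c * z $ j)) * ?f z))"
    by (intro trig_cmult trig_sum trig_mult_cos Suc) auto
  moreover have "1 / of_nat CARD('n) * (\<Sum>j\<in>UNIV. complex_of_real (cos (c * z $ j)) * ?f z)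
      = complex_of_real (bump_kernel c z ^ Suc m) * wave (\<chi> j. c / 2) z" for z :: "real^'n"
    by (simp add: bump_kernel_def sum_distrib_right[symmetric])
  ultimately show ?case by simp
qed

lemma continuous_bump_kernel: "continuous_on UNIV (bump_kernel c)"
  unfolding bump_kernel_def[abs_def] by (intro continuous_intros) auto

lemma bump_kernel_minus: "bump_kernel c (- z) = bump_kernel c z"
  by (simp add: bump_kernel_def)

lemma bump_kernel_0: "bump_kernel c 0 = 1"
  by (simp add: bump_kernel_def)

lemma bump_kernel_bounds:
  fixes z :: "real^'n::finite"
  assumes "\<bar>c\<bar> * norm z \<le> 1"
  shows "0 < bump_kernel c z" "bump_kernel c z \<le> 1" "c \<noteq> 0 \<Longrightarrow> z \<noteq> 0 \<Longrightarrow> bump_kernel c z < 1"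
proof -
  have a: "\<bar>c * z $ j\<bar> \<le> 1" for j
  proof -
    have "\<bar>c * z $ j\<bar> \<le> \<bar>c\<bar> * norm z" unfolding abs_mult by (intro mult_left_mono component_le_norm_cart) simp
    then show ?thesis using assms by linarith
  qed
  have p: "0 < cos (c * z $ j)" for j
    by (rule cos_gt_zero_pi) (use a[of j] pi_gt3 in \<open>auto simp: abs_le_iff\<close>)
  then show "0 < bump_kernel c z" unfolding bump_kernel_def by (intro divide_pos_pos sum_pos) auto
  have "(\<Sum>j\<in>UNIV. cos (c * z $ j)) \<le> (\<Sum>j\<in>(UNIV :: 'n set). 1)" by (intro sum_mono) simp
  then show "bump_kernel c z \<le> 1" unfolding bump_kernel_def by (simp add: divide_le_eq)
  assume "c \<noteq> 0" "z \<noteq> 0"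
  then obtain j where j: "z $ j \<noteq> 0" by (auto simp: vec_eq_iff)
  have "cos \<bar>c * z $ j\<bar> < cos 0"
    by (rule cos_monotone_0_pi) (use a[of j] pi_gt3 j \<open>c \<noteq> 0\<close> in auto)
  then have "cos (c * z $ j) < 1" by (simp add: cos_abs_real)
  then have "(\<Sum>j\<in>UNIV. cos (c * z $ j)) < (\<Sum>j\<in>(UNIV :: 'n set). 1)" by (intro sum_strict_mono_ex1) auto
  then show "bump_kernel c z < 1" unfolding bump_kernel_def by (simp add: divide_less_eq)
qed

text \<open>The mass of \<open>k ^ m\<close> concentrates at the strict maximum of \<open>k\<close> as \<open>m\<close> grows.\<close>

lemma power_concentration:
  fixes k :: "'a::euclidean_space \<Rightarrow> real"
  assumes k: "continuous_on UNIV k" "k 0 = 1" and \<rho>: "\<rho> > 0"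
    and k01: "\<And>z. z \<in> cball 0 \<rho> \<Longrightarrow> 0 < k z" and k1: "\<And>z. z \<in> cball 0 \<rho> \<Longrightarrow> z \<noteq> 0 \<Longrightarrow> k z < 1"
    and \<delta>: "0 < \<delta>"
  defines "c m \<equiv> (LINT z|lebesgue_on (ball 0 \<rho>). k z ^ m)"
  shows "\<And>m. 0 < c m"
    "(\<lambda>m. (LINT z|lebesgue_on (ball 0 \<rho>). indicator (- ball 0 \<delta>) z * k z ^ m) / c m) \<longlonglongrightarrow> 0"
proof -
  let ?B = "ball 0 \<rho> :: 'a set"
  have le1: "k z \<le> 1" if "z \<in> cball 0 \<rho>" for z using k1[OF that] k(2) by (cases "z = 0") auto
  have B: "?B \<in> sets lebesgue" "bounded ?B" "?B \<in> lmeasurable" by auto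
  have mi: "indicat_real A \<in> borel_measurable (lebesgue_on ?B)" if "A \<in> sets borel" for A
    by (rule measurable_restrict_space1) (use that in \<open>simp add: borel_measurable_indicator\<close>)
  have int: "integrable (lebesgue_on ?B) (\<lambda>z. k z ^ m)" for m
    by (rule integrable_lebesgue_on_continuous[OF _ B(2,1)]) (intro continuous_intros k(1))
  define Z where "Z = cball (0 :: 'a) \<rho> - ball 0 \<delta>"
  have cZ: "compact Z" unfolding Z_def Diff_eq by (rule compact_Int_closed[OF compact_cball]) (simp add: closed_Compl)
  \<comment> \<open>The kernel is at most \<open>q\<close> away from the origin and exceeds some
    \<open>r\<close> between \<open>q\<close> and 1 near it. The outer mass is then
    \<open>O(q ^ m)\<close> while the total is at least a multiple of \<open>r ^ m\<close>.\<close>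
  obtain q where q: "0 \<le> q" "q < 1" "\<And>z. z \<in> Z \<Longrightarrow> k z \<le> q"
  proof (cases "Z = {}")
    case False
    obtain z0 where z0: "z0 \<in> Z" "\<And>z. z \<in> Z \<Longrightarrow> k z \<le> k z0"
      using continuous_attains_sup[OF cZ False continuous_on_subset[OF k(1)]] by auto
    have "z0 \<in> cball 0 \<rho>" "z0 \<noteq> 0" using z0(1) \<delta> by (auto simp: Z_def)
    then show ?thesis using that[of "k z0"] z0(2) k01[of z0] k1[of z0] by auto
  qed (use that[of 0] in auto)
  define r where "r = (1 + q) / 2"
  have r: "q < r" "r < 1" "0 < r" using q by (auto simp: r_def)
  have "open {z. r < k z}" by (intro open_Collect_less continuous_on_const k(1))
  moreover have "0 \<in> {z. r < k z}" using k(2) r by simp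
  ultimately obtain \<eta>' where \<eta>': "\<eta>' > 0" "ball 0 \<eta>' \<subseteq> {z. r < k z}" using open_contains_ball by blast
  define \<eta> where "\<eta> = min \<eta>' \<rho>"
  have \<eta>: "0 < \<eta>" "ball 0 \<eta> \<subseteq> ?B" "\<And>z. z \<in> ball 0 \<eta> \<Longrightarrow> r < k z" using \<eta>' \<rho> by (auto simp: \<eta>_def)
  define v where "v = measure lebesgue (ball 0 \<eta> :: 'a set)"
  have v: "0 < v" unfolding v_def using \<eta>(1) by (simp add: content_ball_pos measure_completion)
  have low: "v * r ^ m \<le> c m" for m
  proof -
    have i1: "integrable (lebesgue_on ?B) (\<lambda>z. indicator (ball 0 \<eta>) z * r ^ m)"
      by (rule integrable_lebesgue_on_bounded[OF B(3) borel_measurable_times[OF mi borel_measurable_const], of _ "r ^ m"])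
        (use r in \<open>auto simp: indicator_def\<close>)
    have "v * r ^ m = (LINT z|lebesgue. indicator (ball (0 :: 'a) \<eta>) z *\<^sub>R r ^ m)"
      by (simp add: v_def)
    also have "\<dots> = (LINT z|lebesgue. indicator ?B z *\<^sub>R (indicator (ball 0 \<eta>) z * r ^ m))"
      by (rule Bochner_Integration.integral_cong[OF refl]) (use \<eta>(2) in \<open>auto simp: indicator_def\<close>)
    also have "\<dots> = (LINT z|lebesgue_on ?B. indicator (ball 0 \<eta>) z * r ^ m)"
      by (rule integral_restrict_space[symmetric]) simp
    also have "\<dots> \<le> c m"
      unfolding c_def
    proof (rule integral_mono[OF i1 int])
      fix z assume "z \<in> space (lebesgue_on ?B)"
      then have "0 < k z" using k01[of z] by auto
      then show "indicator (ball 0 \<eta>) z * r ^ m \<le> k z ^ m"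
      proof (cases "z \<in> ball 0 \<eta>")
        case True
        have "r ^ m \<le> k z ^ m" by (rule power_mono) (use \<eta>(3)[OF True] r in auto)
        then show ?thesis using True by simp
      qed simp
    qed
    finally show ?thesis .
  qed
  show c0: "0 < c m" for m using low[of m] v r by (meson less_le_trans mult_pos_pos zero_less_power)
  define V where "V = measure lebesgue ?B"
  have up: "(LINT z|lebesgue_on ?B. indicator (- ball 0 \<delta>) z * k z ^ m) \<le> V * q ^ m" for m
  proof -
    have m: "(\<lambda>z. indicator (- ball 0 \<delta>) z * k z ^ m) \<in> borel_measurable (lebesgue_on ?B)"
    proof (rule borel_measurable_times)
      show "(\<lambda>z. k z ^ m) \<in> borel_measurable (lebesgue_on ?B)" using int by (rule borel_measurable_integrable)
      show "indicat_real (- ball 0 \<delta>) \<in> borel_measurable (lebesgue_on ?B)"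
        by (rule mi) simp
    qed
    have pw: "\<bar>indicator (- ball 0 \<delta>) z * k z ^ m\<bar> \<le> q ^ m" if "z \<in> ?B" for z
    proof (cases "z \<in> ball 0 \<delta>")
      case False
      then have "z \<in> Z" using that by (auto simp: Z_def)
      then show ?thesis using q(3) k01[of z] that False by (auto simp: indicator_def power_mono abs_of_pos)
    qed (use q(1) in \<open>auto simp: indicator_def\<close>)
    have i1: "integrable (lebesgue_on ?B) (\<lambda>z. indicator (- ball 0 \<delta>) z * k z ^ m)"
      by (rule integrable_lebesgue_on_bounded[OF B(3) m, of "q ^ m"]) (use pw in auto)
    have i2: "integrable (lebesgue_on ?B) (\<lambda>z. q ^ m)"
      by (rule integrable_lebesgue_on_continuous[OF _ B(2,1)]) (intro continuous_intros)
    have "(LINT z|lebesgue_on ?B. indicator (- ball 0 \<delta>) z * k z ^ m) \<le> (LINT z|lebesgue_on ?B. q ^ m)"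
      by (rule integral_mono[OF i1 i2]) (use pw in \<open>force simp: abs_le_iff\<close>)
    also have "\<dots> = V * q ^ m" using B(1) by (simp add: V_def measure_restrict_space)
    finally show ?thesis .
  qed
  have low0: "0 \<le> (LINT z|lebesgue_on ?B. indicator (- ball 0 \<delta>) z * k z ^ m)" for m
  proof (rule Bochner_Integration.integral_nonneg)
    fix z assume "z \<in> space (lebesgue_on ?B)"
    then have "0 < k z" using k01[of z] by auto
    then show "0 \<le> indicator (- ball 0 \<delta>) z * k z ^ m" by simp
  qed
  show "(\<lambda>m. (LINT z|lebesgue_on ?B. indicator (- ball 0 \<delta>) z * k z ^ m) / c m) \<longlonglongrightarrow> 0"
  proof (rule tendsto_sandwich[OF _ _ tendsto_const])
    show "\<forall>\<^sub>F m in sequentially. 0 \<le> (LINT z|lebesgue_on ?B. indicator (- ball 0 \<delta>) z * k z ^ m) / c m"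
      using low0 c0 by (intro always_eventually allI divide_nonneg_pos) auto
    show "\<forall>\<^sub>F m in sequentially. (LINT z|lebesgue_on ?B. indicator (- ball 0 \<delta>) z * k z ^ m) / c m \<le> V / v * (q / r) ^ m"
    proof (intro always_eventually allI)
      fix m
      have "(LINT z|lebesgue_on ?B. indicator (- ball 0 \<delta>) z * k z ^ m) / c m \<le> (V * q ^ m) / (v * r ^ m)"
        by (rule frac_le) (use low up v r q in \<open>auto simp: V_def\<close>)
      then show "(LINT z|lebesgue_on ?B. indicator (- ball 0 \<delta>) z * k z ^ m) / c m \<le> V / v * (q / r) ^ m"
        by (simp add: power_divide)
    qed
    have "(\<lambda>m. (q / r) ^ m) \<longlonglongrightarrow> 0" by (rule LIMSEQ_realpow_zero) (use q r in auto)
    from tendsto_mult_right_zero[OF this] show "(\<lambda>m. V / v * (q / r) ^ m) \<longlonglongrightarrow> 0" .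
  qed
qed

context bounded_open
begin

definition conv :: "(real^'n \<Rightarrow> complex) \<Rightarrow> (real^'n \<Rightarrow> complex) \<Rightarrow> real^'n \<Rightarrow> complex" where
  "conv K \<phi> x = (LINT y|lebesgue_on \<Omega>. K (x - y) * \<phi> y)"

section \<open>Convolution with trigonometric kernels\<close>

lemma conv_wave: "conv (wave \<xi>) \<phi> = (\<lambda>x. (LINT y|lebesgue_on \<Omega>. wave (- \<xi>) y * \<phi> y) * wave \<xi> x)"
  by (simp add: conv_def fun_eq_iff wave_diff_arg mult.assoc)

lemma conv_lincomb:
  assumes f: "continuous_on UNIV f" and g: "continuous_on UNIV g" and \<phi>: "continuous_on UNIV \<phi>"
  shows "conv (\<lambda>x. a * f x + b * g x) \<phi> = (\<lambda>x. a * conv f \<phi> x + b * conv g \<phi> x)"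
proof
  fix x
  have i: "integrable (lebesgue_on \<Omega>) (\<lambda>y. h (x - y) * \<phi> y)" if "continuous_on UNIV h" for h
  proof (rule integrable_lebesgue_on_continuous[OF _ bounded_\<Omega> sets_\<Omega>])
    have "continuous_on UNIV (\<lambda>y. x - y)" by (intro continuous_intros)
    then have "continuous_on UNIV (\<lambda>y. h (x - y))" by (rule continuous_on_compose2[OF that]) simp
    then show "continuous_on UNIV (\<lambda>y. h (x - y) * \<phi> y)" by (intro continuous_on_mult \<phi>)
  qed
  have "conv (\<lambda>x. a * f x + b * g x) \<phi> x = (LINT y|lebesgue_on \<Omega>. a * (f (x - y) * \<phi> y) + b * (g (x - y) * \<phi> y))"
    by (simp add: conv_def algebra_simps)
  also have "\<dots> = a * conv f \<phi> x + b * conv g \<phi> x"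
    using i[OF f] i[OF g] by (simp add: conv_def)
  finally show "conv (\<lambda>x. a * f x + b * g x) \<phi> x = a * conv f \<phi> x + b * conv g \<phi> x" .
qed

text \<open>Convolving a wave with \<phi> gives a multiple of the same wave, so no new frequencies
  arise.\<close>

lemma trig_conv:
  assumes "trig W K" "continuous_on UNIV \<phi>" shows "trig W (conv K \<phi>)"
  using assms(1)
proof (induction rule: trig.induct)
  case (wave \<xi>)
  show ?case unfolding conv_wave by (rule trig_cmult[OF trig.wave[OF wave]])
next
  case (lincomb f g a b)
  show ?case
    unfolding conv_lincomb[OF smooth_on_continuous[OF smooth_on_trig[OF lincomb.hyps(1)]] smooth_on_continuous[OF smooth_on_trig[OF lincomb.hyps(2)]] assms(2)]
    by (rule trig.lincomb[OF lincomb.IH])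
qed

text \<open>Integration by parts puts the derivative on \<phi>, without a boundary term since \<phi>
  has compact support in \<Omega>. Uniform approximation of every test function therefore includes
  approximation of its derivatives.\<close>

lemma partial_conv:
  assumes "trig W K" and \<phi>: "\<phi> \<in> test_fun \<Omega>"
  shows "partial i (conv K \<phi>) = conv K (partial i \<phi>)"
  using assms(1)
proof (induction rule: trig.induct)
  case (wave \<xi>)
  have s: "smooth_on \<Omega> (wave (- \<xi>))" by (rule smooth_on_wave[OF open_\<Omega>])
  have "(LINT y|lebesgue_on \<Omega>. wave (- \<xi>) y * partial i \<phi> y) = - (LINT y|lebesgue_on \<Omega>. partial i (wave (- \<xi>)) y * \<phi> y)"
    by (rule integral_test_fun_parts(2)[OF open_\<Omega> bounded_\<Omega> s \<phi>])
  also have "\<dots> = (- \<i> * complex_of_real (\<xi> $ i)) * (LINT y|lebesgue_on \<Omega>. wave (- \<xi>) y * \<phi> y)"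
    by (simp add: partial_wave mult.assoc)
  finally have c: "(LINT y|lebesgue_on \<Omega>. wave (- \<xi>) y * partial i \<phi> y)
      = (- \<i> * complex_of_real (\<xi> $ i)) * (LINT y|lebesgue_on \<Omega>. wave (- \<xi>) y * \<phi> y)" .
  have "partial i (\<lambda>x. k * wave \<xi> x) x = k * ((- \<i> * complex_of_real (\<xi> $ i)) * wave \<xi> x)" for k x
    using partial_linear[OF bounded_linear_mult_right[of k] smooth_on_differentiable[OF smooth_on_wave[OF open_UNIV], of x], of i \<xi>]
    by (simp add: partial_wave)
  then show ?case unfolding conv_wave c by (auto simp: fun_eq_iff)
next
  case (lincomb f g a b)
  note f = smooth_on_continuous[OF smooth_on_trig[OF lincomb.hyps(1)]] and g = smooth_on_continuous[OF smooth_on_trig[OF lincomb.hyps(2)]]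
  note c\<phi> = smooth_on_continuous[OF test_funD(1)[OF \<phi>]] and c\<phi>' = smooth_on_continuous[OF smooth_on_partial[OF test_funD(1)[OF \<phi>]]]
  have d: "conv f \<phi> differentiable (at x)" "conv g \<phi> differentiable (at x)" for x
    using smooth_on_differentiable[OF smooth_on_trig[OF trig_conv[OF lincomb.hyps(1) c\<phi>]]]
      smooth_on_differentiable[OF smooth_on_trig[OF trig_conv[OF lincomb.hyps(2) c\<phi>]]] by auto
  have "partial i (\<lambda>x. a * conv f \<phi> x + b * conv g \<phi> x) x = a * partial i (conv f \<phi>) x + b * partial i (conv g \<phi>) x" for x
    using d[of x] partial_add[of "\<lambda>x. a * conv f \<phi> x" x "\<lambda>x. b * conv g \<phi> x" i]
      partial_linear[OF bounded_linear_mult_right d(1)[of x], of i a] partial_linear[OF bounded_linear_mult_right d(2)[of x], of i b]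
    by simp
  then show ?case
    unfolding conv_lincomb[OF f g c\<phi>] conv_lincomb[OF f g c\<phi>'] lincomb.IH[symmetric] by (rule ext)
qed

lemma partials_test_fun: "\<phi> \<in> test_fun \<Omega> \<Longrightarrow> partials is \<phi> \<in> test_fun \<Omega>"
  by (induction "is") (auto intro: test_fun_partial)

lemma partials_conv:
  assumes "trig W K" and \<phi>: "\<phi> \<in> test_fun \<Omega>"
  shows "partials is (conv K \<phi>) = conv K (partials is \<phi>)"
  by (induction "is") (simp_all add: partial_conv[OF assms(1) partials_test_fun[OF \<phi>]])

lemma lebesgue_on_ball_translation:
  fixes f :: "real^'n \<Rightarrow> real"
  assumes "f \<in> borel_measurable borel"
  shows "(LINT y|lebesgue_on (ball x \<rho>). f (y - x)) = (LINT z|lebesgue_on (ball 0 \<rho>). f z)"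
proof -
  have m: "(\<lambda>z. indicator (ball 0 \<rho>) z *\<^sub>R f z) \<in> borel_measurable borel"
    by (intro borel_measurable_scaleR borel_measurable_indicator assms) simp
  have "(LINT y|lebesgue_on (ball x \<rho>). f (y - x)) = (LINT y|lebesgue. indicator (ball x \<rho>) y *\<^sub>R f (y - x))"
    by (rule integral_restrict_space) simp
  also have "\<dots> = (LINT y|lebesgue. indicator (ball 0 \<rho>) (y + - x) *\<^sub>R f (y + - x))"
    by (rule Bochner_Integration.integral_cong[OF refl]) (simp add: indicator_def dist_norm norm_minus_commute)
  also have "\<dots> = (LINT z|lebesgue. indicator (ball 0 \<rho>) z *\<^sub>R f z)"
    by (rule lebesgue_integral_translation[OF m])
  also have "\<dots> = (LINT z|lebesgue_on (ball 0 \<rho>). f z)"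
    by (rule integral_restrict_space[symmetric]) simp
  finally show ?thesis .
qed

text \<open>The normalised powers of the bump kernel form an approximate identity on the ball that
  contains all differences of points of \<Omega>. The modulating wave has modulus 1 and equals 1 at
  the origin, so it spoils the approximation only by its variation near 0.\<close>

lemma trig_kernel_exists:
  obtains c K where "c \<noteq> 0" "\<And>m :: nat. trig (shifted_lattice c) (K m)"
    "\<And>\<phi> \<epsilon>. \<phi> \<in> test_fun \<Omega> \<Longrightarrow> 0 < \<epsilon> \<Longrightarrow> \<forall>\<^sub>F m in sequentially. \<forall>x\<in>\<Omega>. norm (\<phi> x - conv (K m) \<phi> x) \<le> \<epsilon>"
proof -
  obtain R where R: "R > 0" "\<Omega> \<subseteq> ball 0 R" using bounded_subset_ballD[OF bounded_\<Omega>, of 0] by auto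
  \<comment> \<open>Differences of points of \<Omega> are shorter than \<open>2 * R\<close>; the
    choice \<open>c = 1 / \<rho>\<close> keeps the ball of that radius in the range where the kernel
    is positive with a strict maximum at 0.\<close>
  define \<rho> where "\<rho> = 2 * R"
  have \<rho>: "\<rho> > 0" using R by (simp add: \<rho>_def)
  define c where "c = 1 / \<rho>"
  have c: "c \<noteq> 0" "c > 0" using \<rho> by (auto simp: c_def)
  define k where "k = (bump_kernel c :: real^'n \<Rightarrow> real)"
  have kc: "continuous_on UNIV k" unfolding k_def by (rule continuous_bump_kernel)
  have k0: "k 0 = 1" by (simp add: k_def bump_kernel_0)
  have cz: "\<bar>c\<bar> * norm z \<le> 1" if "z \<in> cball 0 \<rho>" for z :: "real^'n"
    using that \<rho> by (simp add: c_def)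
  have kpos: "0 < k z" if "z \<in> cball 0 \<rho>" for z unfolding k_def by (rule bump_kernel_bounds(1)[OF cz[OF that]])
  have klt: "k z < 1" if "z \<in> cball 0 \<rho>" "z \<noteq> 0" for z unfolding k_def by (rule bump_kernel_bounds(3)[OF cz[OF that(1)] c(1) that(2)])
  have kmin: "k (x - y) = k (y - x)" for x y using bump_kernel_minus[of c "x - y"] by (simp add: k_def)
  define g where "g = (wave (\<chi> j. c / 2) :: real^'n \<Rightarrow> complex)"
  have gc: "continuous_on UNIV g" unfolding g_def by (rule smooth_on_continuous[OF smooth_on_wave[OF open_UNIV]])
  have g0: "g 0 = 1" by (simp add: g_def wave_eq)
  have g1: "norm (g z) = 1" for z by (simp add: g_def norm_wave)
  define I where "I = (\<lambda>m. LINT z|lebesgue_on (ball 0 \<rho>). k z ^ m)"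
  have I: "0 < I m" for m unfolding I_def by (rule power_concentration(1)[OF kc k0 \<rho> kpos klt zero_less_one])
  define K where "K = (\<lambda>m z. complex_of_real (1 / I m) * (complex_of_real (k z ^ m) * g z))"
  have trigK: "trig (shifted_lattice c) (K m)" for m
    unfolding K_def k_def g_def by (rule trig_cmult[OF trig_bump_kernel_power])
  have approx: "\<forall>\<^sub>F m in sequentially. \<forall>x\<in>\<Omega>. norm (\<phi> x - conv (K m) \<phi> x) \<le> \<epsilon>"
    if \<phi>: "\<phi> \<in> test_fun \<Omega>" and \<epsilon>: "0 < \<epsilon>" for \<phi> \<epsilon>
  proof -
    note D = test_funD[OF \<phi>] and \<phi>c = smooth_on_continuous[OF test_funD(1)[OF \<phi>]]
    obtain B where B: "\<And>x. norm (\<phi> x) \<le> B" using test_fun_bounded[OF \<phi>] by blast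
    have B0: "0 \<le> B" using order.trans[OF norm_ge_zero B] .
    have "uniformly_continuous_on (cball 0 (R + \<rho>)) \<phi>"
      by (rule compact_uniformly_continuous[OF continuous_on_subset[OF \<phi>c]]) auto
    then obtain \<delta>1 where \<delta>1: "\<delta>1 > 0" "\<And>x y. x \<in> cball 0 (R + \<rho>) \<Longrightarrow> y \<in> cball 0 (R + \<rho>) \<Longrightarrow> dist y x < \<delta>1 \<Longrightarrow> dist (\<phi> y) (\<phi> x) < \<epsilon> / 4"
      using \<epsilon> unfolding uniformly_continuous_on_def by (metis divide_pos_pos zero_less_numeral)
    have "isCont g 0" using gc by (simp add: continuous_on_eq_continuous_at)
    then obtain \<delta>2 where \<delta>2: "\<delta>2 > 0" "\<And>z. dist z 0 < \<delta>2 \<Longrightarrow> dist (g z) (g 0) < \<epsilon> / (4 * (B + 1))"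
      using \<epsilon> B0 unfolding continuous_at_eps_delta by (metis divide_pos_pos mult_pos_pos zero_less_numeral add_nonneg_pos zero_less_one)
    define \<delta> where "\<delta> = min \<delta>1 \<delta>2"
    have \<delta>: "\<delta> > 0" using \<delta>1 \<delta>2 by (simp add: \<delta>_def)
    \<comment> \<open>A majorant of the integrand: a quarter of \<epsilon> from the continuity of
      \<phi>, a quarter from the wave, and the crude bound \<open>2 * B\<close> outside the small
      ball, where little mass remains.\<close>
    define w where "w = (\<lambda>z :: real^'n. \<epsilon> / 2 + 2 * B * indicator (- ball 0 \<delta>) z)"
    have pw: "norm (\<phi> x - g (x - y) * \<phi> y) \<le> w (y - x)" if x: "x \<in> \<Omega>" and y: "y \<in> ball x \<rho>" for x y
    proof (cases "y - x \<in> ball 0 \<delta>")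
      case True
      have xb: "x \<in> cball 0 (R + \<rho>)" using x R \<rho> by force
      have "norm y \<le> norm x + dist x y" using norm_triangle_ineq2[of y x] by (simp add: dist_norm norm_minus_commute)
      then have yb: "y \<in> cball 0 (R + \<rho>)" using x y R by force
      have dyx: "dist y x < \<delta>1" "dist (x - y) 0 < \<delta>2" using True by (auto simp: \<delta>_def dist_norm norm_minus_commute)
      have "norm (\<phi> x - g (x - y) * \<phi> y) \<le> norm (\<phi> x - \<phi> y) + norm (\<phi> y - g (x - y) * \<phi> y)"
        using norm_triangle_ineq[of "\<phi> x - \<phi> y" "\<phi> y - g (x - y) * \<phi> y"] by simp
      also have "\<phi> y - g (x - y) * \<phi> y = (g 0 - g (x - y)) * \<phi> y" by (simp add: g0 algebra_simps)
      also have "norm (\<phi> x - \<phi> y) + norm ((g 0 - g (x - y)) * \<phi> y) \<le> \<epsilon> / 4 + \<epsilon> / (4 * (B + 1)) * B"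
        unfolding norm_mult
        using \<delta>1(2)[OF xb yb dyx(1)] \<delta>2(2)[OF dyx(2)] B[of y] \<epsilon> B0
        by (intro add_mono mult_mono) (auto simp: dist_norm norm_minus_commute less_imp_le)
      also have "\<epsilon> / (4 * (B + 1)) * B \<le> \<epsilon> / 4"
        using \<epsilon> B0 by (simp add: field_simps)
      finally show ?thesis using True B0 by (simp add: w_def)
    next
      case False
      have "norm (\<phi> x - g (x - y) * \<phi> y) \<le> norm (\<phi> x) + norm (g (x - y) * \<phi> y)" by (rule norm_triangle_ineq4)
      also have "\<dots> \<le> B + B" using B[of x] B[of y] by (simp add: norm_mult g1)
      also have "\<dots> \<le> w (y - x)" using False \<epsilon> by (simp add: w_def)
      finally show ?thesis .
    qed
    define J where "J = (\<lambda>m. LINT z|lebesgue_on (ball 0 \<rho>). indicator (- ball 0 \<delta>) z * k z ^ m)"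
    have wb: "w \<in> borel_measurable borel" unfolding w_def by (intro borel_measurable_add borel_measurable_times borel_measurable_const borel_measurable_indicator) simp
    have kb: "k \<in> borel_measurable borel" by (rule borel_measurable_continuous_onI[OF kc])
    have err: "norm (\<phi> x - conv (K m) \<phi> x) \<le> \<epsilon> / 2 + 2 * B * (J m / I m)" if x: "x \<in> \<Omega>" for x m
    proof -
      let ?U = "ball x \<rho>"
      have \<Omega>U: "\<Omega> \<subseteq> ?U"
      proof
        fix y assume "y \<in> \<Omega>"
        then have "norm x < R" "norm y < R" using x R(2) by auto
        then show "y \<in> ?U" using norm_triangle_ineq4[of x y] by (simp add: dist_norm \<rho>_def)
      qed
      have U: "?U \<in> sets lebesgue" "bounded ?U" "?U \<in> lmeasurable" by auto
      have kx: "continuous_on UNIV (\<lambda>y. k (y - x))"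
        by (rule continuous_on_compose2[OF kc continuous_on_diff[OF continuous_on_id continuous_on_const]]) simp
      have gx: "continuous_on UNIV (\<lambda>y. g (x - y))"
        by (rule continuous_on_compose2[OF gc continuous_on_diff[OF continuous_on_const continuous_on_id]]) simp
      define p where "p = (\<lambda>z. k z ^ m / I m)"
      have pp: "0 \<le> p (y - x)" if "y \<in> ?U" for y
        unfolding p_def using kpos[of "y - x"] that I[of m]
        by (intro divide_nonneg_pos zero_le_power) (auto simp: dist_norm norm_minus_commute less_imp_le)
      have pb: "p \<in> borel_measurable borel" unfolding p_def using kb by measurable
      have px: "continuous_on UNIV (\<lambda>y. p (y - x))" unfolding p_def using I[of m] by (intro continuous_intros kx) auto
      have "(LINT y|lebesgue_on ?U. p (y - x)) = (LINT z|lebesgue_on (ball 0 \<rho>). p z)"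
        by (rule lebesgue_on_ball_translation[OF pb])
      also have "\<dots> = 1" unfolding p_def using I[of m] by (simp add: I_def)
      finally have one: "(LINT y|lebesgue_on ?U. p (y - x)) = 1" .
      have Kp: "K m (x - y) = complex_of_real (p (y - x)) * g (x - y)" for y
        by (simp add: K_def p_def kmin[of x y])
      have i1: "integrable (lebesgue_on ?U) (\<lambda>y. complex_of_real (p (y - x)) * \<phi> x)"
        by (rule integrable_lebesgue_on_continuous[OF _ U(2,1)]) (intro continuous_intros px)
      have i2: "integrable (lebesgue_on ?U) (\<lambda>y. complex_of_real (p (y - x)) * g (x - y) * \<phi> y)"
        by (rule integrable_lebesgue_on_continuous[OF _ U(2,1)]) (intro continuous_on_mult continuous_on_of_real px gx \<phi>c)
      \<comment> \<open>As \<phi> vanishes off \<Omega>, the integral may be taken over the ball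
        about \<open>x\<close>, on which the positive factor has total mass 1.\<close>
      have "conv (K m) \<phi> x = (LINT y|lebesgue. indicator \<Omega> y *\<^sub>R (complex_of_real (p (y - x)) * g (x - y) * \<phi> y))"
        unfolding conv_def Kp by (rule integral_restrict_space) (use sets_\<Omega> in simp)
      also have "\<dots> = (LINT y|lebesgue. indicator ?U y *\<^sub>R (complex_of_real (p (y - x)) * g (x - y) * \<phi> y))"
        by (rule Bochner_Integration.integral_cong[OF refl]) (use D(3,4) \<Omega>U in \<open>auto simp: indicator_def\<close>)
      also have "\<dots> = (LINT y|lebesgue_on ?U. complex_of_real (p (y - x)) * g (x - y) * \<phi> y)"
        by (rule integral_restrict_space[symmetric]) simp
      finally have cv: "conv (K m) \<phi> x = (LINT y|lebesgue_on ?U. complex_of_real (p (y - x)) * g (x - y) * \<phi> y)" .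
      have "(LINT y|lebesgue_on ?U. complex_of_real (p (y - x)) * \<phi> x) = (LINT y|lebesgue_on ?U. complex_of_real (p (y - x))) * \<phi> x"
        by simp
      also have "(LINT y|lebesgue_on ?U. complex_of_real (p (y - x))) = 1"
        unfolding integral_complex_of_real one by simp
      finally have "\<phi> x = (LINT y|lebesgue_on ?U. complex_of_real (p (y - x)) * \<phi> x)" by simp
      then have "\<phi> x - conv (K m) \<phi> x = (LINT y|lebesgue_on ?U. complex_of_real (p (y - x)) * \<phi> x - complex_of_real (p (y - x)) * g (x - y) * \<phi> y)"
        unfolding cv using Bochner_Integration.integral_diff[OF i1 i2] by simp
      then have "norm (\<phi> x - conv (K m) \<phi> x) \<le> (LINT y|lebesgue_on ?U. norm (complex_of_real (p (y - x)) * \<phi> x - complex_of_real (p (y - x)) * g (x - y) * \<phi> y))"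
        by (simp only:) (rule integral_norm_bound)
      also have "\<dots> \<le> (LINT y|lebesgue_on ?U. p (y - x) * w (y - x))"
      proof (rule integral_mono[OF integrable_norm[OF Bochner_Integration.integrable_diff[OF i1 i2]]])
        show "integrable (lebesgue_on ?U) (\<lambda>y. p (y - x) * w (y - x))"
        proof -
          have i: "integrable (lebesgue_on ?U) (\<lambda>y. p (y - x))"
            by (rule integrable_lebesgue_on_continuous[OF px U(2,1)])
          have "(\<lambda>y. w (y - x)) \<in> borel_measurable borel" using wb by measurable
          then have "(\<lambda>y. w (y - x)) \<in> borel_measurable lebesgue" by (simp add: measurable_completion)
          then have mw: "(\<lambda>y. w (y - x)) \<in> borel_measurable (lebesgue_on ?U)" by (rule measurable_restrict_space1)
          show ?thesis
          proof (rule Bochner_Integration.integrable_bound)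
            show "integrable (lebesgue_on ?U) (\<lambda>y. p (y - x) * (\<epsilon> / 2 + 2 * B))" using i by simp
            show "(\<lambda>y. p (y - x) * w (y - x)) \<in> borel_measurable (lebesgue_on ?U)"
              by (rule borel_measurable_times[OF borel_measurable_integrable[OF i] mw])
            show "AE y in lebesgue_on ?U. norm (p (y - x) * w (y - x)) \<le> norm (p (y - x) * (\<epsilon> / 2 + 2 * B))"
            proof (rule AE_I2)
              fix y
              have "\<bar>w (y - x)\<bar> \<le> \<bar>\<epsilon> / 2 + 2 * B\<bar>" using \<epsilon> B0 by (auto simp: w_def indicator_def)
              then show "norm (p (y - x) * w (y - x)) \<le> norm (p (y - x) * (\<epsilon> / 2 + 2 * B))"
                unfolding real_norm_def abs_mult by (rule mult_left_mono) simp
            qed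
          qed
        qed
        fix y assume "y \<in> space (lebesgue_on ?U)"
        then have y: "y \<in> ?U" by simp
        have "norm (complex_of_real (p (y - x)) * \<phi> x - complex_of_real (p (y - x)) * g (x - y) * \<phi> y)
            = norm (complex_of_real (p (y - x)) * (\<phi> x - g (x - y) * \<phi> y))" by (simp add: algebra_simps)
        also have "\<dots> = p (y - x) * norm (\<phi> x - g (x - y) * \<phi> y)" using pp[OF y] by (simp add: norm_mult)
        also have "\<dots> \<le> p (y - x) * w (y - x)" by (rule mult_left_mono[OF pw[OF x y] pp[OF y]])
        finally show "norm (complex_of_real (p (y - x)) * \<phi> x - complex_of_real (p (y - x)) * g (x - y) * \<phi> y) \<le> p (y - x) * w (y - x)" .
      qed
      also have "\<dots> = (LINT z|lebesgue_on (ball 0 \<rho>). p z * w z)"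
        by (rule lebesgue_on_ball_translation) (use pb wb in measurable)
      also have "\<dots> = (LINT z|lebesgue_on (ball 0 \<rho>). \<epsilon> / 2 * p z + 2 * B / I m * (indicator (- ball 0 \<delta>) z * k z ^ m))"
        by (rule Bochner_Integration.integral_cong[OF refl]) (simp add: w_def p_def algebra_simps)
      also have "\<dots> = \<epsilon> / 2 * (LINT z|lebesgue_on (ball 0 \<rho>). p z) + 2 * B / I m * J m"
      proof -
        have b: "ball (0 :: real^'n) \<rho> \<in> sets lebesgue" "bounded (ball (0 :: real^'n) \<rho>)" by auto
        have pc: "continuous_on UNIV p" unfolding p_def using I[of m] by (intro continuous_intros kc) auto
        have j1: "integrable (lebesgue_on (ball 0 \<rho>)) p"
          by (rule integrable_lebesgue_on_continuous[OF pc b(2,1)])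
        have j2: "integrable (lebesgue_on (ball 0 \<rho>)) (\<lambda>z. k z ^ m)"
          by (rule integrable_lebesgue_on_continuous[OF _ b(2,1)]) (intro continuous_intros kc)
        have mi: "indicat_real (- ball 0 \<delta>) \<in> borel_measurable (lebesgue_on (ball (0 :: real^'n) \<rho>))"
          by (rule measurable_restrict_space1) (simp add: borel_measurable_indicator)
        have j3: "integrable (lebesgue_on (ball 0 \<rho>)) (\<lambda>z. indicator (- ball 0 \<delta>) z * k z ^ m)"
          by (rule Bochner_Integration.integrable_bound[OF j2 borel_measurable_times[OF mi borel_measurable_integrable[OF j2]]])
            (auto simp: indicator_def)
        show ?thesis using j1 j3 by (simp add: J_def)
      qed
      also have "(LINT z|lebesgue_on (ball 0 \<rho>). p z) = 1" unfolding p_def using I[of m] by (simp add: I_def)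
      finally show ?thesis by simp
    qed
    have "(\<lambda>m. J m / I m) \<longlonglongrightarrow> 0"
      unfolding J_def I_def by (rule power_concentration(2)[OF kc k0 \<rho> kpos klt \<delta>])
    from tendsto_mult_right_zero[OF this, of "2 * B"]
    have "\<forall>\<^sub>F m in sequentially. 2 * B * (J m / I m) < \<epsilon> / 2"
      by (rule order_tendstoD(2)) (use \<epsilon> in simp)
    then show ?thesis
    proof (rule eventually_mono)
      fix m assume m: "2 * B * (J m / I m) < \<epsilon> / 2"
      show "\<forall>x\<in>\<Omega>. norm (\<phi> x - conv (K m) \<phi> x) \<le> \<epsilon>"
      proof
        fix x assume "x \<in> \<Omega>"
        from err[OF this, of m] m show "norm (\<phi> x - conv (K m) \<phi> x) \<le> \<epsilon>" by linarith
      qed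
    qed
  qed
  show ?thesis by (rule that[OF c(1) trigK approx])
qed

text \<open>There are finitely many index lists of length at most \<open>N\<close>, so one index
  \<open>m\<close> serves all these derivatives, each of which is itself a test function
  approximated by its convolution.\<close>

lemma trig_dense:
  assumes \<phi>: "\<phi> \<in> test_fun \<Omega>" and \<epsilon>: "0 < \<epsilon>"
  shows "\<exists>\<psi>. trig {\<xi>. \<xi> \<noteq> 0} \<psi> \<and> (\<forall>is. length is \<le> N \<longrightarrow> (\<forall>x\<in>\<Omega>. norm (partials is (\<lambda>x. \<phi> x - \<psi> x) x) \<le> \<epsilon>))"
proof -
  obtain c K where c: "c \<noteq> 0" and trigK: "\<And>m :: nat. trig (shifted_lattice c) (K m)"
    and app: "\<And>\<phi> \<epsilon>. \<phi> \<in> test_fun \<Omega> \<Longrightarrow> 0 < \<epsilon> \<Longrightarrow> \<forall>\<^sub>F m in sequentially. \<forall>x\<in>\<Omega>. norm (\<phi> x - conv (K m) \<phi> x) \<le> \<epsilon>"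
    by (rule trig_kernel_exists) (rule that)
  have "finite {is :: 'n list. length is \<le> N}" using finite_lists_length_le[of "UNIV :: 'n set" N] by simp
  then have "\<forall>\<^sub>F m in sequentially. \<forall>is\<in>{is :: 'n list. length is \<le> N}. \<forall>x\<in>\<Omega>. norm (partials is \<phi> x - conv (K m) (partials is \<phi>) x) \<le> \<epsilon>"
    by (rule eventually_ball_finite) (use app[OF partials_test_fun[OF \<phi>] \<epsilon>] in blast)
  then obtain m where m: "\<And>is x. length is \<le> N \<Longrightarrow> x \<in> \<Omega> \<Longrightarrow> norm (partials is \<phi> x - conv (K m) (partials is \<phi>) x) \<le> \<epsilon>"
    unfolding eventually_sequentially by auto
  have t: "trig (shifted_lattice c) (conv (K m) \<phi>)"
    by (rule trig_conv[OF trigK smooth_on_continuous[OF test_funD(1)[OF \<phi>]]])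
  have mono: "trig {\<xi>. \<xi> \<noteq> 0} f" if "trig (shifted_lattice c) f" for f
    using that
  proof (induction rule: trig.induct)
    case (wave \<xi>)
    then show ?case by (intro trig.wave) (use shifted_lattice_nonzero[OF c] in auto)
  qed (rule trig.lincomb)
  have "partials is (\<lambda>x. \<phi> x - conv (K m) \<phi> x) x = partials is \<phi> x - conv (K m) (partials is \<phi>) x" for "is" x
    by (simp add: partials_diff[OF test_funD(1)[OF \<phi>] smooth_on_trig[OF t]] partials_conv[OF trigK \<phi>])
  then show ?thesis using mono[OF t] m by auto
qed

text \<open>Both functionals are bounded by finitely many derivatives on \<Omega>, and in that sense
  test functions are limits of trigonometric sums. The claim is about decompositions because waves
  are not test functions, so the distribution itself has no meaning on them.\<close>

lemma pairing_determined_by_waves: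
  assumes D: "fst D \<in> L1 \<Omega>" "snd D \<in> E_prime \<Omega>" and D': "fst D' \<in> L1 \<Omega>" "snd D' \<in> E_prime \<Omega>"
    and eq: "\<And>\<xi>. \<xi> \<noteq> 0 \<Longrightarrow> pairing D (wave \<xi>) = pairing D' (wave \<xi>)" and \<phi>: "\<phi> \<in> test_fun \<Omega>"
  shows "pairing D \<phi> = pairing D' \<phi>"
proof -
  have trig_eq: "pairing D \<psi> = pairing D' \<psi>" if "trig {\<xi>. \<xi> \<noteq> 0} \<psi>" for \<psi>
    using that
  proof (induction rule: trig.induct)
    case (lincomb f g a b)
    then show ?case
      using pairing_lincomb[OF D smooth_on_trig smooth_on_trig, of _ f _ g a b]
        pairing_lincomb[OF D' smooth_on_trig smooth_on_trig, of _ f _ g a b] by simp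
  qed (use eq in auto)
  obtain C N where C: "\<And>\<phi> M. smooth_on UNIV \<phi> \<Longrightarrow> (\<forall>is. length is \<le> N \<longrightarrow> (\<forall>x\<in>\<Omega>. norm (partials is \<phi> x) \<le> M)) \<Longrightarrow> 0 \<le> M \<Longrightarrow>
    norm (pairing D \<phi>) \<le> C * M" using pairing_bound[OF D] by blast
  obtain C' N' where C': "\<And>\<phi> M. smooth_on UNIV \<phi> \<Longrightarrow> (\<forall>is. length is \<le> N' \<longrightarrow> (\<forall>x\<in>\<Omega>. norm (partials is \<phi> x) \<le> M)) \<Longrightarrow> 0 \<le> M \<Longrightarrow>
    norm (pairing D' \<phi>) \<le> C' * M" using pairing_bound[OF D'] by blast
  have bound: "norm (pairing D \<phi> - pairing D' \<phi>) \<le> (\<bar>C\<bar> + \<bar>C'\<bar>) * e" if e: "0 < e" for e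
  proof -
    obtain \<psi> where \<psi>: "trig {\<xi>. \<xi> \<noteq> 0} \<psi>"
      "\<forall>is. length is \<le> max N N' \<longrightarrow> (\<forall>x\<in>\<Omega>. norm (partials is (\<lambda>x. \<phi> x - \<psi> x) x) \<le> e)"
      using trig_dense[OF \<phi> e, of "max N N'"] by blast
    note s\<phi> = test_funD(1)[OF \<phi>] and s\<psi> = smooth_on_trig[OF \<psi>(1)]
    have s: "smooth_on UNIV (\<lambda>x. \<phi> x - \<psi> x)" by (rule smooth_on_diff[OF open_UNIV s\<phi> s\<psi>])
    have "pairing D \<phi> - pairing D' \<phi> = (pairing D \<phi> - pairing D \<psi>) - (pairing D' \<phi> - pairing D' \<psi>)"
      using trig_eq[OF \<psi>(1)] by simp
    also have "\<dots> = pairing D (\<lambda>x. \<phi> x - \<psi> x) - pairing D' (\<lambda>x. \<phi> x - \<psi> x)"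
      using pairing_lincomb[OF D s\<phi> s\<psi>, of 1 "-1"] pairing_lincomb[OF D' s\<phi> s\<psi>, of 1 "-1"] by simp
    finally have "norm (pairing D \<phi> - pairing D' \<phi>) \<le> norm (pairing D (\<lambda>x. \<phi> x - \<psi> x)) + norm (pairing D' (\<lambda>x. \<phi> x - \<psi> x))"
      by (simp only: norm_triangle_ineq4)
    also have "\<dots> \<le> C * e + C' * e"
      by (intro add_mono C[OF s] C'[OF s]) (use \<psi>(2) e in auto)
    also have "\<dots> \<le> (\<bar>C\<bar> + \<bar>C'\<bar>) * e"
      unfolding distrib_right using e by (intro add_mono mult_right_mono) auto
    finally show ?thesis .
  qed
  have "norm (pairing D \<phi> - pairing D' \<phi>) \<le> 0"
  proof (rule field_le_epsilon)
    fix d :: real assume d: "0 < d"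
    define b where "b = \<bar>C\<bar> + \<bar>C'\<bar>"
    have b: "0 \<le> b" by (simp add: b_def)
    have "norm (pairing D \<phi> - pairing D' \<phi>) \<le> b * (d / (b + 1))" using bound[of "d / (b + 1)"] b d by (simp add: b_def)
    also have "\<dots> \<le> d" using b d by (simp add: field_simps)
    finally show "norm (pairing D \<phi> - pairing D' \<phi>) \<le> 0 + d" by simp
  qed
  then show ?thesis by simp
qed

end

section \<open>Exponential solutions\<close>

lemma bdot_cvec_combination:
  fixes x y :: "real^'n::finite"
  shows "bdot (a *s cvec x + b *s cvec y) (a *s cvec x + b *s cvec y)
    = a\<^sup>2 * complex_of_real (x \<bullet> x) + 2 * a * b * complex_of_real (x \<bullet> y) + b\<^sup>2 * complex_of_real (y \<bullet> y)"
  by (simp add: bdot_def cvec_def inner_vec_def sum_distrib_left sum.distrib[symmetric])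
    (intro sum.cong refl, simp add: power2_eq_square algebra_simps)

text \<open>In dimension at least 2 there is a vector \<open>v\<close> orthogonal to \<xi> and of
  the same length. In the squares of \<open>(v - i \<xi>) / 2\<close> and
  \<open>(- v - i \<xi>) / 2\<close> the cross terms vanish and the two lengths cancel.\<close>

lemma isotropic_pair_exists:
  fixes \<xi> :: "real^'n::finite"
  assumes "CARD('n) \<ge> 2"
  obtains \<eta>1 \<eta>2 where "bdot \<eta>1 \<eta>1 = 0" "bdot \<eta>2 \<eta>2 = 0" "\<eta>1 + \<eta>2 = - \<i> *s cvec \<xi>"
proof -
  obtain y :: "real^'n" where y: "y \<noteq> 0" "orthogonal \<xi> y"
    using orthogonal_to_vector_exists[of \<xi>] assms by auto
  define v where "v = (norm \<xi> / norm y) *\<^sub>R y"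
  have vv: "v \<bullet> v = \<xi> \<bullet> \<xi>"
  proof -
    have "norm v = norm \<xi>" using y(1) by (simp add: v_def)
    then show ?thesis by (simp add: power2_norm_eq_inner[symmetric])
  qed
  have v\<xi>: "v \<bullet> \<xi> = 0" using y(2) by (simp add: v_def orthogonal_def inner_commute)
  show ?thesis
  proof (rule that[of "(1/2) *s cvec v + (- \<i> / 2) *s cvec \<xi>" "(- 1/2) *s cvec v + (- \<i> / 2) *s cvec \<xi>"])
    show "bdot ((1/2) *s cvec v + (- \<i> / 2) *s cvec \<xi>) ((1/2) *s cvec v + (- \<i> / 2) *s cvec \<xi>) = 0"
      "bdot ((- 1/2) *s cvec v + (- \<i> / 2) *s cvec \<xi>) ((- 1/2) *s cvec v + (- \<i> / 2) *s cvec \<xi>) = 0"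
      unfolding bdot_cvec_combination vv v\<xi> by (simp_all add: power2_eq_square)
    show "(1/2) *s cvec v + (- \<i> / 2) *s cvec \<xi> + ((- 1/2) *s cvec v + (- \<i> / 2) *s cvec \<xi>) = - \<i> *s cvec \<xi>"
      by (simp add: vec_eq_iff cvec_def)
  qed
qed

lemma bdot_isotropic_pair:
  fixes \<xi> :: "real^'n::finite"
  assumes "bdot \<eta>1 \<eta>1 = 0" "bdot \<eta>2 \<eta>2 = 0" "\<eta>1 + \<eta>2 = - \<i> *s cvec \<xi>"
  shows "bdot \<eta>1 \<eta>2 = - complex_of_real ((norm \<xi>)\<^sup>2) / 2"
proof -
  have "bdot (\<eta>1 + \<eta>2) (\<eta>1 + \<eta>2) = bdot \<eta>1 \<eta>1 + 2 * bdot \<eta>1 \<eta>2 + bdot \<eta>2 \<eta>2"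
    by (simp add: bdot_def algebra_simps sum.distrib sum_distrib_left)
  then have "2 * bdot \<eta>1 \<eta>2 = bdot (- \<i> *s cvec \<xi>) (- \<i> *s cvec \<xi>)" using assms by simp
  also have "\<dots> = - complex_of_real ((norm \<xi>)\<^sup>2)"
    using bdot_cvec_combination[of "- \<i>" \<xi> 0 0] by (simp add: power2_norm_eq_inner)
  finally have two: "2 * bdot \<eta>1 \<eta>2 = - complex_of_real ((norm \<xi>)\<^sup>2)" .
  have "bdot \<eta>1 \<eta>2 = 2 * bdot \<eta>1 \<eta>2 / 2" by simp
  then show ?thesis unfolding two .
qed

lemma e_exp_add: "e_exp (a + b) x = e_exp a x * e_exp b x"
  by (simp add: e_exp_def bdot_def distrib_right sum.distrib exp_add)

lemma cgrad_e_exp: "cgrad (e_exp \<eta>) x = e_exp \<eta> x *s \<eta>"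
  by (simp add: cgrad_def vec_eq_iff partial_e_exp)

lemma bdot_cgrad_e_exp: "bdot (cgrad (e_exp a) x) (cgrad (e_exp b) x) = bdot a b * e_exp (a + b) x"
  by (simp add: cgrad_e_exp e_exp_add bdot_def sum_distrib_left sum_distrib_right mult_ac)

lemma harmonic_e_exp:
  assumes "bdot \<eta> \<eta> = 0"
  shows "(\<Sum>i\<in>UNIV. partial i (partial i (e_exp \<eta>)) x) = 0"
proof -
  have "partial i (partial i (e_exp \<eta>)) x = \<eta> $ i * (\<eta> $ i * e_exp \<eta> x)" for i
    using partial_linear[OF bounded_linear_mult_right[of "\<eta> $ i"] smooth_on_differentiable[OF smooth_on_e_exp[OF open_UNIV], of x], of i \<eta>]
    by (simp add: partial_e_exp)
  then have "(\<Sum>i\<in>UNIV. partial i (partial i (e_exp \<eta>)) x) = bdot \<eta> \<eta> * e_exp \<eta> x"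
    by (simp add: bdot_def sum_distrib_right mult.assoc)
  then show ?thesis using assms by simp
qed

context smooth_domain
begin

section \<open>Boundary data at isotropic exponentials\<close>

lemma e_exp_H_half: "e_exp \<eta> \<in> H_half \<Omega>"
  using has_trace_smooth[OF smooth_on_e_exp[OF open_UNIV]] by (auto simp: H_half_def)

lemma sol_e_exp_gradient:
  assumes "bdot \<eta> \<eta> = 0"
  shows "sol \<Omega> (\<lambda>_. 1) (e_exp \<eta>) \<in> H1 \<Omega>"
    "AE x in lebesgue_on \<Omega>. wgrad \<Omega> (sol \<Omega> (\<lambda>_. 1) (e_exp \<eta>)) x = cgrad (e_exp \<eta>) x"
proof -
  note h = smooth_on_e_exp[OF open_UNIV, of \<eta>] harmonic_e_exp[OF assms]
  have "weak_solution \<Omega> (\<lambda>_. 1) (e_exp \<eta>) (sol \<Omega> (\<lambda>_. 1) (e_exp \<eta>))"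
    unfolding sol_def by (rule someI[where P="weak_solution \<Omega> (\<lambda>_. 1) (e_exp \<eta>)", OF weak_solution_harmonic[OF h]])
  then show "sol \<Omega> (\<lambda>_. 1) (e_exp \<eta>) \<in> H1 \<Omega>" by (simp add: weak_solution_def)
  show "AE x in lebesgue_on \<Omega>. wgrad \<Omega> (sol \<Omega> (\<lambda>_. 1) (e_exp \<eta>)) x = cgrad (e_exp \<eta>) x"
    by (rule sol_harmonic[OF h])
qed

text \<open>For the decomposition \<open>D\<close> chosen by \<open>dPhi1\<close>, the function part
  needs the gradients of the solutions almost everywhere and the distributional part needs them
  pointwise. Both parts reduce to the pairing of \<open>D\<close> with one exponential, which is the
  Fourier transform.\<close>

lemma dPhi1_e_exp:
  assumes T: "T \<in> plus_E_prime (Linf \<Omega>) \<Omega>"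
    and \<eta>: "bdot \<eta>1 \<eta>1 = 0" "bdot \<eta>2 \<eta>2 = 0" "\<eta>1 + \<eta>2 = - \<i> *s cvec \<xi>"
  shows "dPhi1 \<Omega> T (e_exp \<eta>2) (e_exp \<eta>1) = bdot \<eta>1 \<eta>2 * fourier \<Omega> T \<xi>"
proof -
  define D where "D = (SOME D. decomposition (Linf \<Omega>) \<Omega> T D)"
  have "\<exists>D. decomposition (Linf \<Omega>) \<Omega> T D" using T by (simp add: plus_E_prime_def)
  from someI_ex[OF this] have D: "decomposition (Linf \<Omega>) \<Omega> T D" by (simp add: D_def)
  note DL = decompositionD[OF D]
  have Fm: "fst D \<in> borel_measurable (lebesgue_on \<Omega>)" using DL(1) by (simp add: Linf_def)
  let ?e = "e_exp (\<eta>1 + \<eta>2)" and ?b = "bdot \<eta>1 \<eta>2"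
  note s1 = sol_e_exp_gradient[OF \<eta>(1)] and s2 = sol_e_exp_gradient[OF \<eta>(2)]
  have se: "smooth_on UNIV ?e" by (rule smooth_on_e_exp[OF open_UNIV])
  have "dPhi1_Linf \<Omega> (fst D) (e_exp \<eta>2) (e_exp \<eta>1) = (LINT x|lebesgue_on \<Omega>. ?b * (fst D x * ?e x))"
    unfolding dPhi1_Linf_def
  proof (rule integral_cong_AE)
    show "AE x in lebesgue_on \<Omega>. fst D x * bdot (wgrad \<Omega> (sol \<Omega> (\<lambda>_. 1) (e_exp \<eta>1)) x) (wgrad \<Omega> (sol \<Omega> (\<lambda>_. 1) (e_exp \<eta>2)) x)
        = ?b * (fst D x * ?e x)"
      using s1(2) s2(2) by eventually_elim (simp add: bdot_cgrad_e_exp)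
    show "(\<lambda>x. fst D x * bdot (wgrad \<Omega> (sol \<Omega> (\<lambda>_. 1) (e_exp \<eta>1)) x) (wgrad \<Omega> (sol \<Omega> (\<lambda>_. 1) (e_exp \<eta>2)) x)) \<in> borel_measurable (lebesgue_on \<Omega>)"
      by (rule borel_measurable_times[OF Fm borel_measurable_integrable[OF integrable_wgrad_product[OF s1(1) s2(1)]]])
    show "(\<lambda>x. ?b * (fst D x * ?e x)) \<in> borel_measurable (lebesgue_on \<Omega>)"
      by (intro borel_measurable_times borel_measurable_const Fm
          borel_measurable_lebesgue_on_continuous[OF smooth_on_continuous[OF se] sets_\<Omega>])
  qed
  then have a: "dPhi1_Linf \<Omega> (fst D) (e_exp \<eta>2) (e_exp \<eta>1) = ?b * (LINT x|lebesgue_on \<Omega>. fst D x * ?e x)" by simp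
  \<comment> \<open>The zero summand gives the argument the shape of
    \<open>E_pair_lincomb\<close>.\<close>
  have "dPhi1_E \<Omega> (snd D) (e_exp \<eta>2) (e_exp \<eta>1) = E_pair \<Omega> (snd D) (\<lambda>x. ?b * ?e x + 0 * ?e x)"
    unfolding dPhi1_E_def
  proof (rule E_pair_cong[OF DL(2) open_\<Omega>])
    fix x assume x: "x \<in> \<Omega>"
    show "bdot (cgrad (harmonic_sol \<Omega> (e_exp \<eta>1)) x) (cgrad (harmonic_sol \<Omega> (e_exp \<eta>2)) x) = ?b * ?e x + 0 * ?e x"
      by (simp add: harmonic_sol_gradient[OF smooth_on_e_exp[OF open_UNIV] harmonic_e_exp[OF \<eta>(1)] x]
          harmonic_sol_gradient[OF smooth_on_e_exp[OF open_UNIV] harmonic_e_exp[OF \<eta>(2)] x] bdot_cgrad_e_exp)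
  qed
  also have "\<dots> = ?b * E_pair \<Omega> (snd D) ?e"
    using E_pair_lincomb[OF DL(2) open_\<Omega> smooth_on_subset[OF se] smooth_on_subset[OF se], of ?b 0] by simp
  finally have b: "dPhi1_E \<Omega> (snd D) (e_exp \<eta>2) (e_exp \<eta>1) = ?b * E_pair \<Omega> (snd D) ?e" .
  have "dPhi1 \<Omega> T (e_exp \<eta>2) (e_exp \<eta>1) = dPhi1_Linf \<Omega> (fst D) (e_exp \<eta>2) (e_exp \<eta>1) + dPhi1_E \<Omega> (snd D) (e_exp \<eta>2) (e_exp \<eta>1)"
    unfolding dPhi1_def D_def[symmetric] Let_def case_prod_unfold ..
  also have "\<dots> = ?b * pairing D ?e" unfolding a b pairing_def by (simp add: distrib_left)
  also have "pairing D ?e = fourier \<Omega> T \<xi>"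
    unfolding \<eta>(3) by (rule fourier_eq_pairing[OF decomposition_L1[OF D], symmetric])
  finally show ?thesis .
qed

text \<open>The operator identity is evaluated at two exponentials, which belong to
  \<open>H_half\<close>, and divided by their product \<open>bdot \<eta>1 \<eta>2\<close>, nonzero
  because \<xi> is.\<close>

lemma fourier_formula:
  assumes T: "T \<in> plus_E_prime (Linf \<Omega>) \<Omega>" and same: "same_operator \<Omega> (dPhi1 \<Omega> T) \<Lambda>"
    and \<xi>: "\<xi> \<noteq> 0" and \<eta>: "bdot \<eta>1 \<eta>1 = 0" "bdot \<eta>2 \<eta>2 = 0" "\<eta>1 + \<eta>2 = - \<i> *s cvec \<xi>"
  shows "fourier \<Omega> T \<xi> = - complex_of_real (2 / (norm \<xi>)\<^sup>2) * bpair (e_exp \<eta>1) (\<Lambda> (e_exp \<eta>2))"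
proof -
  have "bpair (e_exp \<eta>1) (\<Lambda> (e_exp \<eta>2)) = bpair (e_exp \<eta>1) (dPhi1 \<Omega> T (e_exp \<eta>2))"
    using same e_exp_H_half unfolding same_operator_def by metis
  also have "\<dots> = - complex_of_real ((norm \<xi>)\<^sup>2) / 2 * fourier \<Omega> T \<xi>"
    unfolding bpair_def dPhi1_e_exp[OF T \<eta>] bdot_isotropic_pair[OF \<eta>] ..
  finally show ?thesis using \<xi> by simp
qed

text \<open>Isotropic pairs exist for each nonzero frequency, so the formula makes the two Fourier
  transforms agree there; trigonometric sums without constant term carry the equality over to test
  functions.\<close>

lemma dPhi1_injective:
  assumes T: "T \<in> plus_E_prime (Linf \<Omega>) \<Omega>" "same_operator \<Omega> (dPhi1 \<Omega> T) \<Lambda>"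
    and T': "T' \<in> plus_E_prime (Linf \<Omega>) \<Omega>" "same_operator \<Omega> (dPhi1 \<Omega> T') \<Lambda>"
  shows "distribution_eq \<Omega> T T'"
proof -
  obtain D where D: "decomposition (L1 \<Omega>) \<Omega> T D" using T(1) decomposition_L1 unfolding plus_E_prime_def by blast
  obtain D' where D': "decomposition (L1 \<Omega>) \<Omega> T' D'" using T'(1) decomposition_L1 unfolding plus_E_prime_def by blast
  have w: "pairing D (wave \<xi>) = pairing D' (wave \<xi>)" if \<xi>: "\<xi> \<noteq> 0" for \<xi>
  proof -
    obtain \<eta>1 \<eta>2 where \<eta>: "bdot \<eta>1 \<eta>1 = 0" "bdot \<eta>2 \<eta>2 = 0" "\<eta>1 + \<eta>2 = - \<i> *s cvec \<xi>"
      by (rule isotropic_pair_exists[OF dim_ge_2])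
    have "fourier \<Omega> T \<xi> = fourier \<Omega> T' \<xi>"
      unfolding fourier_formula[OF T \<xi> \<eta>] fourier_formula[OF T' \<xi> \<eta>] ..
    then show ?thesis unfolding wave_def fourier_eq_pairing[OF D] fourier_eq_pairing[OF D'] .
  qed
  show ?thesis
    unfolding distribution_eq_def
  proof
    fix \<phi> assume \<phi>: "\<phi> \<in> test_fun \<Omega>"
    have "pairing D \<phi> = pairing D' \<phi>"
      by (rule pairing_determined_by_waves[OF decompositionD(1,2)[OF D] decompositionD(1,2)[OF D'] w \<phi>])
    then show "T \<phi> = T' \<phi>" by (simp only: pairing_test_fun[OF D \<phi>] pairing_test_fun[OF D' \<phi>])
  qed
qed

end

theorem theorem2p7:
  fixes \<Omega> :: "(real^'n::finite) set" and \<gamma> :: "real^'n \<Rightarrow> real"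
  assumes "CARD('n) \<ge> 2"
    and "bounded_smooth_domain \<Omega>"
    and "conductivity \<Omega> \<gamma>"
  shows "(\<forall>\<gamma>B \<in> plus_E_prime (Linf \<Omega>) \<Omega>. same_operator \<Omega> (dPhi1 \<Omega> \<gamma>B) (DN_map \<Omega> \<gamma>) \<longrightarrow>
            (\<forall>\<xi> :: real^'n. \<forall>\<eta>1 \<eta>2 :: complex^'n.
               \<xi> \<noteq> 0 \<and> bdot \<eta>1 \<eta>1 = 0 \<and> bdot \<eta>2 \<eta>2 = 0 \<and> \<eta>1 + \<eta>2 = - \<i> *s cvec \<xi> \<longrightarrow>
               fourier \<Omega> \<gamma>B \<xi> =
                 - complex_of_real (2 / (norm \<xi>)\<^sup>2) * bpair (e_exp \<eta>1) (DN_map \<Omega> \<gamma> (e_exp \<eta>2))))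
       \<and> (\<forall>\<gamma>B \<in> plus_E_prime (Linf \<Omega>) \<Omega>. \<forall>\<gamma>B' \<in> plus_E_prime (Linf \<Omega>) \<Omega>.
            same_operator \<Omega> (dPhi1 \<Omega> \<gamma>B) (DN_map \<Omega> \<gamma>) \<and>
            same_operator \<Omega> (dPhi1 \<Omega> \<gamma>B') (DN_map \<Omega> \<gamma>) \<longrightarrow>
            distribution_eq \<Omega> \<gamma>B \<gamma>B')"
proof -
  interpret smooth_domain \<Omega>
    by unfold_locales (use assms in \<open>auto simp: bounded_smooth_domain_def\<close>)
  show ?thesis
    using fourier_formula dPhi1_injective by blast
qed

end
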